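(* Let $T$ be a $G_0$-symmetric operator in $\mathcal H$ and let $J\subset\mathbb R$ be a bounded or unbounded open interval which is of positive (resp. negative) type with respect to $T$. Assume that each of the sets $\mathbb C^+\cap\rho(T)$ and $\mathbb C^-\cap\rho(T)$ has an accumulation point in $J$. Then $T$ has a local spectral function $E$ on $J$ without critical points (i.e. with $s=\emptyset$) such that for every $\Delta\in\mathfrak R(J)$: (i) the subspace $E(\Delta)\mathcal H$ is uniformly positive (resp. uniformly negative); (ii) the projection $E(\Delta)$ is $G_0$-symmetric, i.e. $[E(\Delta)x,y]=[x,E(\Delta)y]$ for all $x,y\in\mathcal H$; (iii) if $\Delta$ is compact, then $E(\Delta)\mathcal H$ is the maximal spectral subspace of $T$ corresponding to $\Delta$.
   Context: $(\mathcal H,(\cdot,\cdot))$ is a complex Hilbert space, $G_0$ a bounded selfadjoint operator in $\mathcal H$, $[x,y]:=(G_0x,y)$. For a linear operator $S$, $\rho(S)$ is the set of $\lambda\in\mathbb C$ with $S-\lambda$ injective, surjective and $(S-\lambda)^{-1}$ bounded; $\sigma(S)=\mathbb C\setminus\rho(S)$. The approximate point spectrum $\sigma_{ap}(S)$ is the set of $\lambda$ for which there is $(x_n)\subset\operatorname{dom}S$ with $\|x_n\|=1$ and $(S-\lambda)x_n\to0$. A closed densely defined operator $T$ is $G_0$-symmetric if $[Tx,y]=[x,Ty]$ for all $x,y\in\operatorname{dom}T$. A point $\lambda\in\sigma_{ap}(T)$ is a spectral point of positive (negative) type of $T$ if for every sequence $(x_n)\subset\operatorname{dom}T$ with $\|x_n\|=1$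 and $(T-\lambda)x_n\to0$ one has $\liminf_n[x_n,x_n]>0$ (resp. $\limsup_n[x_n,x_n]<0$); the sets of such points are $\sigma_{++}(T)$, $\sigma_{--}(T)$. A set $\Delta\subset\mathbb C$ is of positive (negative) type with respect to $T$ if $\Delta\cap\sigma_{ap}(T)\subset\sigma_{++}(T)$ (resp. $\subset\sigma_{--}(T)$). $\mathbb C^\pm$ are the open upper/lower half planes. A subspace $\mathcal L$ is uniformly positive (negative) if there is $\delta>0$ with $[x,x]\ge\delta\|x\|^2$ (resp. $[x,x]\le-\delta\|x\|^2$) for all $x\in\mathcal L$. Local spectral function: for an open interval $J\subset\mathbb R$ and a finite set $s\subset J$, $\mathfrak R_s(J)$ is the system of bounded Borel sets $\Delta\subset J$ with $\overline\Delta\subset J$ whose boundary points are not in $s$; $\mathfrak R(J):=\mathfrak R_\emptyset(J)$. For a closed densely defined operator $S$ in a Banach space $X$, a map $E$ from $\mathfrak R_s(J)$ into the bounded projections of $X$ is a local spectral function of $S$ on $J$ with set of critical points $s$ if for all $\Delta,\Delta_1,\Delta_2\in\mathfrak R_s(J)$: (S1) $E(\Delta_1\cap\Delta_2)=E(\Delta_1)E(\Delta_2)$; (S2) if $\Delta_1\cap\Delta_2=\emptyset$ then $E(\Delta_1\cup\Delta_2)=E(\Delta_1)+E(\Delta_2)$; (S3) $E(\Delta)$ commutes with every bounded everywhere defined $B$ with $BS\subset SB$; (S4) $\sigma(S|E(\Delta)X)\subset\overline{\sigma(S)\cap\Delta}$; (S5) $\sigma(S|(I-E(\Delta))X)\subset\overline{\sigma(S)\setminus\Delta}$.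 For a compact $\Delta\subset\mathbb C$, a closed subspace $\mathcal L_\Delta\subset\operatorname{dom}S$ is the maximal spectral subspace of $S$ corresponding to $\Delta$ if (a) $S\mathcal L_\Delta\subset\mathcal L_\Delta$, (b) $\sigma(S|\mathcal L_\Delta)\subset\sigma(S)\cap\Delta$, and (c) every closed subspace $\mathcal L\subset\operatorname{dom}S$ satisfying (a) and (b) is contained in $\mathcal L_\Delta$. *)

theory Defs
  imports "HOL-Analysis.Analysis"
begin

text \<open>HOL-Analysis has no complex inner product spaces, so we introduce a class:
a real Banach space equipped with a complex scalar multiplication extending the real one
and a complex inner product (linear in the first, conjugate linear in the second argument)
inducing the norm.\<close>

class complex_hilbert = banach +
  fixes cscale :: "complex \<Rightarrow> 'a \<Rightarrow> 'a"
    and cinner :: "'a \<Rightarrow> 'a \<Rightarrow> complex"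
  assumes cscale_of_real: "cscale (complex_of_real r) x = r *\<^sub>R x"
    and cscale_add_right: "cscale a (x + y) = cscale a x + cscale a y"
    and cscale_add_left: "cscale (a + b) x = cscale a x + cscale b x"
    and cscale_assoc: "cscale a (cscale b x) = cscale (a * b) x"
    and cinner_add_left: "cinner (x + y) z = cinner x z + cinner y z"
    and cinner_cscale_left: "cinner (cscale a x) y = a * cinner x y"
    and cinner_commute: "cinner y x = cnj (cinner x y)"
    and norm_cinner: "norm x = sqrt (Re (cinner x x))"

instantiation complex :: complex_hilbert
begin
definition cscale_complex :: "complex \<Rightarrow> complex \<Rightarrow> complex" where "cscale_complex a x = a * x"
definition cinner_complex :: "complex \<Rightarrow> complex \<Rightarrow> complex" where "cinner_complex x y = x * cnj y"
instance
  by standard (auto simp: cscale_complex_def cinner_complex_def algebra_simps scaleR_conv_of_real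
      complex_mult_cnj cmod_def power2_eq_square)
end

definition csubspace :: "'a::complex_hilbert set \<Rightarrow> bool" where
  "csubspace S \<longleftrightarrow> 0 \<in> S \<and> (\<forall>x\<in>S. \<forall>y\<in>S. x + y \<in> S) \<and> (\<forall>c. \<forall>x\<in>S. cscale c x \<in> S)"

definition cblinear :: "('a::complex_hilbert \<Rightarrow> 'a) \<Rightarrow> bool" where
  "cblinear f \<longleftrightarrow> bounded_linear f \<and> (\<forall>c x. f (cscale c x) = cscale c (f x))"

definition bounded_selfadjoint :: "('a::complex_hilbert \<Rightarrow> 'a) \<Rightarrow> bool" where
  "bounded_selfadjoint G \<longleftrightarrow> cblinear G \<and> (\<forall>x y. cinner (G x) y = cinner x (G y))"

text \<open>An (unbounded) operator is a pair: its domain D and a function T (meaningful on D).\<close>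
definition closed_densely_defined :: "'a::complex_hilbert set \<Rightarrow> ('a \<Rightarrow> 'a) \<Rightarrow> bool" where
  "closed_densely_defined D T \<longleftrightarrow> csubspace D \<and> closure D = UNIV
     \<and> (\<forall>x\<in>D. \<forall>y\<in>D. T (x + y) = T x + T y)
     \<and> (\<forall>c. \<forall>x\<in>D. T (cscale c x) = cscale c (T x))
     \<and> closed {(x, T x) | x. x \<in> D}"

definition G_symmetric :: "('a::complex_hilbert \<Rightarrow> 'a) \<Rightarrow> 'a set \<Rightarrow> ('a \<Rightarrow> 'a) \<Rightarrow> bool" where
  "G_symmetric G D T \<longleftrightarrow> closed_densely_defined D T
     \<and> (\<forall>x\<in>D. \<forall>y\<in>D. cinner (G (T x)) y = cinner (G x) (T y))"

text \<open>Resolvent set of the operator T with domain Dm, regarded as an operator in the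
  (closed) subspace M: T - lambda is injective on Dm, maps Dm onto M, and has bounded inverse.\<close>
definition resolvent_in :: "'a::complex_hilbert set \<Rightarrow> 'a set \<Rightarrow> ('a \<Rightarrow> 'a) \<Rightarrow> complex set" where
  "resolvent_in M Dm T = {l. inj_on (\<lambda>x. T x - cscale l x) Dm
      \<and> (\<lambda>x. T x - cscale l x) ` Dm = M
      \<and> (\<exists>C. \<forall>x\<in>Dm. norm x \<le> C * norm (T x - cscale l x))}"

definition spectrum_in :: "'a::complex_hilbert set \<Rightarrow> 'a set \<Rightarrow> ('a \<Rightarrow> 'a) \<Rightarrow> complex set" where
  "spectrum_in M Dm T = - resolvent_in M Dm T"

definition op_resolvent :: "'a::complex_hilbert set \<Rightarrow> ('a \<Rightarrow> 'a) \<Rightarrow> complex set" where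
  "op_resolvent D T = resolvent_in UNIV D T"

definition op_spectrum :: "'a::complex_hilbert set \<Rightarrow> ('a \<Rightarrow> 'a) \<Rightarrow> complex set" where
  "op_spectrum D T = spectrum_in UNIV D T"

definition approx_point_spectrum :: "'a::complex_hilbert set \<Rightarrow> ('a \<Rightarrow> 'a) \<Rightarrow> complex set" where
  "approx_point_spectrum D T = {l. \<exists>x::nat \<Rightarrow> 'a. (\<forall>n. x n \<in> D \<and> norm (x n) = 1)
      \<and> (\<lambda>n. T (x n) - cscale l (x n)) \<longlonglongrightarrow> 0}"

text \<open>[x,y] = (G x, y); [x,x] is real, we take its real part.\<close>
definition sigma_pp :: "('a::complex_hilbert \<Rightarrow> 'a) \<Rightarrow> 'a set \<Rightarrow> ('a \<Rightarrow> 'a) \<Rightarrow> complex set" where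
  "sigma_pp G D T = {l \<in> approx_point_spectrum D T. \<forall>x::nat \<Rightarrow> 'a.
      (\<forall>n. x n \<in> D \<and> norm (x n) = 1) \<and> (\<lambda>n. T (x n) - cscale l (x n)) \<longlonglongrightarrow> 0
      \<longrightarrow> liminf (\<lambda>n. ereal (Re (cinner (G (x n)) (x n)))) > 0}"

definition sigma_mm :: "('a::complex_hilbert \<Rightarrow> 'a) \<Rightarrow> 'a set \<Rightarrow> ('a \<Rightarrow> 'a) \<Rightarrow> complex set" where
  "sigma_mm G D T = {l \<in> approx_point_spectrum D T. \<forall>x::nat \<Rightarrow> 'a.
      (\<forall>n. x n \<in> D \<and> norm (x n) = 1) \<and> (\<lambda>n. T (x n) - cscale l (x n)) \<longlonglongrightarrow> 0
      \<longrightarrow> limsup (\<lambda>n. ereal (Re (cinner (G (x n)) (x n)))) < 0}"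

definition positive_type_set :: "('a::complex_hilbert \<Rightarrow> 'a) \<Rightarrow> 'a set \<Rightarrow> ('a \<Rightarrow> 'a) \<Rightarrow> complex set \<Rightarrow> bool" where
  "positive_type_set G D T S \<longleftrightarrow> S \<inter> approx_point_spectrum D T \<subseteq> sigma_pp G D T"

definition negative_type_set :: "('a::complex_hilbert \<Rightarrow> 'a) \<Rightarrow> 'a set \<Rightarrow> ('a \<Rightarrow> 'a) \<Rightarrow> complex set \<Rightarrow> bool" where
  "negative_type_set G D T S \<longleftrightarrow> S \<inter> approx_point_spectrum D T \<subseteq> sigma_mm G D T"

definition uniformly_positive :: "('a::complex_hilbert \<Rightarrow> 'a) \<Rightarrow> 'a set \<Rightarrow> bool" where
  "uniformly_positive G L \<longleftrightarrow> (\<exists>\<delta>>0. \<forall>x\<in>L. Re (cinner (G x) x) \<ge> \<delta> * (norm x)\<^sup>2)"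

definition uniformly_negative :: "('a::complex_hilbert \<Rightarrow> 'a) \<Rightarrow> 'a set \<Rightarrow> bool" where
  "uniformly_negative G L \<longleftrightarrow> (\<exists>\<delta>>0. \<forall>x\<in>L. Re (cinner (G x) x) \<le> - \<delta> * (norm x)\<^sup>2)"

text \<open>\<open>\<RR>(J)\<close>: bounded Borel subsets of J whose closure lies in J (s = empty).\<close>
definition Rsys :: "real set \<Rightarrow> real set set" where
  "Rsys J = {\<Delta>. \<Delta> \<in> sets borel \<and> bounded \<Delta> \<and> closure \<Delta> \<subseteq> J}"

definition local_spectral_function ::
  "'a::complex_hilbert set \<Rightarrow> ('a \<Rightarrow> 'a) \<Rightarrow> real set \<Rightarrow> (real set \<Rightarrow> 'a \<Rightarrow> 'a) \<Rightarrow> bool" where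
  "local_spectral_function D T J E \<longleftrightarrow>
     (\<forall>\<Delta>\<in>Rsys J. cblinear (E \<Delta>) \<and> E \<Delta> \<circ> E \<Delta> = E \<Delta>)
   \<and> (\<forall>\<Delta>1\<in>Rsys J. \<forall>\<Delta>2\<in>Rsys J. E (\<Delta>1 \<inter> \<Delta>2) = E \<Delta>1 \<circ> E \<Delta>2)
   \<and> (\<forall>\<Delta>1\<in>Rsys J. \<forall>\<Delta>2\<in>Rsys J. \<Delta>1 \<inter> \<Delta>2 = {} \<longrightarrow>
         E (\<Delta>1 \<union> \<Delta>2) = (\<lambda>x. E \<Delta>1 x + E \<Delta>2 x))
   \<and> (\<forall>\<Delta>\<in>Rsys J. \<forall>B. cblinear B \<and> (\<forall>x\<in>D. B x \<in> D \<and> B (T x) = T (B x))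
         \<longrightarrow> E \<Delta> \<circ> B = B \<circ> E \<Delta>)
   \<and> (\<forall>\<Delta>\<in>Rsys J. spectrum_in (range (E \<Delta>)) (D \<inter> range (E \<Delta>)) T
         \<subseteq> closure (op_spectrum D T \<inter> complex_of_real ` \<Delta>))
   \<and> (\<forall>\<Delta>\<in>Rsys J. spectrum_in (range (\<lambda>x. x - E \<Delta> x)) (D \<inter> range (\<lambda>x. x - E \<Delta> x)) T
         \<subseteq> closure (op_spectrum D T - complex_of_real ` \<Delta>))"

definition maximal_spectral_subspace ::
  "'a::complex_hilbert set \<Rightarrow> ('a \<Rightarrow> 'a) \<Rightarrow> complex set \<Rightarrow> 'a set \<Rightarrow> bool" where
  "maximal_spectral_subspace D T K L \<longleftrightarrow>
     closed L \<and> csubspace L \<and> L \<subseteq> D \<and> T ` L \<subseteq> L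
   \<and> spectrum_in L L T \<subseteq> op_spectrum D T \<inter> K
   \<and> (\<forall>L'. closed L' \<and> csubspace L' \<and> L' \<subseteq> D \<and> T ` L' \<subseteq> L'
         \<and> spectrum_in L' L' T \<subseteq> op_spectrum D T \<inter> K \<longrightarrow> L' \<subseteq> L)"

end

theory Submission
  imports Defs "HOL-Complex_Analysis.Complex_Analysis"
begin

text \<open>
  Write \<open>[x, y] = (G x, y)\<close>. Near a point \<open>c\<close> of \<open>J\<close> positive type says that \<open>[x, x] \<ge> \<delta> \<parallel>x\<parallel>\<^sup>2\<close> whenever
  \<open>\<parallel>(T - c) x\<parallel> \<le> \<epsilon> \<parallel>x\<parallel>\<close>. Since \<open>Im [(T - \<lambda>) x, x] = - Im \<lambda> [x, x]\<close>, this yields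
  \<open>\<parallel>(T - \<lambda>) x\<parallel> \<ge> k \<bar>Im \<lambda>\<bar> \<parallel>x\<parallel>\<close> near \<open>c\<close>; together with the accumulation hypotheses, nonreal points
  near \<open>J\<close> lie in the resolvent set and the resolvent grows at most like \<open>1 / \<bar>Im \<lambda>\<bar>\<close>.

  Hence \<open>X = - (1 / 2 \<pi> \<i>) \<ointegral> w(\<lambda>) (T - \<lambda>)\<^sup>-\<^sup>1 d\<lambda>\<close> over a small circle around \<open>c\<close> exists, where
  \<open>w(\<lambda>) = ((\<lambda> - c)\<^sup>2 - s\<^sup>2)\<^sup>2\<close> vanishes where the circle meets the real line. On its range \<open>T - c\<close> is small, so
  \<open>[\<cdot>, \<cdot>]\<close> is uniformly positive there, while \<open>T - z\<close> is invertible on its kernel for \<open>\<bar>z - c\<bar> < s\<close>. The form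
  projections onto the closed ranges of finitely many such \<open>X\<close> combine to a projection \<open>P\<close> that localizes
  \<open>T\<close> to a compact subset of \<open>J\<close>. On the range of \<open>P\<close> the operator \<open>T\<close> is bounded and selfadjoint for an
  equivalent inner product, and the spectral theorem supplies the projections.
\<close>

section \<open>Complex Hilbert spaces and subspaces\<close>

text \<open>Before any spectral theorem is available, \<open>X\<close> must be recognized as a
  cut-off function of T. The decisive estimate is that T - c is O(s) on the range of
  \<open>X\<close>, with a constant that depends only on the growth constant \<open>k\<close> of the
  resolvent; as \<open>k\<close> survives shrinking the circle, a small s beats the fixed threshold
  \<epsilon>. Two facts give this: contour integrals over concentric circles multiply like
  functions, and a polynomial of degree four in T - c with nonreal roots acts on the range of
  \<open>X\<close> as an operator of norm O(s^4), while inverting three of its factors costs only (k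
  s)^(-3). \<open>X\<close> is no projection and [.,.] is indefinite on the whole space, so the form
  projection onto the closed range of \<open>X\<close> is built variationally; symmetry of
  \<open>X\<close> gives it the same kernel as \<open>X\<close>. All these projections commute with
  every bounded operator that commutes with T. This lets them be joined and makes the final spectral
  projections independent of the choices. Negative type for \<open>G0\<close> is positive type for -
  \<open>G0\<close>.\<close>

lemma cscale_one [simp]: "cscale 1 x = x"
  using cscale_of_real[of 1 x] by simp

lemma cscale_zero_left [simp]: "cscale 0 x = 0"
  using cscale_of_real[of 0 x] by simp

lemma cscale_zero_right [simp]: "cscale a 0 = 0"
  using cscale_add_right[of a 0 0] by simp

lemma cscale_minus_right [simp]: "cscale a (- x) = - cscale a x"
  using cscale_add_right[of a x "- x"] by (simp add: eq_neg_iff_add_eq_0 add.commute)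

lemma cscale_minus_left [simp]: "cscale (- a) x = - cscale a x"
  using cscale_add_left[of a "- a" x] by (simp add: eq_neg_iff_add_eq_0 add.commute)

lemma cscale_diff_right: "cscale a (x - y) = cscale a x - cscale a y"
  using cscale_add_right[of a x "- y"] by simp

lemma cscale_diff_left: "cscale (a - b) x = cscale a x - cscale b x"
  using cscale_add_left[of a "- b" x] by simp

lemma scaleR_cscale: "r *\<^sub>R x = cscale (complex_of_real r) x"
  by (simp add: cscale_of_real)

lemma cscale_scaleR: "cscale a (r *\<^sub>R x) = r *\<^sub>R cscale a x"
  by (metis cscale_of_real cscale_assoc mult.commute)

lemma cscale_scaleR_left: "cscale (r *\<^sub>R a) x = r *\<^sub>R cscale a x"
  by (simp only: scaleR_conv_of_real cscale_assoc[symmetric] cscale_of_real)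

lemma cscale_left_commute: "cscale a (cscale b x) = cscale b (cscale a x)"
  by (simp add: cscale_assoc mult.commute)

lemma cinner_add_right: "cinner x (y + z) = cinner x y + cinner x z"
  by (metis cinner_add_left cinner_commute complex_cnj_add)

lemma cinner_cscale_right: "cinner x (cscale a y) = cnj a * cinner x y"
  by (metis cinner_commute cinner_cscale_left complex_cnj_mult)

lemma cinner_cscale_self: "Re (cinner (cscale a x) (cscale a x)) = (cmod a)\<^sup>2 * Re (cinner x x)"
proof -
  have "cinner (cscale a x) (cscale a x) = complex_of_real ((cmod a)\<^sup>2) * cinner x x"
    by (simp only: cinner_cscale_left cinner_cscale_right complex_norm_square mult_ac)
  then show ?thesis by simp
qed

lemma cinner_scaleR_left: "cinner (r *\<^sub>R x) y = r *\<^sub>R cinner x y"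
  using cinner_cscale_left[of "complex_of_real r" x y] by (simp add: cscale_of_real scaleR_conv_of_real)

lemma cinner_scaleR_right: "cinner x (r *\<^sub>R y) = r *\<^sub>R cinner x y"
  using cinner_cscale_right[of x "complex_of_real r" y] by (simp add: cscale_of_real scaleR_conv_of_real)

lemma norm_sq_cinner: "(norm (x::'a::complex_hilbert))\<^sup>2 = Re (cinner x x)"
proof -
  have "Re (cinner x x) \<ge> 0"
    using norm_cinner[of x] norm_ge_zero[of x] by (metis real_sqrt_ge_0_iff)
  then show ?thesis by (simp add: norm_cinner)
qed

text \<open>Stated for semidefinite forms because it serves both the inner product and the forms
  \<open>Re (b (C x) y)\<close> of positive operators C. The quadratic t \<mapsto> r (x + t y) (x +
  t y) is nonnegative; it is evaluated at its minimum, or far out when it degenerates to a linear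
  function.\<close>

lemma semidefinite_form_Cauchy_Schwarz:
  fixes r :: "'a::real_vector \<Rightarrow> 'a \<Rightarrow> real"
  assumes add: "\<And>x y z. r (x + y) z = r x z + r y z"
    and scale: "\<And>c x z. r (c *\<^sub>R x) z = c * r x z"
    and sym: "\<And>x y. r x y = r y x"
    and pos: "\<And>x. r x x \<ge> 0"
  shows "(r x y)\<^sup>2 \<le> r x x * r y y"
proof -
  have add': "r z (x + y) = r z x + r z y" and scale': "r z (c *\<^sub>R x) = c * r z x" for c x y z
    using add[of x y z] scale[of c x z] by (simp_all only: sym[of z])
  have expand: "r (x + t *\<^sub>R y) (x + t *\<^sub>R y) = r x x + 2 * t * r x y + t\<^sup>2 * r y y" for t
    using sym[of y x] by (simp add: add scale add' scale' power2_eq_square algebra_simps)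
  show ?thesis
  proof (cases "r y y = 0")
    case True
    have "r x y = 0"
    proof (rule ccontr)
      assume ne: "r x y \<noteq> 0"
      \<comment> \<open>The parameter t is chosen so that 2 t r x y = - (r x x + 1), which makes the
        linear function equal to - 1.\<close>
      have "0 \<le> r x x + 2 * (- (r x x + 1) / (2 * r x y)) * r x y"
        using pos[of "x + (- (r x x + 1) / (2 * r x y)) *\<^sub>R y"] expand True by simp
      also have "\<dots> = - 1" using ne by (simp add: field_simps)
      finally show False by simp
    qed
    then show ?thesis using True by simp
  next
    case False
    then have p: "r y y > 0" using pos[of y] by simp
    have "0 \<le> r x x + 2 * (- r x y / r y y) * r x y + (- r x y / r y y)\<^sup>2 * r y y"
      by (simp only: expand[symmetric] pos)
    also have "\<dots> = r x x - (r x y)\<^sup>2 / r y y"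
      using False by (simp add: power2_eq_square field_simps)
    finally show ?thesis using p by (simp add: field_simps)
  qed
qed

lemma cinner_Cauchy_Schwarz: "cmod (cinner x y) \<le> norm x * norm (y::'a::complex_hilbert)"
proof -
  have re: "\<bar>Re (cinner u v)\<bar> \<le> norm u * norm v" for u v :: 'a
  proof -
    have "(Re (cinner u v))\<^sup>2 \<le> Re (cinner u u) * Re (cinner v v)"
    proof (rule semidefinite_form_Cauchy_Schwarz[where r = "\<lambda>u v. Re (cinner u v)"])
      show "Re (cinner x y) = Re (cinner y x)" for x y :: 'a
        using cinner_commute[of x y] by simp
      show "0 \<le> Re (cinner x x)" for x :: 'a
        by (metis norm_sq_cinner zero_le_power2)
    qed (simp_all add: cinner_add_left cinner_scaleR_left)
    then have "(Re (cinner u v))\<^sup>2 \<le> (norm u * norm v)\<^sup>2"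
      by (simp add: norm_sq_cinner[symmetric] power_mult_distrib)
    then have "\<bar>Re (cinner u v)\<bar>\<^sup>2 \<le> (norm u * norm v)\<^sup>2" by (simp only: power2_abs)
    then show ?thesis by (rule power2_le_imp_le) simp
  qed
  define a where "a = cinner x y"
  \<comment> \<open>A unimodular factor that rotates \<open>cinner x y\<close> onto its modulus, so
    that the estimate for real parts suffices.\<close>
  define u where "u = (if a = 0 then 1 else cnj a / cmod a)"
  have nu: "cmod u = 1" by (simp add: u_def norm_divide)
  have ua: "u * a = cmod a"
    by (simp add: u_def complex_norm_square[symmetric] power2_eq_square mult.commute)
  have "(norm (cscale u x))\<^sup>2 = (norm x)\<^sup>2"
    by (simp only: norm_sq_cinner[of x] norm_sq_cinner[of "cscale u x"] cinner_cscale_self nu) simp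
  then have nx: "norm (cscale u x) = norm x" by simp
  have "cmod a = Re (cinner (cscale u x) y)"
    using ua by (simp add: cinner_cscale_left a_def)
  also have "\<dots> \<le> norm x * norm y" using re[of "cscale u x" y] nx by simp
  finally show ?thesis by (simp add: a_def)
qed

lemma norm_cscale: "norm (cscale a (x::'a::complex_hilbert)) = cmod a * norm x"
proof -
  have "(norm (cscale a x))\<^sup>2 = (cmod a * norm x)\<^sup>2"
    by (simp only: cinner_cscale_self power_mult_distrib norm_sq_cinner[of "cscale a x"] norm_sq_cinner[of x])
  then show ?thesis by (rule power2_eq_imp_eq) simp_all
qed

lemma bounded_bilinear_cscale: "bounded_bilinear (cscale :: complex \<Rightarrow> 'a::complex_hilbert \<Rightarrow> 'a)"
proof
  show "\<exists>K. \<forall>a b. norm (cscale a (b::'a)) \<le> norm a * norm b * K"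
    by (rule exI[of _ 1]) (simp add: norm_cscale)
qed (rule cscale_add_left cscale_add_right cscale_scaleR_left cscale_scaleR)+

lemma bounded_bilinear_cinner: "bounded_bilinear (cinner :: 'a::complex_hilbert \<Rightarrow> 'a \<Rightarrow> complex)"
proof
  show "\<exists>K. \<forall>a b. norm (cinner a (b::'a)) \<le> norm a * norm b * K"
    by (rule exI[of _ 1]) (simp add: cinner_Cauchy_Schwarz)
qed (rule cinner_add_left cinner_add_right cinner_scaleR_left cinner_scaleR_right)+

lemmas tendsto_cscale [tendsto_intros] = bounded_bilinear.tendsto[OF bounded_bilinear_cscale]
lemmas continuous_on_cscale [continuous_intros] =
  bounded_bilinear.continuous_on[OF bounded_bilinear_cscale]
lemmas tendsto_cinner [tendsto_intros] = bounded_bilinear.tendsto[OF bounded_bilinear_cinner]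
lemmas bounded_linear_cscale = bounded_bilinear.bounded_linear_right[OF bounded_bilinear_cscale]
lemmas bounded_linear_cscale_left = bounded_bilinear.bounded_linear_left[OF bounded_bilinear_cscale]
lemmas bounded_linear_cinner_left = bounded_bilinear.bounded_linear_left[OF bounded_bilinear_cinner]

lemma cinner_zero_left [simp]: "cinner 0 (x::'a::complex_hilbert) = 0"
  by (rule bounded_bilinear.zero_left[OF bounded_bilinear_cinner])
lemma cinner_zero_right [simp]: "cinner (x::'a::complex_hilbert) 0 = 0"
  by (rule bounded_bilinear.zero_right[OF bounded_bilinear_cinner])
lemma cinner_diff_left: "cinner (x - y) (z::'a::complex_hilbert) = cinner x z - cinner y z"
  by (rule bounded_bilinear.diff_left[OF bounded_bilinear_cinner])
lemma cinner_diff_right: "cinner (z::'a::complex_hilbert) (x - y) = cinner z x - cinner z y"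
  by (rule bounded_bilinear.diff_right[OF bounded_bilinear_cinner])
lemma cinner_minus_left [simp]: "cinner (- x) (z::'a::complex_hilbert) = - cinner x z"
  by (rule bounded_bilinear.minus_left[OF bounded_bilinear_cinner])
lemma cinner_minus_right [simp]: "cinner (z::'a::complex_hilbert) (- x) = - cinner z x"
  by (rule bounded_bilinear.minus_right[OF bounded_bilinear_cinner])

lemma cinner_self_eq_0 [simp]: "cinner x x = 0 \<longleftrightarrow> (x::'a::complex_hilbert) = 0"
  by (metis cinner_zero_left norm_eq_zero norm_sq_cinner power2_eq_iff zero_complex.sel(1) zero_power2
      norm_zero power_eq_0_iff zero_neq_numeral)

lemma cinner_all_0_imp_0: "(\<And>y. cinner x y = 0) \<Longrightarrow> (x::'a::complex_hilbert) = 0"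
  using cinner_self_eq_0 by blast

section \<open>Complex subspaces and bounded complex linear operators\<close>

lemma csubspace_0: "csubspace S \<Longrightarrow> 0 \<in> S"
  and csubspace_add: "csubspace S \<Longrightarrow> x \<in> S \<Longrightarrow> y \<in> S \<Longrightarrow> x + y \<in> S"
  and csubspace_cscale: "csubspace S \<Longrightarrow> x \<in> S \<Longrightarrow> cscale a x \<in> S"
  by (auto simp: csubspace_def)

lemma csubspace_minus: "csubspace S \<Longrightarrow> x \<in> S \<Longrightarrow> - x \<in> S"
  using csubspace_cscale[of S x "- 1"] by simp

lemma csubspace_diff: "csubspace S \<Longrightarrow> x \<in> S \<Longrightarrow> y \<in> S \<Longrightarrow> x - y \<in> S"
  using csubspace_add[of S x "- y"] csubspace_minus[of S y] by simp

lemma csubspace_scaleR: "csubspace S \<Longrightarrow> x \<in> S \<Longrightarrow> r *\<^sub>R x \<in> S"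
  by (simp add: scaleR_cscale csubspace_cscale)

lemma csubspace_imp_subspace: "csubspace S \<Longrightarrow> subspace S"
  by (rule subspaceI) (simp_all add: csubspace_0 csubspace_add csubspace_scaleR)

lemma csubspace_UNIV: "csubspace UNIV"
  by (simp add: csubspace_def)

lemma csubspace_closure:
  assumes "csubspace (S :: 'a::complex_hilbert set)"
  shows "csubspace (closure S)"
  unfolding csubspace_def
proof (intro conjI ballI allI)
  show "0 \<in> closure S" using assms csubspace_0 closure_subset by blast
  show "x + y \<in> closure S" if "x \<in> closure S" "y \<in> closure S" for x y
  proof -
    from that obtain f g where "\<And>n. f n \<in> S" "f \<longlonglongrightarrow> x" "\<And>n. g n \<in> S" "g \<longlonglongrightarrow> y"
      unfolding closure_sequential by blast
    then show ?thesis unfolding closure_sequential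
      by (intro exI[of _ "\<lambda>n. f n + g n"]) (auto intro: tendsto_add csubspace_add assms)
  qed
  show "cscale c x \<in> closure S" if "x \<in> closure S" for c x
  proof -
    from that obtain f where "\<And>n. f n \<in> S" "f \<longlonglongrightarrow> x"
      unfolding closure_sequential by blast
    then show ?thesis unfolding closure_sequential
      by (intro exI[of _ "\<lambda>n. cscale c (f n)"])
         (auto intro: tendsto_cscale csubspace_cscale assms)
  qed
qed

lemma cblinearI:
  assumes "\<And>x y. f (x + y) = f x + f y" "\<And>c x. f (cscale c x) = cscale c (f x)"
    and "\<And>x. norm (f x) \<le> K * norm x"
  shows "cblinear f"
  unfolding cblinear_def
  by (intro conjI allI assms bounded_linear_intro[where K = K])
     (simp_all add: assms scaleR_cscale mult.commute)

lemma cblinear_bl: "cblinear f \<Longrightarrow> bounded_linear f"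
  by (simp add: cblinear_def)

lemma cblinear_cscale: "cblinear f \<Longrightarrow> f (cscale c x) = cscale c (f x)"
  by (simp add: cblinear_def)

lemma cblinear_simps:
  assumes "cblinear f"
  shows "f (x + y) = f x + f y" "f (x - y) = f x - f y" "f (- x) = - f x" "f 0 = 0"
    "f (r *\<^sub>R x) = r *\<^sub>R f x" "f (cscale c x) = cscale c (f x)"
proof -
  interpret bounded_linear f using assms by (rule cblinear_bl)
  show "f (x + y) = f x + f y" "f (x - y) = f x - f y" "f (- x) = - f x" "f 0 = 0"
    "f (r *\<^sub>R x) = r *\<^sub>R f x" "f (cscale c x) = cscale c (f x)"
    using assms by (simp_all add: add diff neg scaleR cblinear_cscale)
qed

lemma cblinear_bound: "cblinear f \<Longrightarrow> \<exists>K>0. \<forall>x. norm (f x) \<le> K * norm x"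
  using bounded_linear.pos_bounded[OF cblinear_bl] by (metis mult.commute)

lemma cblinear_id: "cblinear (\<lambda>x. x)"
  by (simp add: cblinear_def)
lemma cblinear_zero: "cblinear (\<lambda>x. 0)"
  by (simp add: cblinear_def)
lemma cblinear_compose: "cblinear f \<Longrightarrow> cblinear g \<Longrightarrow> cblinear (\<lambda>x. f (g x))"
  by (simp add: cblinear_def bounded_linear_compose)
lemma cblinear_add: "cblinear f \<Longrightarrow> cblinear g \<Longrightarrow> cblinear (\<lambda>x. f x + g x)"
  by (simp add: cblinear_def bounded_linear_add cscale_add_right)
lemma cblinear_sub: "cblinear f \<Longrightarrow> cblinear g \<Longrightarrow> cblinear (\<lambda>x. f x - g x)"
  by (simp add: cblinear_def bounded_linear_sub cscale_diff_right)
lemma cblinear_scale: "cblinear f \<Longrightarrow> cblinear (\<lambda>x. cscale a (f x))"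
  by (simp add: cblinear_def bounded_linear_compose[OF bounded_linear_cscale] cscale_left_commute)
lemma cblinear_scaleR: "cblinear f \<Longrightarrow> cblinear (\<lambda>x. r *\<^sub>R f x)"
  by (simp add: scaleR_cscale cblinear_scale)

lemma cblinear_tendsto: "cblinear f \<Longrightarrow> (g \<longlongrightarrow> x) F \<Longrightarrow> ((\<lambda>n. f (g n)) \<longlongrightarrow> f x) F"
  by (rule bounded_linear.tendsto[OF cblinear_bl])

lemma csubspace_range: "cblinear f \<Longrightarrow> csubspace (range f)"
  unfolding csubspace_def
  by (metis (no_types, lifting) cblinear_simps(1,4,6) rangeE rangeI)

lemma csubspace_image:
  assumes "csubspace S" "\<And>x y. x \<in> S \<Longrightarrow> y \<in> S \<Longrightarrow> f (x + y) = f x + f y"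
    "\<And>c x. x \<in> S \<Longrightarrow> f (cscale c x) = cscale c (f x)"
  shows "csubspace (f ` S)"
proof -
  have "f 0 = 0" using assms(3)[of 0 0] csubspace_0[OF assms(1)] by simp
  then show ?thesis unfolding csubspace_def
    by (auto simp: assms(2)[symmetric] assms(3)[symmetric] csubspace_add[OF assms(1)]
        csubspace_cscale[OF assms(1)] intro!: imageI) (metis csubspace_0[OF assms(1)] image_eqI)
qed

lemma cblinear_limit:
  assumes "\<And>n. cblinear (f n)" "\<And>x. (\<lambda>n. f n x) \<longlonglongrightarrow> g x" "\<And>n x. norm (f n x) \<le> K * norm x"
  shows "cblinear g"
proof (rule cblinearI[where K = K])
  show "g (x + y) = g x + g y" for x y
  proof (rule LIMSEQ_unique[OF assms(2)])
    show "(\<lambda>n. f n (x + y)) \<longlonglongrightarrow> g x + g y"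
      using tendsto_add[OF assms(2) assms(2)] by (simp add: cblinear_simps[OF assms(1)])
  qed
  show "g (cscale c x) = cscale c (g x)" for c x
  proof (rule LIMSEQ_unique[OF assms(2)])
    show "(\<lambda>n. f n (cscale c x)) \<longlonglongrightarrow> cscale c (g x)"
      using tendsto_cscale[OF tendsto_const assms(2)] by (simp add: cblinear_simps[OF assms(1)])
  qed
  show "norm (g x) \<le> K * norm x" for x
    by (rule tendsto_upperbound[OF tendsto_norm[OF assms(2)]]) (simp_all add: assms(3))
qed

lemma projection_range_iff: "(\<And>x. P (P x) = P x) \<Longrightarrow> y \<in> range P \<longleftrightarrow> P y = y"
  by (metis rangeE rangeI)

lemma closed_range_projection:
  assumes "cblinear P" "\<And>x. P (P x) = P x"
  shows "closed (range P)"
proof -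
  have "range P = {x. P x = x}" using projection_range_iff[OF assms(2)] by blast
  moreover have "closed {x. P x = x}"
    by (intro closed_Collect_eq continuous_on_id linear_continuous_on cblinear_bl assms)
  ultimately show ?thesis by simp
qed

lemma uniformly_positive_subset: "uniformly_positive G L \<Longrightarrow> L' \<subseteq> L \<Longrightarrow> uniformly_positive G L'"
  unfolding uniformly_positive_def by blast

section \<open>Resolvents of operators in closed subspaces\<close>

text \<open>The ambient space is a closed subspace M so that one resolvent calculus covers T in the
  whole space, T on an invariant subspace, and T on the range of a complementary projection.\<close>

locale subspace_operator =
  fixes M Dm :: "'a::complex_hilbert set" and T :: "'a \<Rightarrow> 'a"
  assumes cM: "closed M" and sM: "csubspace M" and sD: "csubspace Dm" and DM: "Dm \<subseteq> M"
    and T_add: "\<And>x y. x \<in> Dm \<Longrightarrow> y \<in> Dm \<Longrightarrow> T (x + y) = T x + T y"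
    and T_cscale: "\<And>c x. x \<in> Dm \<Longrightarrow> T (cscale c x) = cscale c (T x)"
begin

abbreviation "rho \<equiv> resolvent_in M Dm T"
text \<open>Meaningful only for l in \<open>rho\<close>. At the points where contours cross the
  spectrum, the arbitrary value is later multiplied by a vanishing weight.\<close>

definition res :: "complex \<Rightarrow> 'a \<Rightarrow> 'a" where
  "res l = inv_into Dm (\<lambda>x. T x - cscale l x)"

lemma T_diff: "x \<in> Dm \<Longrightarrow> y \<in> Dm \<Longrightarrow> T (x - y) = T x - T y"
  using T_add[of "x" "- y"] T_cscale[of y "- 1"] csubspace_minus[OF sD] by simp

lemma T_0: "T 0 = 0"
  using T_diff[of 0 0] csubspace_0[OF sD] by simp

lemma res_in: "l \<in> rho \<Longrightarrow> y \<in> M \<Longrightarrow> res l y \<in> Dm"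
  unfolding res_def resolvent_in_def using inv_into_into[of y "\<lambda>x. T x - cscale l x" Dm] by simp

lemma res_right: "l \<in> rho \<Longrightarrow> y \<in> M \<Longrightarrow> T (res l y) - cscale l (res l y) = y"
  unfolding res_def resolvent_in_def using f_inv_into_f[of y "\<lambda>x. T x - cscale l x" Dm] by auto

lemma res_left: "l \<in> rho \<Longrightarrow> x \<in> Dm \<Longrightarrow> res l (T x - cscale l x) = x"
  unfolding res_def resolvent_in_def by (auto intro: inv_into_f_f)

lemma res_maps: "l \<in> rho \<Longrightarrow> x \<in> Dm \<Longrightarrow> T x - cscale l x \<in> M"
  unfolding resolvent_in_def by blast

lemma res_eqI: "l \<in> rho \<Longrightarrow> x \<in> Dm \<Longrightarrow> T x - cscale l x = y \<Longrightarrow> res l y = x"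
  using res_left by blast

lemma res_bound: "l \<in> rho \<Longrightarrow> \<exists>C>0. \<forall>y\<in>M. norm (res l y) \<le> C * norm y"
proof -
  assume l: "l \<in> rho"
  then obtain C where C: "\<And>x. x \<in> Dm \<Longrightarrow> norm x \<le> C * norm (T x - cscale l x)"
    unfolding resolvent_in_def by blast
  have "norm (res l y) \<le> (\<bar>C\<bar> + 1) * norm y" if "y \<in> M" for y
  proof -
    have "norm (res l y) \<le> C * norm y" using C[OF res_in[OF l that]] res_right[OF l that] by simp
    also have "\<dots> \<le> (\<bar>C\<bar> + 1) * norm y" by (intro mult_right_mono) auto
    finally show ?thesis .
  qed
  then show ?thesis by (intro exI[of _ "\<bar>C\<bar> + 1"]) auto
qed

lemma res_add: "l \<in> rho \<Longrightarrow> x \<in> M \<Longrightarrow> y \<in> M \<Longrightarrow> res l (x + y) = res l x + res l y"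
proof (rule res_eqI)
  assume l: "l \<in> rho" and x: "x \<in> M" and y: "y \<in> M"
  note r = res_in[OF l x] res_in[OF l y]
  show "res l x + res l y \<in> Dm" by (intro csubspace_add[OF sD] r)
  have "T (res l x + res l y) - cscale l (res l x + res l y)
      = (T (res l x) - cscale l (res l x)) + (T (res l y) - cscale l (res l y))"
    by (simp add: T_add r cscale_add_right)
  then show "T (res l x + res l y) - cscale l (res l x + res l y) = x + y"
    by (simp add: res_right l x y)
qed

lemma res_cscale: "l \<in> rho \<Longrightarrow> x \<in> M \<Longrightarrow> res l (cscale c x) = cscale c (res l x)"
proof (rule res_eqI)
  assume l: "l \<in> rho" and x: "x \<in> M"
  show "cscale c (res l x) \<in> Dm" by (intro csubspace_cscale[OF sD] res_in l x)
  have "T (cscale c (res l x)) - cscale l (cscale c (res l x))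
      = cscale c (T (res l x) - cscale l (res l x))"
    by (simp add: T_cscale[OF res_in[OF l x]] cscale_left_commute[of l] cscale_diff_right)
  then show "T (cscale c (res l x)) - cscale l (cscale c (res l x)) = cscale c x"
    by (simp add: res_right l x)
qed

lemma res_diff: "l \<in> rho \<Longrightarrow> x \<in> M \<Longrightarrow> y \<in> M \<Longrightarrow> res l (x - y) = res l x - res l y"
  using res_add[of l x "- y"] res_cscale[of l y "- 1"] csubspace_minus[OF sM] by simp

lemma resolvent_identity:
  assumes "l \<in> rho" "m \<in> rho" "x \<in> M"
  shows "res l x - res m x = cscale (l - m) (res l (res m x))"
proof -
  have m: "res m x \<in> Dm" "res m x \<in> M" using assms res_in DM by auto
  have "res l x - res m x = res l x - res l (T (res m x) - cscale l (res m x))"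
    using res_left[OF assms(1) m(1)] by simp
  also have "\<dots> = res l (x - (T (res m x) - cscale l (res m x)))"
    using res_diff[OF assms(1,3) res_maps[OF assms(1) m(1)]] by simp
  also have "x - (T (res m x) - cscale l (res m x)) = cscale (l - m) (res m x)"
    using res_right[OF assms(2,3)] by (simp add: cscale_diff_left algebra_simps)
  finally show ?thesis by (simp add: res_cscale[OF assms(1) m(2)])
qed

text \<open>A Banach fixed point argument solves \<open>x = (T - l)\<^sup>-\<^sup>1 (y + (m - l) x)\<close>.\<close>
lemma resolvent_perturbation:
  assumes l: "l \<in> rho" and C: "\<And>x. x \<in> Dm \<Longrightarrow> norm x \<le> C * norm (T x - cscale l x)"
    and C0: "C \<ge> 0" and m: "cmod (m - l) * C < 1"
  shows "m \<in> rho"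
proof -
  define c where "c = cmod (m - l) * C"
  have c: "0 \<le> c" "c < 1" using C0 m by (auto simp: c_def)
  have lb: "(1 - c) * norm x \<le> C * norm (T x - cscale m x)" if "x \<in> Dm" for x
  proof -
    have "norm x \<le> C * norm (T x - cscale l x)" using C that by blast
    also have "T x - cscale l x = (T x - cscale m x) + cscale (m - l) x"
      by (simp add: cscale_diff_left)
    also have "C * norm \<dots> \<le> C * (norm (T x - cscale m x) + cmod (m - l) * norm x)"
      by (intro mult_left_mono C0 order_trans[OF norm_triangle_ineq]) (simp add: norm_cscale)
    finally show ?thesis by (simp add: c_def algebra_simps)
  qed
  have inj: "inj_on (\<lambda>x. T x - cscale m x) Dm"
  proof (rule inj_onI)
    fix x y assume xy: "x \<in> Dm" "y \<in> Dm" "T x - cscale m x = T y - cscale m y"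
    then have "T (x - y) - cscale m (x - y) = 0"
      by (simp add: T_diff cscale_diff_right algebra_simps)
    then have "(1 - c) * norm (x - y) \<le> 0"
      using lb[of "x - y"] xy csubspace_diff[OF sD] by simp
    then have "norm (x - y) \<le> 0" using c by (simp add: mult_le_0_iff)
    then show "x = y" by simp
  qed
  have sub: "T x - cscale m x \<in> M" if "x \<in> Dm" for x
  proof -
    have "T x - cscale m x = (T x - cscale l x) - cscale (m - l) x"
      by (simp add: cscale_diff_left)
    moreover have "x \<in> M" using that DM by blast
    ultimately show ?thesis
      by (simp only: csubspace_diff[OF sM res_maps[OF l that] csubspace_cscale[OF sM]])
  qed
  have sur: "\<exists>x\<in>Dm. T x - cscale m x = y" if y: "y \<in> M" for y
  proof -
    define f where "f x = res l (y + cscale (m - l) x)" for x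
    have fM: "y + cscale (m - l) x \<in> M" if "x \<in> M" for x
      by (intro csubspace_add[OF sM] csubspace_cscale[OF sM] y that)
    have "\<exists>!x\<in>M. f x = x"
    proof (rule Banach_fix[OF _ _ c])
      show "complete M" using cM by (simp add: complete_eq_closed)
      show "M \<noteq> {}" using y by blast
      show "f ` M \<subseteq> M" using res_in[OF l fM] DM by (auto simp: f_def)
      fix x z assume xz: "x \<in> M" "z \<in> M"
      have "f x - f z = res l (cscale (m - l) (x - z))"
        unfolding f_def using xz
        by (subst res_diff[OF l fM fM, symmetric]) (simp_all add: cscale_diff_right)
      also have "\<dots> = cscale (m - l) (res l (x - z))"
        using xz by (intro res_cscale l csubspace_diff[OF sM])
      finally have "dist (f x) (f z) = cmod (m - l) * norm (res l (x - z))"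
        by (simp add: dist_norm norm_cscale)
      also have "norm (res l (x - z)) \<le> C * norm (x - z)"
        using C[OF res_in[OF l]] res_right[OF l] csubspace_diff[OF sM xz] by simp
      finally show "dist (f x) (f z) \<le> c * dist x z"
        by (simp add: c_def mult_left_mono dist_norm mult.assoc)
    qed
    then obtain x where x: "x \<in> M" "f x = x" by blast
    have xD: "x \<in> Dm" using res_in[OF l fM[OF x(1)]] x(2) by (simp add: f_def)
    have "T x - cscale l x = y + cscale (m - l) x"
      using res_right[OF l fM[OF x(1)]] x(2) by (simp add: f_def)
    then have "T x - cscale m x = y" by (simp add: cscale_diff_left algebra_simps)
    then show ?thesis using xD by blast
  qed
  have "norm x \<le> (C / (1 - c)) * norm (T x - cscale m x)" if "x \<in> Dm" for x
    using lb[OF that] c by (simp add: field_simps)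
  then show ?thesis
    unfolding resolvent_in_def using inj sub sur by blast
qed

lemma open_rho: "open rho"
  unfolding open_dist
proof (intro ballI)
  fix l assume l: "l \<in> rho"
  from res_bound[OF l] obtain C where C: "C > 0" "\<And>y. y \<in> M \<Longrightarrow> norm (res l y) \<le> C * norm y"
    by blast
  have "m \<in> rho" if "dist m l < 1 / C" for m
  proof (rule resolvent_perturbation[OF l])
    show "norm x \<le> C * norm (T x - cscale l x)" if "x \<in> Dm" for x
      using C(2)[OF res_maps[OF l that]] res_left[OF l that] by simp
    show "cmod (m - l) * C < 1" using that C(1) by (simp add: dist_norm field_simps)
  qed (use C in auto)
  then show "\<exists>e>0. \<forall>m. dist m l < e \<longrightarrow> m \<in> rho" using C(1) by (intro exI[of _ "1 / C"]) auto
qed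

lemma res_tendsto:
  assumes l: "l \<in> rho" and x: "x \<in> M"
  shows "((\<lambda>m. res m x) \<longlongrightarrow> res l x) (at l)"
proof -
  obtain C where C: "C > 0" "\<And>y. y \<in> M \<Longrightarrow> norm (res l y) \<le> C * norm y" using res_bound[OF l] by blast
  obtain e where e: "e > 0" "ball l e \<subseteq> rho" using open_rho l by (meson openE)
  \<comment> \<open>The radius 1 / (2 C) allows half of \<open>norm (res m x)\<close> to be
    absorbed, which bounds \<open>res m x\<close> uniformly near l before the limit is
    taken.\<close>
  define d where "d = min e (1 / (2 * C))"
  have d: "d > 0" using e C by (simp add: d_def)
  have bd: "norm (res m x - res l x) \<le> cmod (m - l) * (2 * C * C * norm x)" if "dist m l < d" for m
  proof -
    have m: "m \<in> rho" using that e by (auto simp: d_def dist_commute)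
    have eq: "res m x - res l x = cscale (m - l) (res l (res m x))"
    proof -
      have "res l x - res m x = cscale (l - m) (res l (res m x))"
        by (rule resolvent_identity[OF l m x])
      then show ?thesis by (metis cscale_minus_left minus_diff_eq)
    qed
    have rm: "res m x \<in> M" using res_in[OF m x] DM by blast
    have lm: "norm (res m x - res l x) \<le> cmod (m - l) * (C * norm (res m x))"
      unfolding eq norm_cscale by (intro mult_left_mono C rm) simp
    have "cmod (m - l) * C \<le> 1 / 2" using that C by (simp add: d_def dist_norm field_simps)
    then have "norm (res m x - res l x) \<le> norm (res m x) / 2"
      using lm mult_right_mono[of "cmod (m - l) * C" "1/2" "norm (res m x)"] by simp
    then have "norm (res m x) \<le> 2 * norm (res l x)"
      using norm_triangle_ineq2[of "res m x" "res l x"] by linarith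
    also have "\<dots> \<le> 2 * (C * norm x)" using C(2)[OF x] by simp
    finally have "C * norm (res m x) \<le> 2 * C * C * norm x" using C(1) by simp
    then show ?thesis using lm by (meson mult_left_mono norm_ge_zero order_trans)
  qed
  have "((\<lambda>m. res m x - res l x) \<longlongrightarrow> 0) (at l)"
  proof (rule Lim_null_comparison)
    show "\<forall>\<^sub>F m in at l. norm (res m x - res l x) \<le> cmod (m - l) * (2 * C * C * norm x)"
      unfolding eventually_at using d bd by blast
    show "((\<lambda>m. cmod (m - l) * (2 * C * C * norm x)) \<longlongrightarrow> 0) (at l)"
      by (rule tendsto_eq_intros refl | simp)+
  qed
  then show ?thesis by (simp add: LIM_zero_iff)
qed

text \<open>By the resolvent identity the difference quotient is exactly
  \<open>f (res m (res l x))\<close>. Passing to scalar values through f makes the theorems on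
  holomorphic functions applicable.\<close>

lemma res_holomorphic:
  assumes f: "bounded_linear f" "\<And>c x. f (cscale c x) = c * f x" and x: "x \<in> M"
  shows "(\<lambda>l. f (res l x)) holomorphic_on rho"
  unfolding holomorphic_on_open[OF open_rho]
proof (intro ballI exI)
  fix l assume l: "l \<in> rho"
  have rl: "res l x \<in> M" using res_in[OF l x] DM by blast
  show "((\<lambda>l. f (res l x)) has_field_derivative f (res l (res l x))) (at l)"
    unfolding has_field_derivative_iff
  proof (rule Lim_transform_eventually)
    show "((\<lambda>m. f (res m (res l x))) \<longlongrightarrow> f (res l (res l x))) (at l)"
      by (intro bounded_linear.tendsto[OF f(1)] res_tendsto l rl)
    show "\<forall>\<^sub>F m in at l. f (res m (res l x)) = (f (res m x) - f (res l x)) / (m - l)"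
      using eventually_at_in_open[OF open_rho l]
    proof eventually_elim
      case (elim m)
      have "f (res m x) - f (res l x) = f (res m x - res l x)"
        by (simp add: bounded_linear.linear[OF f(1)] linear_diff)
      also have "\<dots> = (m - l) * f (res m (res l x))"
        using elim by (simp add: resolvent_identity[OF _ l x] f(2))
      finally show ?case using elim by simp
    qed
  qed
qed

end

section \<open>The form defined by a bounded selfadjoint operator\<close>

locale hermitian_form =
  fixes G :: "'a::complex_hilbert \<Rightarrow> 'a"
  assumes bsa: "bounded_selfadjoint G"
begin

definition b :: "'a \<Rightarrow> 'a \<Rightarrow> complex" where "b x y = cinner (G x) y"
definition q :: "'a \<Rightarrow> real" where "q x = Re (b x x)"
definition Gsym :: "('a \<Rightarrow> 'a) \<Rightarrow> bool" where "Gsym C \<longleftrightarrow> (\<forall>x y. b (C x) y = b x (C y))"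

lemma cblinear_G: "cblinear G"
  using bsa by (simp add: bounded_selfadjoint_def)

lemma b_commute: "b y x = cnj (b x y)"
  using bsa unfolding b_def bounded_selfadjoint_def by (metis cinner_commute)

lemma b_add_left: "b (x + y) z = b x z + b y z"
  and b_diff_left: "b (x - y) z = b x z - b y z"
  and b_cscale_left: "b (cscale c x) z = c * b x z"
  and b_scaleR_left: "b (r *\<^sub>R x) z = r *\<^sub>R b x z"
  and b_zero_left [simp]: "b 0 z = 0"
  by (simp_all add: b_def cblinear_simps[OF cblinear_G] cinner_add_left cinner_diff_left
      cinner_cscale_left cinner_scaleR_left)

lemma b_add_right: "b z (x + y) = b z x + b z y"
  and b_diff_right: "b z (x - y) = b z x - b z y"
  and b_cscale_right: "b z (cscale c x) = cnj c * b z x"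
  and b_scaleR_right: "b z (r *\<^sub>R x) = r *\<^sub>R b z x"
  and b_zero_right [simp]: "b z 0 = 0"
  by (simp_all add: b_def cinner_add_right cinner_diff_right cinner_cscale_right cinner_scaleR_right)

lemma b_self: "b x x = complex_of_real (q x)"
  unfolding q_def using b_commute[of x x] by (simp add: complex_eq_iff)

lemma Re_b_commute: "Re (b x y) = Re (b y x)"
  using b_commute[of x y] by simp

lemma b_bound: "\<exists>K>0. \<forall>x y. cmod (b x y) \<le> K * norm x * norm y"
proof -
  obtain K where K: "K > 0" "\<And>x. norm (G x) \<le> K * norm x" using cblinear_bound[OF cblinear_G] by blast
  have "cmod (b x y) \<le> K * norm x * norm y" for x y
    unfolding b_def by (rule order_trans[OF cinner_Cauchy_Schwarz]) (intro mult_right_mono K norm_ge_zero)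
  then show ?thesis using K by blast
qed

definition bK :: real where "bK = (SOME K. K > 0 \<and> (\<forall>x y. cmod (b x y) \<le> K * norm x * norm y))"

lemma bK: "bK > 0" "cmod (b x y) \<le> bK * norm x * norm y"
  using someI_ex[OF b_bound, folded bK_def] by auto

lemma Re_b_le: "Re (b x y) \<le> bK * norm x * norm y"
  using bK(2)[of x y] complex_Re_le_cmod order_trans by blast

lemma q_le: "q x \<le> bK * (norm x)\<^sup>2"
  unfolding q_def using Re_b_le[of x x] by (simp add: power2_eq_square mult.assoc)

lemma tendsto_b:
  assumes "(f \<longlongrightarrow> x) F" "(g \<longlongrightarrow> y) F"
  shows "((\<lambda>n. b (f n) (g n)) \<longlongrightarrow> b x y) F"
  unfolding b_def by (intro tendsto_cinner cblinear_tendsto[OF cblinear_G] assms)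

lemma tendsto_q: "(f \<longlongrightarrow> x) F \<Longrightarrow> ((\<lambda>n. q (f n)) \<longlongrightarrow> q x) F"
  unfolding q_def by (intro tendsto_Re tendsto_b)

lemma q_scaleR: "q (t *\<^sub>R x) = t\<^sup>2 * q x"
  by (simp add: q_def b_scaleR_left b_scaleR_right power2_eq_square)

lemma q_add: "q (x + y) = q x + 2 * Re (b x y) + q y"
  by (simp add: q_def b_add_left b_add_right Re_b_commute[of y x])

lemma q_diff: "q (x - y) = q x - 2 * Re (b x y) + q y"
  by (simp add: q_def b_diff_left b_diff_right Re_b_commute[of y x])

lemma uniformly_positive_q:
  "uniformly_positive G L \<longleftrightarrow> (\<exists>d>0. \<forall>x\<in>L. q x \<ge> d * (norm x)\<^sup>2)"
  by (simp add: uniformly_positive_def q_def b_def)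

lemma uniformly_positive_closure:
  assumes "uniformly_positive G L"
  shows "uniformly_positive G (closure L)"
proof -
  obtain d where d: "d > 0" "\<And>x. x \<in> L \<Longrightarrow> q x \<ge> d * (norm x)\<^sup>2"
    using assms unfolding uniformly_positive_q by blast
  have "q x \<ge> d * (norm x)\<^sup>2" if "x \<in> closure L" for x
  proof -
    obtain f where f: "\<And>n. f n \<in> L" "f \<longlonglongrightarrow> x" using \<open>x \<in> closure L\<close> unfolding closure_sequential by blast
    show ?thesis
      by (rule LIMSEQ_le[OF tendsto_mult[OF tendsto_const tendsto_power[OF tendsto_norm[OF f(2)]]]
            tendsto_q[OF f(2)]]) (use d f in auto)
  qed
  then show ?thesis unfolding uniformly_positive_q using d by blast
qed

text \<open>The form restricted to \<open>L\<close> is an equivalent inner product, so the minimizer of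
  \<open>l \<mapsto> q (y - l)\<close> over \<open>L\<close> exists although \<open>q\<close> is indefinite on the whole space.\<close>
lemma form_projection_point:
  assumes L: "closed L" "csubspace L" "uniformly_positive G L"
  shows "\<exists>l\<in>L. \<forall>m\<in>L. b (y - l) m = 0"
proof -
  obtain d where d: "d > 0" "\<And>x. x \<in> L \<Longrightarrow> q x \<ge> d * (norm x)\<^sup>2"
    using L(3) unfolding uniformly_positive_q by blast
  define f where "f l = q (y - l)" for l
  define I where "I = Inf (f ` L)"
  have lower: "f l \<ge> q y - (bK * norm y)\<^sup>2 / d" if "l \<in> L" for l
  proof -
    have "f l = q y - 2 * Re (b y l) + q l" by (simp add: f_def q_diff)
    moreover have "d * (norm l)\<^sup>2 - 2 * (bK * norm y * norm l) \<ge> - ((bK * norm y)\<^sup>2 / d)"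
    proof -
      \<comment> \<open>Completing the square: uniform positivity on L dominates the linear term
        \<open>2 * Re (b y l)\<close>, so f is bounded below on L.\<close>
      have "0 \<le> (d * norm l - bK * norm y)\<^sup>2 / d" using d by simp
      also have "\<dots> = d * (norm l)\<^sup>2 - 2 * (bK * norm y * norm l) + (bK * norm y)\<^sup>2 / d"
        using d by (simp add: power2_eq_square field_simps)
      finally show ?thesis by simp
    qed
    ultimately show ?thesis using d(2)[OF that] Re_b_le[of y l] by linarith
  qed
  then have bdd: "bdd_below (f ` L)" by (intro bdd_belowI2[where m = "q y - (bK * norm y)\<^sup>2 / d"])
  have I: "I \<le> f l" if "l \<in> L" for l unfolding I_def by (intro cInf_lower bdd imageI that)
  have "\<exists>l\<in>L. f l < I + 1 / real (Suc n)" for n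
  proof -
    have "f ` L \<noteq> {}" using csubspace_0[OF L(2)] by blast
    then show ?thesis using cInf_lessD[of "f ` L" "I + 1 / real (Suc n)"] by (auto simp: I_def)
  qed
  then obtain s where s: "\<And>n. s n \<in> L" "\<And>n. f (s n) < I + 1 / real (Suc n)" by metis
  \<comment> \<open>Parallelogram identity for q. It turns nearly minimal values at u, v into a
    small \<open>q (u - v)\<close>, hence into a small norm because u - v lies in L.\<close>
  have para: "q (u - v) = 2 * f u + 2 * f v - 4 * f ((1/2) *\<^sub>R (u + v))" for u v
  proof -
    have "4 * f ((1/2) *\<^sub>R (u + v)) = q (2 *\<^sub>R (y - (1/2) *\<^sub>R (u + v)))" by (simp add: q_scaleR f_def)
    also have "2 *\<^sub>R (y - (1/2) *\<^sub>R (u + v)) = (y - u) + (y - v)"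
      by (simp add: scaleR_right_diff_distrib scaleR_2)
    finally have 1: "4 * f ((1/2) *\<^sub>R (u + v)) = q ((y - u) + (y - v))" .
    have "u - v = (y - v) - (y - u)" by simp
    then have "q (u - v) = q ((y - v) - (y - u))" by simp
    then show ?thesis
      using 1 q_diff[of "y - v" "y - u"] q_add[of "y - u" "y - v"] Re_b_commute[of "y - v" "y - u"]
      by (simp add: f_def)
  qed
  have small: "d * (norm (s m - s n))\<^sup>2 \<le> 2 / real (Suc m) + 2 / real (Suc n)" for m n
  proof -
    have "(1/2) *\<^sub>R (s m + s n) \<in> L" by (intro csubspace_scaleR csubspace_add L s)
    then have "q (s m - s n) \<le> 2 / real (Suc m) + 2 / real (Suc n)"
      using para[of "s m" "s n"] I[of "(1/2) *\<^sub>R (s m + s n)"] s(2)[of m] s(2)[of n] by simp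
    then show ?thesis using d(2)[OF csubspace_diff[OF L(2) s(1) s(1)], of m n] by linarith
  qed
  have "Cauchy s"
  proof (rule metric_CauchyI)
    fix e :: real assume e: "e > 0"
    obtain N where "4 / (d * e\<^sup>2) < real N" using reals_Archimedean2 by blast
    then have N: "4 / (d * e\<^sup>2) < real (Suc N)" by simp
    have "dist (s m) (s n) < e" if "m \<ge> N" "n \<ge> N" for m n
    proof -
      have "2 / real (Suc m) + 2 / real (Suc n) \<le> 2 / real (Suc N) + 2 / real (Suc N)"
        using that by (intro add_mono divide_left_mono) auto
      also have "\<dots> = 4 / real (Suc N)" by simp
      also have "\<dots> < d * e\<^sup>2" using N d e by (simp add: field_simps)
      finally have "d * (norm (s m - s n))\<^sup>2 < d * e\<^sup>2" using small[of m n] by linarith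
      then have "(norm (s m - s n))\<^sup>2 < e\<^sup>2" using d by simp
      then show ?thesis using e by (simp add: dist_norm power2_less_imp_less)
    qed
    then show "\<exists>M. \<forall>m\<ge>M. \<forall>n\<ge>M. dist (s m) (s n) < e" by blast
  qed
  then obtain l where l: "s \<longlonglongrightarrow> l" using Cauchy_convergent_iff convergent_def by blast
  have lL: "l \<in> L" using L(1) s(1) l by (rule closed_sequentially)
  have "f l \<le> I"
  proof (rule LIMSEQ_le)
    show "(\<lambda>n. f (s n)) \<longlonglongrightarrow> f l" unfolding f_def by (intro tendsto_q tendsto_intros l)
    show "(\<lambda>n. I + 1 / real (Suc n)) \<longlonglongrightarrow> I"
      using tendsto_add[OF tendsto_const LIMSEQ_inverse_real_of_nat, of I] by (simp add: inverse_eq_divide)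
  qed (use s(2) less_imp_le in blast)
  then have min: "f l \<le> f m" if "m \<in> L" for m using I[OF that] by linarith
  have re0: "Re (b (y - l) m) = 0" if m: "m \<in> L" for m
  proof (rule ccontr)
    define a where "a = Re (b (y - l) m)"
    assume "Re (b (y - l) m) \<noteq> 0"
    then have a: "a \<noteq> 0" by (simp add: a_def)
    \<comment> \<open>Moving l by (a / c) m changes f by - 2 a^2 / c + (a / c)^2 q m, which is
      negative since c exceeds q m.\<close>
    define c where "c = \<bar>q m\<bar> + 1"
    have c: "c > 0" "q m < c" by (auto simp: c_def)
    have "f l \<le> f (l + (a / c) *\<^sub>R m)" by (intro min csubspace_add csubspace_scaleR L lL m)
    also have "\<dots> = q ((y - l) - (a / c) *\<^sub>R m)" by (simp add: f_def algebra_simps)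
    also have "\<dots> = f l - 2 * (a / c) * a + (a / c)\<^sup>2 * q m"
      by (simp add: q_diff q_scaleR b_scaleR_right a_def f_def)
    finally have "2 * (a / c) * a \<le> (a / c)\<^sup>2 * q m" by simp
    also have "\<dots> \<le> (a / c)\<^sup>2 * c" using c by (intro mult_left_mono) auto
    also have "\<dots> = a\<^sup>2 / c" using c by (simp add: power2_eq_square)
    finally have "2 * (a\<^sup>2 / c) \<le> a\<^sup>2 / c" by (simp add: power2_eq_square)
    moreover have "a\<^sup>2 / c > 0" using a c by simp
    ultimately show False by linarith
  qed
  \<comment> \<open>Testing with \<i> m in place of m gives the imaginary part.\<close>
  have "b (y - l) m = 0" if m: "m \<in> L" for m
    using re0[OF m] re0[OF csubspace_cscale[OF L(2) m, of "\<i>"]]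
    by (simp add: b_cscale_right complex_eq_iff)
  then show ?thesis using lL by blast
qed

text \<open>The form is definite on L, so the point found above is unique, and uniqueness yields
  linearity and idempotence. The norm bound \<open>bK / d\<close> results from d \<parallel>E
  x\<parallel>^2 \<le> q (E x) = Re (b x (E x)).\<close>

lemma form_projection:
  assumes L: "closed L" "csubspace L" "uniformly_positive G L"
  obtains E where "cblinear E" "\<And>x. E (E x) = E x" "Gsym E" "range E = L"
proof -
  obtain d where d: "d > 0" "\<And>x. x \<in> L \<Longrightarrow> q x \<ge> d * (norm x)\<^sup>2"
    using L(3) unfolding uniformly_positive_q by blast
  obtain E where E: "\<And>y. E y \<in> L" "\<And>y m. m \<in> L \<Longrightarrow> b (y - E y) m = 0"
    using form_projection_point[OF L] by metis
  have uniq: "E y = l" if "l \<in> L" "\<And>m. m \<in> L \<Longrightarrow> b (y - l) m = 0" for y l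
  proof -
    have m: "E y - l \<in> L" by (intro csubspace_diff L E that)
    have "E y - l = (y - l) - (y - E y)" by simp
    then have "b (E y - l) (E y - l) = 0"
      using that(2)[OF m] E(2)[OF m, of y] by (metis b_diff_left diff_zero)
    then have "q (E y - l) = 0" by (simp add: q_def)
    then have "d * (norm (E y - l))\<^sup>2 \<le> 0" using d(2)[OF m] by simp
    then have "norm (E y - l) = 0" using d(1) by (simp add: mult_le_0_iff)
    then show ?thesis by simp
  qed
  have fix_L: "E y = y" if "y \<in> L" for y by (rule uniq) (use that in auto)
  have bE: "b (E x) m = b x m" if "m \<in> L" for x m using E(2)[OF that, of x] by (simp add: b_diff_left)
  show ?thesis
  proof
    show "cblinear E"
    proof (rule cblinearI[where K = "bK / d"])
      show "E (x + y) = E x + E y" for x y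
        by (rule uniq) (auto intro!: csubspace_add[OF L(2)] E simp: b_diff_left b_add_left bE)
      show "E (cscale c x) = cscale c (E x)" for c x
        by (rule uniq) (auto intro!: csubspace_cscale[OF L(2)] E simp: b_diff_left b_cscale_left bE)
      show "norm (E x) \<le> bK / d * norm x" for x
      proof (cases "E x = 0")
        case True
        then show ?thesis using bK d by simp
      next
        case False
        have "d * (norm (E x))\<^sup>2 \<le> Re (b x (E x))"
          using d(2)[OF E(1), of x] bE[OF E(1)] by (simp add: q_def)
        also have "\<dots> \<le> bK * norm x * norm (E x)" by (rule Re_b_le)
        finally have "norm (E x) * (d * norm (E x)) \<le> norm (E x) * (bK * norm x)"
          by (simp add: power2_eq_square mult_ac)
        then have "d * norm (E x) \<le> bK * norm x" using False by simp
        then show ?thesis using d by (simp add: field_simps)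
      qed
    qed
    show "E (E x) = E x" for x by (rule fix_L[OF E(1)])
    show "Gsym E" unfolding Gsym_def
    proof (intro allI)
      fix x y
      have "b (E x) y = cnj (b y (E x))" by (rule b_commute)
      also have "\<dots> = cnj (b (E y) (E x))" by (simp add: bE[OF E(1)])
      also have "\<dots> = b (E x) (E y)" by (rule b_commute[symmetric])
      finally show "b (E x) y = b x (E y)" by (simp add: bE[OF E(1)])
    qed
    show "range E = L" using E(1) fix_L by (metis image_subset_iff rangeI subsetI subset_antisym)
  qed
qed

text \<open>The kernel of E is the form-orthogonal complement of the range of C, and by symmetry
  this is the kernel of C. An operator that commutes with C therefore preserves both the range and
  the kernel of E, hence commutes with E; it need not be symmetric itself.\<close>

lemma support_projection:
  assumes C: "cblinear C" "Gsym C" "uniformly_positive G (range C)"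
  obtains E where "cblinear E" "\<And>x. E (E x) = E x" "Gsym E" "range E = closure (range C)"
    "\<And>x. E x = 0 \<longleftrightarrow> C x = 0"
    "\<And>B x. cblinear B \<Longrightarrow> (\<And>x. B (C x) = C (B x)) \<Longrightarrow> B (E x) = E (B x)"
proof -
  define L where "L = closure (range C)"
  have up: "uniformly_positive G L" unfolding L_def by (intro uniformly_positive_closure C)
  have L: "closed L" "csubspace L"
    unfolding L_def by (simp_all add: csubspace_closure csubspace_range C)
  obtain E where E: "cblinear E" "\<And>x. E (E x) = E x" "Gsym E" "range E = L"
    using form_projection[OF L up] by blast
  have fix_L: "E x = x \<longleftrightarrow> x \<in> L" for x using projection_range_iff[of E x, OF E(2)] E(4) by simp
  obtain d where d: "d > 0" "\<And>x. x \<in> L \<Longrightarrow> q x \<ge> d * (norm x)\<^sup>2"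
    using up unfolding uniformly_positive_q by blast
  have q0: "x = 0" if "x \<in> L" "q x = 0" for x
    using d(2)[OF that(1)] that(2) d(1) by (simp add: mult_le_0_iff)
  have CL: "C x \<in> L" for x unfolding L_def using closure_subset[of "range C"] by auto
  have ker: "E x = 0 \<longleftrightarrow> C x = 0" for x
  proof
    assume "E x = 0"
    then have "b x (E (C (C x))) = 0" using E(3)[unfolded Gsym_def, rule_format, of x "C (C x)"] by simp
    then have "b x (C (C x)) = 0" using fix_L[of "C (C x)"] CL by simp
    then have "q (C x) = 0" using C(2) by (simp add: Gsym_def q_def)
    then show "C x = 0" using q0 CL by blast
  next
    assume Cx: "C x = 0"
    obtain s where s: "\<And>n. s n \<in> range C" "s \<longlonglongrightarrow> E x"
      using E(4) unfolding L_def by (metis closure_sequential rangeI)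
    have "b x (s n) = 0" for n
    proof -
      obtain u where "s n = C u" using s(1)[of n] by blast
      then show ?thesis using C(2)[unfolded Gsym_def, rule_format, of x u] Cx by simp
    qed
    then have "b x (E x) = 0" using tendsto_b[OF tendsto_const s(2), of x] by (simp add: LIMSEQ_const_iff)
    then have "q (E x) = 0" using E(3)[unfolded Gsym_def, rule_format, of x "E x"] E(2) by (simp add: q_def)
    then show "E x = 0" using q0 E(4) by blast
  qed
  have comm: "B (E x) = E (B x)" if B: "cblinear B" "\<And>x. B (C x) = C (B x)" for B x
  proof -
    have BL: "B y \<in> L" if "y \<in> L" for y
    proof -
      have "y \<in> closure (range C)" using that by (simp add: L_def)
      then obtain s where s: "\<And>n. s n \<in> range C" "s \<longlonglongrightarrow> y"
        unfolding closure_sequential by blast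
      have "B (s n) \<in> range C" for n
      proof -
        obtain u where "s n = C u" using s(1)[of n] by blast
        then show ?thesis using B(2)[of u] by simp
      qed
      then show ?thesis unfolding L_def closure_sequential
        by (intro exI[of _ "\<lambda>n. B (s n)"] conjI allI cblinear_tendsto[OF B(1) s(2)])
    qed
    have "E x \<in> L" using E(4) by blast
    then have 1: "E (B (E x)) = B (E x)" using fix_L BL by blast
    have "E (x - E x) = 0" by (simp add: cblinear_simps[OF E(1)] E(2))
    then have "C (x - E x) = 0" using ker by blast
    then have "C (B (x - E x)) = 0" using B(2)[of "x - E x"] by (simp add: cblinear_simps(4)[OF B(1)])
    then have "E (B (x - E x)) = 0" using ker by blast
    then show ?thesis using 1 by (simp add: cblinear_simps[OF E(1)] cblinear_simps[OF B(1)])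
  qed
  show ?thesis using that[OF E(1,2,3) _ ker comm] E(4) L_def by blast
qed

end

section \<open>Selfadjoint operators on a uniformly positive subspace\<close>

locale positive_range = hermitian_form +
  fixes P :: "'a \<Rightarrow> 'a"
  assumes P_lin: "cblinear P" and PP: "P (P x) = P x" and P_sym: "Gsym P"
    and P_pos: "uniformly_positive G (range P)"
begin

definition dl :: real where "dl = (SOME d. d > 0 \<and> (\<forall>x\<in>range P. q x \<ge> d * (norm x)\<^sup>2))"

lemma dl: "dl > 0" "P x = x \<Longrightarrow> dl * (norm x)\<^sup>2 \<le> q x"
proof -
  have "\<exists>d. d > 0 \<and> (\<forall>x\<in>range P. q x \<ge> d * (norm x)\<^sup>2)"
    using P_pos unfolding uniformly_positive_q .
  from someI_ex[OF this, folded dl_def]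
  have *: "dl > 0" "\<And>x. x \<in> range P \<Longrightarrow> dl * (norm x)\<^sup>2 \<le> q x" by auto
  show "dl > 0" by (rule *)
  show "P x = x \<Longrightarrow> dl * (norm x)\<^sup>2 \<le> q x" using *(2)[of x] by (metis rangeI)
qed

lemma q_nonneg: "P x = x \<Longrightarrow> 0 \<le> q x"
  using dl(2)[of x] dl(1) by (meson less_imp_le mult_nonneg_nonneg order_trans zero_le_power2)

lemma q_eq_0: "P x = x \<Longrightarrow> q x \<le> 0 \<Longrightarrow> x = 0"
proof -
  assume "P x = x" "q x \<le> 0"
  then have "dl * (norm x)\<^sup>2 \<le> 0" using dl(2)[of x] by linarith
  then show "x = 0" using dl(1) by (simp add: mult_le_0_iff)
qed

lemma P_b: "b (P x) y = b x (P y)"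
  using P_sym by (simp add: Gsym_def)

text \<open>These are the bounded selfadjoint operators of the Hilbert space \<open>range P\<close>
  with inner product b, extended by zero to the kernel of P. In this algebra P is the
  identity.\<close>

definition sa :: "('a \<Rightarrow> 'a) \<Rightarrow> bool" where
  "sa C \<longleftrightarrow> cblinear C \<and> Gsym C \<and> (\<forall>x. P (C x) = C x) \<and> (\<forall>x. C (P x) = C x)"

lemma saD: assumes "sa C"
  shows "cblinear C" "b (C x) y = b x (C y)" "P (C x) = C x" "C (P x) = C x"
  using assms by (auto simp: sa_def Gsym_def)

lemma sa_P: "sa P"
  using P_lin PP P_sym by (simp add: sa_def)
lemma sa_0: "sa (\<lambda>x. 0)"
  by (simp add: sa_def Gsym_def cblinear_zero cblinear_simps[OF P_lin])
lemma sa_add: "sa A \<Longrightarrow> sa C \<Longrightarrow> sa (\<lambda>x. A x + C x)"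
  by (simp add: sa_def Gsym_def cblinear_add b_add_left b_add_right cblinear_simps[OF P_lin])
lemma sa_diff: "sa A \<Longrightarrow> sa C \<Longrightarrow> sa (\<lambda>x. A x - C x)"
  by (simp add: sa_def Gsym_def cblinear_sub b_diff_left b_diff_right cblinear_simps[OF P_lin])
lemma sa_scaleR: "sa A \<Longrightarrow> sa (\<lambda>x. r *\<^sub>R A x)"
  by (simp add: sa_def Gsym_def cblinear_scaleR b_scaleR_left b_scaleR_right cblinear_simps[OF P_lin])
lemma sa_compose: "sa A \<Longrightarrow> sa C \<Longrightarrow> (\<And>x. A (C x) = C (A x)) \<Longrightarrow> sa (\<lambda>x. A (C x))"
  by (simp add: sa_def Gsym_def cblinear_compose)

text \<open>Polarization: the quadratic form evaluated at x + C x isolates 2 q (C x).\<close>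

lemma sa_eq_0:
  assumes C: "sa C" and z: "\<And>x. Re (b (C x) x) = 0"
  shows "C x = 0"
proof (rule q_eq_0)
  show "P (C x) = C x" using C by (rule saD)
  have "Re (b (C (x + C x)) (x + C x)) = 0" by (rule z)
  then have "Re (b (C x) (C x)) + Re (b (C (C x)) x) = 0"
    using z[of x] z[of "C x"] by (simp add: cblinear_simps[OF saD(1)[OF C]] b_add_left b_add_right)
  moreover have "b (C (C x)) x = b (C x) (C x)" using C by (rule saD)
  ultimately show "q (C x) \<le> 0" by (simp add: q_def)
qed

lemma sa_eqI:
  assumes "sa A" "sa C" and z: "\<And>x. Re (b (A x) x) = Re (b (C x) x)"
  shows "A x = C x"
  using sa_eq_0[OF sa_diff[OF assms(1,2)]] z by (simp add: b_diff_left)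

section \<open>Positive operators and monotone limits\<close>

definition pos :: "('a \<Rightarrow> 'a) \<Rightarrow> bool" where "pos C \<longleftrightarrow> (\<forall>x. 0 \<le> Re (b (C x) x))"

lemma pos_Cauchy_Schwarz:
  assumes C: "sa C" "pos C"
  shows "(Re (b (C x) y))\<^sup>2 \<le> Re (b (C x) x) * Re (b (C y) y)"
proof (rule semidefinite_form_Cauchy_Schwarz[where r = "\<lambda>u v. Re (b (C u) v)"])
  show "Re (b (C x) y) = Re (b (C y) x)" for x y
    using saD(2)[OF C(1), of x y] Re_b_commute[of x "C y"] by simp
  show "0 \<le> Re (b (C x) x)" for x using C(2) by (simp add: pos_def)
qed (simp_all add: cblinear_simps[OF saD(1)[OF C(1)]] b_add_left b_scaleR_left)

text \<open>This is C^2 \<le> M C for 0 \<le> C \<le> M. It comes from Cauchy-Schwarz for the form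
  of C at x and C x, after cancelling one factor q (C x).\<close>

lemma pos_bound:
  assumes C: "sa C" "pos C" and M: "\<And>x. Re (b (C x) x) \<le> M * q (P x)"
  shows "q (C x) \<le> M * Re (b (C x) x)"
proof -
  have PC: "P (C x) = C x" using C(1) by (rule saD)
  have nn: "q (C x) \<ge> 0" by (rule q_nonneg[OF PC])
  have "(q (C x))\<^sup>2 \<le> Re (b (C x) x) * Re (b (C (C x)) (C x))"
    using pos_Cauchy_Schwarz[OF C, of x "C x"] by (simp add: q_def)
  also have "\<dots> \<le> Re (b (C x) x) * (M * q (C x))"
    using C(2) M[of "C x"] PC by (intro mult_left_mono) (auto simp: pos_def)
  finally have *: "q (C x) * q (C x) \<le> (M * Re (b (C x) x)) * q (C x)"
    by (simp add: power2_eq_square mult_ac)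
  show ?thesis
  proof (cases "q (C x) = 0")
    case True
    then have "C x = 0" using q_eq_0[OF PC] by simp
    then show ?thesis by (simp add: q_def)
  next
    case False
    then show ?thesis using * nn by simp
  qed
qed

lemma norm_le_q: "P x = x \<Longrightarrow> (norm x)\<^sup>2 \<le> q x / dl"
  using dl by (simp add: field_simps)

lemma q_P_le: "\<exists>K>0. \<forall>x. q (P x) \<le> K * (norm x)\<^sup>2"
proof -
  obtain K where K: "K > 0" "\<And>x. norm (P x) \<le> K * norm x" using cblinear_bound[OF P_lin] by blast
  have "q (P x) \<le> bK * K\<^sup>2 * (norm x)\<^sup>2" for x
  proof -
    have "q (P x) \<le> bK * (norm (P x))\<^sup>2" by (rule q_le)
    also have "\<dots> \<le> bK * (K * norm x)\<^sup>2" using K bK by (intro mult_left_mono power_mono) auto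
    finally show ?thesis by (simp add: power_mult_distrib)
  qed
  moreover have "bK * K\<^sup>2 > 0" using K bK by simp
  ultimately show ?thesis by blast
qed

text \<open>The constant involves only M, K and \<open>dl\<close>, hence is uniform along a sequence
  of operators with a common M.\<close>

lemma pos_bound_norm:
  assumes C: "sa C" "pos C" and M: "\<And>x. Re (b (C x) x) \<le> M * q (P x)" "M \<ge> 0"
    and K: "\<And>x. q (P x) \<le> K * (norm x)\<^sup>2"
  shows "norm (C x) \<le> sqrt (M * M * K / dl) * norm x"
proof -
  have "(norm (C x))\<^sup>2 \<le> q (C x) / dl" by (rule norm_le_q[OF saD(3)[OF C(1)]])
  also have "\<dots> \<le> (M * (M * (K * (norm x)\<^sup>2))) / dl"
    using dl(1)
    by (intro divide_right_mono order_trans[OF pos_bound[OF C M(1)]] mult_left_mono M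
        order_trans[OF M(1)] K) auto
  also have "\<dots> = (M * M * K / dl) * (norm x)\<^sup>2" by simp
  finally have "sqrt ((norm (C x))\<^sup>2) \<le> sqrt ((M * M * K / dl) * (norm x)\<^sup>2)" by (rule real_sqrt_le_mono)
  then show ?thesis by (simp only: real_sqrt_mult real_sqrt_abs abs_norm_cancel)
qed

text \<open>A bounded increasing sequence of forms converges at each x. By \<open>pos_bound\<close>
  the square of a difference of two operators is dominated by M times that difference, so
  convergence of the forms upgrades to norm convergence of each C n x.\<close>

lemma monotone_operator_limit:
  assumes sa: "\<And>n. sa (C n)" and pos0: "pos (C 0)"
    and mono: "\<And>n x. Re (b (C n x) x) \<le> Re (b (C (Suc n) x) x)"
    and M: "\<And>n x. Re (b (C n x) x) \<le> M * q (P x)" "M \<ge> 0"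
  obtains L where "sa L" "\<And>x. (\<lambda>n. C n x) \<longlonglongrightarrow> L x"
proof -
  obtain K where K: "K > 0" "\<And>x. q (P x) \<le> K * (norm x)\<^sup>2" using q_P_le by blast
  have inc: "incseq (\<lambda>n. Re (b (C n x) x))" for x using mono by (rule incseq_SucI)
  have pos: "pos (C n)" for n
    unfolding pos_def
  proof
    fix x
    have "Re (b (C 0 x) x) \<le> Re (b (C n x) x)" using incseqD[OF inc, of 0 n x] by simp
    then show "0 \<le> Re (b (C n x) x)" using pos0 unfolding pos_def by (meson order_trans)
  qed
  have qdiff: "q (C m x - C n x) \<le> M * (Re (b (C m x) x) - Re (b (C n x) x))" if "n \<le> m" for m n x
  proof -
    have "q (C m x - C n x) \<le> M * Re (b (C m x - C n x) x)"
    proof (rule pos_bound[of "\<lambda>x. C m x - C n x"])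
      show "sa (\<lambda>x. C m x - C n x)" by (intro sa_diff sa)
      show "pos (\<lambda>x. C m x - C n x)" unfolding pos_def using incseqD[OF inc that] by (simp add: b_diff_left)
      show "Re (b (C m x - C n x) x) \<le> M * q (P x)" for x
      proof -
        have "0 \<le> Re (b (C n x) x)" using pos[of n] by (simp add: pos_def)
        then show ?thesis using M(1)[of m x] by (simp add: b_diff_left)
      qed
    qed
    then show ?thesis by (simp add: b_diff_left)
  qed
  have "convergent (\<lambda>n. C n x)" for x
  proof -
    have "convergent (\<lambda>n. Re (b (C n x) x))"
      by (rule incseq_convergent[OF inc[of x], where B = "M * q (P x)"])
         (use M(1) in \<open>auto simp: convergent_def\<close>)
    then have cau: "Cauchy (\<lambda>n. Re (b (C n x) x))" by (simp add: Cauchy_convergent_iff)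
    have "Cauchy (\<lambda>n. C n x)"
    proof (rule metric_CauchyI)
      fix e :: real assume e: "e > 0"
      define e' where "e' = dl * e\<^sup>2 / (M + 1)"
      have e': "e' > 0" using e dl M(2) by (simp add: e'_def)
      obtain N where N: "\<And>m n. m \<ge> N \<Longrightarrow> n \<ge> N \<Longrightarrow> dist (Re (b (C m x) x)) (Re (b (C n x) x)) < e'"
        using metric_CauchyD[OF cau e'] by blast
      have main: "dist (C m x) (C n x) < e" if "N \<le> n" "n \<le> m" for m n
      proof -
        have "q (C m x - C n x) \<le> M * (Re (b (C m x) x) - Re (b (C n x) x))" by (rule qdiff[OF that(2)])
        also have "\<dots> \<le> M * e'" using N[of m n] that M(2) by (intro mult_left_mono) (auto simp: dist_real_def)
        also have "\<dots> < (M + 1) * e'" using e' by simp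
        also have "\<dots> = dl * e\<^sup>2" using M(2) by (simp add: e'_def)
        finally have "q (C m x - C n x) < dl * e\<^sup>2" .
        moreover have "P (C m x - C n x) = C m x - C n x" by (simp add: cblinear_simps[OF P_lin] saD(3)[OF sa])
        ultimately have "dl * (norm (C m x - C n x))\<^sup>2 < dl * e\<^sup>2" using dl(2) by (meson le_less_trans)
        then have "(norm (C m x - C n x))\<^sup>2 < e\<^sup>2" using dl(1) by simp
        then show ?thesis using e by (simp add: dist_norm power2_less_imp_less)
      qed
      have "dist (C m x) (C n x) < e" if "N \<le> m" "N \<le> n" for m n
        using main[of n m] main[of m n] that by (cases "n \<le> m") (auto simp: dist_commute)
      then show "\<exists>N. \<forall>m\<ge>N. \<forall>n\<ge>N. dist (C m x) (C n x) < e" by blast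
    qed
    then show ?thesis by (simp add: Cauchy_convergent_iff)
  qed
  then obtain L where L: "\<And>x. (\<lambda>n. C n x) \<longlonglongrightarrow> L x" unfolding convergent_def by metis
  have "sa L" unfolding sa_def Gsym_def
  proof (intro conjI allI)
    show "cblinear L"
      by (rule cblinear_limit[OF _ L]) (rule saD(1)[OF sa], rule pos_bound_norm[OF sa pos M K(2)])
    show "b (L x) y = b x (L y)" for x y
      by (rule LIMSEQ_unique[OF tendsto_b[OF L tendsto_const]])
         (simp add: saD(2)[OF sa] tendsto_b[OF tendsto_const L])
    show "P (L x) = L x" for x
      by (rule LIMSEQ_unique[OF cblinear_tendsto[OF P_lin L]]) (simp add: saD(3)[OF sa] L)
    show "L (P x) = L x" for x
      by (rule LIMSEQ_unique[OF L]) (simp add: saD(4)[OF sa] L)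
  qed
  then show ?thesis using that L by blast
qed

section \<open>Positive square roots and absolute values\<close>

lemma P_absorb: "sa A \<Longrightarrow> P (A x) = A (P x)"
  by (simp add: saD(3,4))

lemma sa_range:
  assumes "sa A"
  shows "range A \<subseteq> range P"
proof
  fix y assume "y \<in> range A"
  then have "P y = y" using saD(3)[OF assms] by auto
  then show "y \<in> range P" by (metis rangeI)
qed

text \<open>Polynomials in N with nonnegative coefficients and unit P. Every member has a
  nonnegative form when N does, and members multiply to members, so positivity of products of these
  commuting operators reduces to membership in the cone.\<close>

inductive poscone :: "('a \<Rightarrow> 'a) \<Rightarrow> ('a \<Rightarrow> 'a) \<Rightarrow> bool" for N where
  pow: "poscone N (\<lambda>x. (N ^^ k) (P x))"
| add: "poscone N A \<Longrightarrow> poscone N C \<Longrightarrow> poscone N (\<lambda>x. A x + C x)"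
| scale: "0 \<le> r \<Longrightarrow> poscone N A \<Longrightarrow> poscone N (\<lambda>x. r *\<^sub>R A x)"

lemma funpow_sa:
  assumes N: "sa N"
  shows "sa (\<lambda>x. (N ^^ k) (P x))"
proof (induction k)
  case 0
  then show ?case by (simp add: sa_P)
next
  case (Suc k)
  have "N ((N ^^ k) (P x)) = (N ^^ k) (P (N x))" for x
    using funpow_swap1[of N k "P x"] by (simp add: saD[OF N])
  then show ?case using sa_compose[OF N Suc] by simp
qed

text \<open>Half of the factors move to the second argument by symmetry. An even power leaves q of a
  vector, an odd power leaves the form of N at a vector.\<close>

lemma funpow_pos:
  assumes N: "sa N" "pos N"
  shows "pos (\<lambda>x. (N ^^ k) (P x))"
proof -
  have even: "(N ^^ (j + j)) (P x) = (N ^^ j) (P ((N ^^ j) (P x)))" for j x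
    by (simp add: funpow_add saD(3)[OF funpow_sa[OF N(1)]])
  note sym = saD(2)[OF funpow_sa[OF N(1)]]
  show ?thesis
  proof (cases "even k")
    case True
    then obtain j where k: "k = j + j" by (metis evenE mult_2)
    have "Re (b ((N ^^ k) (P x)) x) = q ((N ^^ j) (P x))" for x
      unfolding k even q_def by (simp only: sym)
    then show ?thesis using q_nonneg[OF saD(3)[OF funpow_sa[OF N(1), of j]]] by (simp add: pos_def)
  next
    case False
    then obtain j where k: "k = Suc (j + j)" by (metis oddE mult_2 Suc_eq_plus1)
    have "Re (b ((N ^^ k) (P x)) x) = Re (b (N ((N ^^ j) (P x))) ((N ^^ j) (P x)))" for x
    proof -
      have "(N ^^ k) (P x) = N ((N ^^ (j + j)) (P x))" by (simp add: k)
      also have "\<dots> = N ((N ^^ j) (P ((N ^^ j) (P x))))" by (simp only: even)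
      also have "\<dots> = (N ^^ j) (N (P ((N ^^ j) (P x))))" by (rule funpow_swap1)
      also have "\<dots> = (N ^^ j) (P (N ((N ^^ j) (P x))))" by (simp only: P_absorb[OF N(1)])
      finally show ?thesis by (simp only: sym)
    qed
    then show ?thesis using N(2) by (simp add: pos_def)
  qed
qed

lemma poscone_sa:
  assumes N: "sa N"
  shows "poscone N A \<Longrightarrow> sa A"
  by (induction rule: poscone.induct) (auto intro: funpow_sa[OF N] sa_add sa_scaleR)

lemma poscone_pos:
  assumes N: "sa N" "pos N"
  shows "poscone N A \<Longrightarrow> pos A"
proof (induction rule: poscone.induct)
  case (pow k)
  then show ?case by (rule funpow_pos[OF N])
qed (simp_all add: pos_def b_add_left b_scaleR_left)

lemma poscone_comm:
  assumes B: "cblinear B" "\<And>x. B (N x) = N (B x)" "\<And>x. B (P x) = P (B x)"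
  shows "poscone N A \<Longrightarrow> B (A x) = A (B x)"
proof (induction arbitrary: x rule: poscone.induct)
  case (pow k)
  have "B ((N ^^ k) y) = (N ^^ k) (B y)" for y by (induction k) (simp_all add: B(2))
  then show ?case by (simp add: B(3))
qed (simp_all add: cblinear_simps[OF B(1)])

lemma poscone_compose:
  assumes N: "sa N"
  shows "poscone N A \<Longrightarrow> poscone N C \<Longrightarrow> poscone N (\<lambda>x. A (C x))"
proof (induction rule: poscone.induct)
  case (pow k)
  note lin = cblinear_simps[OF saD(1)[OF funpow_sa[OF N, of k]]]
  from pow show ?case
  proof (induction rule: poscone.induct)
    case (pow j)
    have "(\<lambda>x. (N ^^ k) (P ((N ^^ j) (P x)))) = (\<lambda>x. (N ^^ (k + j)) (P x))"
      by (simp add: funpow_add saD(3)[OF funpow_sa[OF N]])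
    then show ?case by (simp only: poscone.pow)
  next
    case (add A C)
    then show ?case by (simp only: lin) (rule poscone.add)
  next
    case (scale r A)
    then show ?case by (simp only: lin) (rule poscone.scale)
  qed
qed (simp_all add: poscone.add poscone.scale)

text \<open>The iteration \<open>Z\<^sub>n\<^sub>+\<^sub>1 = (N + Z\<^sub>n\<^sup>2) / 2\<close> with \<open>N = P - C\<close> consists of polynomials in \<open>N\<close> with
  nonnegative coefficients, increases, and converges to \<open>P - \<surd>C\<close>.\<close>
lemma positive_square_root:
  assumes C: "sa C" "pos C" "\<And>x. Re (b (C x) x) \<le> q (P x)"
  obtains Y where "sa Y" "pos Y" "\<And>x. Y (Y x) = C x"
    "\<And>B x. cblinear B \<Longrightarrow> (\<And>x. B (C x) = C (B x)) \<Longrightarrow> (\<And>x. B (P x) = P (B x)) \<Longrightarrow> B (Y x) = Y (B x)"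
proof -
  define N where "N x = P x - C x" for x
  have qP: "q (P x) = Re (b (P x) x)" for x by (simp add: q_def P_b PP)
  have N: "sa N" "pos N" "\<And>x. Re (b (N x) x) \<le> q (P x)"
    unfolding N_def using C by (auto intro!: sa_diff sa_P simp: pos_def b_diff_left qP)
  define Z where "Z = rec_nat (\<lambda>x. 0) (\<lambda>n Z x. (1/2) *\<^sub>R (N x + Z (Z x)))"
  have Z0: "Z 0 = (\<lambda>x. 0)" and ZS: "Z (Suc n) = (\<lambda>x. (1/2) *\<^sub>R (N x + Z n (Z n x)))" for n
    by (simp_all add: Z_def)
  have coneN: "poscone N N" using poscone.pow[of N 1] by (simp add: saD(4)[OF N(1)])
  have cone0: "poscone N (\<lambda>x. 0)" using poscone.scale[OF _ coneN, of 0] by simp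
  have coneZ: "poscone N (Z n)" for n
  proof (induction n)
    case 0
    then show ?case by (simp add: Z0 cone0)
  next
    case (Suc n)
    show ?case unfolding ZS
      by (rule poscone.scale[OF _ poscone.add[OF coneN poscone_compose[OF N(1) Suc Suc]]]) simp
  qed
  note Zsa = poscone_sa[OF N(1) coneZ] and Zpos = poscone_pos[OF N(1,2) coneZ]
  note Zlin = cblinear_simps[OF saD(1)[OF Zsa]]
  have ZZ: "Z m (Z n x) = Z n (Z m x)" for m n x
  proof (rule poscone_comm[OF _ _ _ coneZ])
    show "cblinear (Z m)" by (rule saD(1)[OF Zsa])
    show "Z m (N x) = N (Z m x)" for x
      by (rule poscone_comm[OF saD(1)[OF N(1)] _ _ coneZ, symmetric]) (simp_all add: saD[OF N(1)])
    show "Z m (P x) = P (Z m x)" for x by (simp add: P_absorb[OF Zsa])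
  qed
  have coneD: "poscone N (\<lambda>x. Z (Suc n) x - Z n x)" for n
  proof (induction n)
    case 0
    have "(\<lambda>x. Z (Suc 0) x - Z 0 x) = (\<lambda>x. (1/2) *\<^sub>R N x)" unfolding ZS Z0 by simp
    then show ?case using poscone.scale[OF _ coneN, of "1/2"] by simp
  next
    case (Suc n)
    \<comment> \<open>The Z n commute, so the difference of the squares factors and the increment is
      half the product of two members of the cone.\<close>
    have "(\<lambda>x. Z (Suc (Suc n)) x - Z (Suc n) x)
        = (\<lambda>x. (1/2) *\<^sub>R ((\<lambda>x. Z (Suc n) x + Z n x) ((\<lambda>x. Z (Suc n) x - Z n x) x)))"
    proof
      fix x
      have "Z (Suc (Suc n)) x - Z (Suc n) x = (1/2) *\<^sub>R (Z (Suc n) (Z (Suc n) x) - Z n (Z n x))"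
        unfolding ZS[of "Suc n"] by (subst (3) ZS) (simp add: scaleR_right_diff_distrib scaleR_right_distrib)
      then show "Z (Suc (Suc n)) x - Z (Suc n) x = (1/2) *\<^sub>R ((\<lambda>x. Z (Suc n) x + Z n x) ((\<lambda>x. Z (Suc n) x - Z n x) x))"
        by (simp add: Zlin(2) ZZ[of "Suc n" n])
    qed
    moreover have "poscone N (\<lambda>x. (1/2) *\<^sub>R ((\<lambda>x. Z (Suc n) x + Z n x) ((\<lambda>x. Z (Suc n) x - Z n x) x)))"
      by (rule poscone.scale[OF _ poscone_compose[OF N(1) poscone.add[OF coneZ coneZ] Suc]]) simp
    ultimately show ?case by (simp only:)
  qed
  have mono: "Re (b (Z n x) x) \<le> Re (b (Z (Suc n) x) x)" for n x
    using poscone_pos[OF N(1,2) coneD, of n] by (simp add: pos_def b_diff_left)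
  have Zle: "Re (b (Z n x) x) \<le> 1 * q (P x)" for n x
  proof (induction n arbitrary: x)
    case 0
    then show ?case using q_nonneg[OF PP] by (simp add: Z0)
  next
    case (Suc n)
    \<comment> \<open>From 0 \<le> Z n \<le> P follows (Z n)^2 \<le> Z n \<le> P, and averaging with
      N \<le> P preserves the bound P.\<close>
    have "q (Z n x) \<le> 1 * Re (b (Z n x) x)" by (rule pos_bound[OF Zsa Zpos Suc])
    then have "Re (b (Z n (Z n x)) x) \<le> q (P x)"
      using Suc[of x] saD(2)[OF Zsa, of n "Z n x" x] by (simp add: q_def)
    then show ?case using N(3)[of x] by (simp add: ZS b_scaleR_left b_add_left)
  qed
  obtain L where L: "sa L" "\<And>x. (\<lambda>n. Z n x) \<longlonglongrightarrow> L x"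
    using monotone_operator_limit[of Z 1, OF Zsa Zpos mono Zle] by auto
  obtain K where K: "K > 0" "\<And>x. q (P x) \<le> K * (norm x)\<^sup>2" using q_P_le by blast
  have ZZL: "(\<lambda>n. Z n (Z n x)) \<longlonglongrightarrow> L (L x)" for x
  proof -
    have "(\<lambda>n. Z n (Z n x - L x)) \<longlonglongrightarrow> 0"
    proof (rule Lim_null_comparison)
      show "\<forall>\<^sub>F n in sequentially. norm (Z n (Z n x - L x)) \<le> sqrt (1 * 1 * K / dl) * norm (Z n x - L x)"
        by (intro always_eventually allI pos_bound_norm[OF Zsa Zpos Zle _ K(2)]) simp
      show "(\<lambda>n. sqrt (1 * 1 * K / dl) * norm (Z n x - L x)) \<longlonglongrightarrow> 0"
        using tendsto_mult[OF tendsto_const tendsto_norm[OF LIM_zero[OF L(2)[of x]]]] by simp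
    qed
    from tendsto_add[OF this L(2)[of "L x"]] show ?thesis by (simp add: Zlin)
  qed
  have fixp: "L x = (1/2) *\<^sub>R (N x + L (L x))" for x
  proof (rule LIMSEQ_unique)
    show "(\<lambda>n. Z (Suc n) x) \<longlonglongrightarrow> L x" by (rule LIMSEQ_Suc[OF L(2)])
    show "(\<lambda>n. Z (Suc n) x) \<longlonglongrightarrow> (1/2) *\<^sub>R (N x + L (L x))"
      unfolding ZS by (intro tendsto_intros ZZL)
  qed
  define Y where "Y x = P x - L x" for x
  have "sa Y" unfolding Y_def by (intro sa_diff sa_P L)
  moreover have "pos Y" unfolding pos_def
  proof
    fix x
    have "Re (b (L x) x) \<le> q (P x)"
      by (rule LIMSEQ_le_const2[OF tendsto_Re[OF tendsto_b[OF L(2) tendsto_const]]]) (use Zle in auto)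
    then show "0 \<le> Re (b (Y x) x)" by (simp add: Y_def b_diff_left qP)
  qed
  moreover have "Y (Y x) = C x" for x
  proof -
    \<comment> \<open>The fixed point equation rearranges to (P - L)^2 = P - N = C.\<close>
    have "2 *\<^sub>R L x = N x + L (L x)" by (subst fixp) simp
    then have "L x + L x = P x - C x + L (L x)" by (simp add: N_def scaleR_2)
    then show ?thesis
      by (simp add: Y_def cblinear_simps[OF P_lin] cblinear_simps[OF saD(1)[OF L(1)]] PP saD[OF L(1)]
          algebra_simps)
  qed
  moreover have "B (Y x) = Y (B x)"
    if B: "cblinear B" "\<And>x. B (C x) = C (B x)" "\<And>x. B (P x) = P (B x)" for B x
  proof -
    have "B (L x) = L (B x)"
    proof (rule LIMSEQ_unique[OF cblinear_tendsto[OF B(1) L(2)]])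
      have "B (Z n x) = Z n (B x)" for n
        by (rule poscone_comm[OF B(1) _ B(3) coneZ]) (simp add: N_def B cblinear_simps[OF B(1)])
      then show "(\<lambda>n. B (Z n x)) \<longlonglongrightarrow> L (B x)" by (simp add: L(2))
    qed
    then show ?thesis by (simp add: Y_def B cblinear_simps[OF B(1)])
  qed
  ultimately show ?thesis using that[of Y] by blast
qed

lemma sa_norm_bound: "sa A \<Longrightarrow> \<exists>K>0. \<forall>x. norm (A x) \<le> K * norm (P x)"
proof -
  assume A: "sa A"
  obtain K where K: "K > 0" "\<And>x. norm (A x) \<le> K * norm x" using cblinear_bound[OF saD(1)[OF A]] by blast
  have "norm (A x) \<le> K * norm (P x)" for x using K(2)[of "P x"] by (simp add: saD(4)[OF A])
  then show ?thesis using K(1) by blast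
qed

lemma sa_absolute_value:
  assumes A: "sa A"
  obtains Y where "sa Y" "pos Y" "\<And>x. Y (Y x) = A (A x)"
    "\<And>B x. cblinear B \<Longrightarrow> (\<And>x. B (A x) = A (B x)) \<Longrightarrow> (\<And>x. B (P x) = P (B x)) \<Longrightarrow> B (Y x) = Y (B x)"
proof -
  obtain K where K: "K > 0" "\<And>x. norm (A x) \<le> K * norm (P x)" using sa_norm_bound[OF A] by blast
  \<comment> \<open>The square root is available for forms bounded by that of P. Here A^2 is at most
    c P, so A^2 is divided by c and the root multiplied by \<open>sqrt c\<close>.\<close>
  define c where "c = bK * K\<^sup>2 / dl"
  have c: "c > 0" using K bK dl by (simp add: c_def)
  define C where "C x = (1 / c) *\<^sub>R A (A x)" for x
  have bC: "Re (b (C x) x) = q (A x) / c" for x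
    by (simp add: C_def b_scaleR_left saD(2)[OF A] q_def)
  have "q (A x) \<le> c * q (P x)" for x
  proof -
    have "q (A x) \<le> bK * (norm (A x))\<^sup>2" by (rule q_le)
    also have "\<dots> \<le> bK * (K * norm (P x))\<^sup>2" using K bK by (intro mult_left_mono power_mono) auto
    also have "\<dots> = bK * K\<^sup>2 * (norm (P x))\<^sup>2" by (simp add: power_mult_distrib)
    also have "\<dots> \<le> bK * K\<^sup>2 * (q (P x) / dl)" using bK K by (intro mult_left_mono norm_le_q PP) auto
    finally show ?thesis by (simp add: c_def)
  qed
  then have le: "Re (b (C x) x) \<le> q (P x)" for x
    using c by (simp add: bC field_simps)
  have sC: "sa C" unfolding C_def by (rule sa_scaleR[OF sa_compose[OF A A]]) simp
  have pC: "pos C" unfolding pos_def bC using c q_nonneg[OF saD(3)[OF A]] by simp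
  obtain Y where Y: "sa Y" "pos Y" "\<And>x. Y (Y x) = C x"
    "\<And>B x. cblinear B \<Longrightarrow> (\<And>x. B (C x) = C (B x)) \<Longrightarrow> (\<And>x. B (P x) = P (B x)) \<Longrightarrow> B (Y x) = Y (B x)"
    using positive_square_root[OF sC pC le] by blast
  show ?thesis
  proof (rule that[of "\<lambda>x. sqrt c *\<^sub>R Y x"])
    show "sa (\<lambda>x. sqrt c *\<^sub>R Y x)" by (intro sa_scaleR Y)
    show "pos (\<lambda>x. sqrt c *\<^sub>R Y x)" using Y(2) c by (simp add: pos_def b_scaleR_left)
    show "sqrt c *\<^sub>R Y (sqrt c *\<^sub>R Y x) = A (A x)" for x
      using c by (simp add: cblinear_simps[OF saD(1)[OF Y(1)]] Y(3) C_def)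
    show "B (sqrt c *\<^sub>R Y x) = sqrt c *\<^sub>R Y (B x)"
      if B: "cblinear B" "\<And>x. B (A x) = A (B x)" "\<And>x. B (P x) = P (B x)" for B x
    proof -
      have "B (Y x) = Y (B x)" by (rule Y(4)) (simp_all add: B C_def cblinear_simps[OF B(1)])
      then show ?thesis by (simp add: cblinear_simps[OF B(1)])
    qed
  qed
qed

end

text \<open>The pi-lambda theorem for the half lines. Only disjoint unions occur, which suits
  statements obtained from countable additivity.\<close>

lemma borel_induct [consumes 1, case_names basic empty compl union]:
  assumes "A \<in> sets (borel :: real measure)"
    and "\<And>t. Q {..t}" "Q {}" "\<And>A. A \<in> sets borel \<Longrightarrow> Q A \<Longrightarrow> Q (UNIV - A)"
    and "\<And>A :: nat \<Rightarrow> real set. disjoint_family A \<Longrightarrow> (\<And>i. A i \<in> sets borel) \<Longrightarrow> (\<And>i. Q (A i)) \<Longrightarrow> Q (\<Union>i. A i)"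
  shows "Q A"
proof -
  define Gen where "Gen = range (\<lambda>a::real. {..a})"
  have bor: "sets (borel :: real measure) = sigma_sets UNIV Gen"
    by (simp add: borel_eq_atMost Gen_def)
  have st: "Int_stable Gen"
  proof (rule Int_stableI)
    fix X Y assume "X \<in> Gen" "Y \<in> Gen"
    then obtain u v where "X = {..u}" "Y = {..v}" by (auto simp: Gen_def)
    then have "X \<inter> Y = {..min u v}" by auto
    then show "X \<inter> Y \<in> Gen" by (simp add: Gen_def)
  qed
  have "Gen \<subseteq> Pow UNIV" by simp
  from st this assms(1)[unfolded bor] show ?thesis
  proof (induct rule: sigma_sets_induct_disjoint)
    case (basic A)
    then show ?case using assms(2) by (auto simp: Gen_def)
  next
    case empty
    show ?case by (rule assms(3))
  next
    case (compl A)
    then show ?case by (intro assms(4)) (simp_all add: bor)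
  next
    case (union A)
    then show ?case by (intro assms(5)) (auto simp: bor)
  qed
qed

section \<open>The spectral theorem on a uniformly positive subspace\<close>

locale bounded_sa = positive_range +
  fixes S :: "'a \<Rightarrow> 'a"
  assumes S: "sa S"
begin

text \<open>F is the support of \<open>C\<close>, twice the positive part of A = S - t P, and plays
  the role of the spectral projection of (t, \<infinity>). The fifth property is strictness: a
  nonzero vector in the range of F lies strictly above t. It excludes the eigenvalue t and drives
  all later uniqueness arguments.\<close>

lemma upper_spectral_projection:
  obtains F where "sa F" "\<And>x. F (F x) = F x"
    "\<And>B x. cblinear B \<Longrightarrow> (\<And>x. B (S x) = S (B x)) \<Longrightarrow> (\<And>x. B (P x) = P (B x)) \<Longrightarrow> B (F x) = F (B x)"
    "\<And>x. F x = x \<Longrightarrow> t * q x \<le> Re (b (S x) x)"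
    "\<And>x. F x = x \<Longrightarrow> Re (b (S x) x) \<le> t * q x \<Longrightarrow> x = 0"
    "\<And>x. P x = x \<Longrightarrow> F x = 0 \<Longrightarrow> Re (b (S x) x) \<le> t * q x"
proof -
  define A where "A x = S x - t *\<^sub>R P x" for x
  have A: "sa A" unfolding A_def by (intro sa_diff sa_scaleR sa_P S)
  have bA: "Re (b (A x) x) = Re (b (S x) x) - t * q x" if "P x = x" for x
    by (simp add: A_def b_diff_left b_scaleR_left that q_def)
  obtain Y where Y: "sa Y" "pos Y" "\<And>x. Y (Y x) = A (A x)"
    "\<And>B x. cblinear B \<Longrightarrow> (\<And>x. B (A x) = A (B x)) \<Longrightarrow> (\<And>x. B (P x) = P (B x)) \<Longrightarrow> B (Y x) = Y (B x)"
    using sa_absolute_value[OF A] by blast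
  define C where "C x = Y x + A x" for x
  have C: "sa C" unfolding C_def by (intro sa_add A Y)
  have AY: "A (Y x) = Y (A x)" for x by (rule Y(4)[OF saD(1)[OF A]]) (simp_all add: P_absorb[OF A])
  have up: "uniformly_positive G (range C)"
    by (rule uniformly_positive_subset[OF P_pos sa_range[OF C]])
  have symC: "Gsym C" using C by (simp add: sa_def)
  obtain F where F: "cblinear F" "\<And>x. F (F x) = F x" "Gsym F" "range F = closure (range C)"
    "\<And>x. F x = 0 \<longleftrightarrow> C x = 0"
    "\<And>B x. cblinear B \<Longrightarrow> (\<And>x. B (C x) = C (B x)) \<Longrightarrow> B (F x) = F (B x)"
    by (rule support_projection[OF saD(1)[OF C] symC up]) blast
  \<comment> \<open>Since A and Y commute and have equal squares, A (Y + A) = Y (Y + A), so they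
    agree on the range of C and on its closure.\<close>
  have AY_eq: "A x = Y x" if "F x = x" for x
  proof -
    have "x \<in> closure (range C)" using that F(4) by (metis rangeI)
    then obtain s where s: "\<And>n. s n \<in> range C" "s \<longlonglongrightarrow> x" unfolding closure_sequential by blast
    have "A (C u) = Y (C u)" for u
      by (simp add: C_def cblinear_simps[OF saD(1)[OF A]] cblinear_simps[OF saD(1)[OF Y(1)]] AY Y(3))
    then have "A (s n) = Y (s n)" for n using s(1)[of n] by auto
    then have "(\<lambda>n. A (s n)) \<longlonglongrightarrow> Y x" using cblinear_tendsto[OF saD(1)[OF Y(1)] s(2)] by simp
    then show ?thesis using cblinear_tendsto[OF saD(1)[OF A] s(2)] LIMSEQ_unique by blast
  qed
  have PF: "P (F x) = F x" for x
  proof -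
    have "range F \<subseteq> range P"
      unfolding F(4) by (rule closure_minimal[OF sa_range[OF C] closed_range_projection[OF P_lin PP]])
    then show ?thesis using projection_range_iff[of P "F x", OF PP] by blast
  qed
  have FP: "F (P x) = F x" for x
  proof -
    have "C (P x - x) = 0" by (simp add: cblinear_simps[OF saD(1)[OF C]] saD(4)[OF C])
    then have "F (P x - x) = 0" by (simp add: F(5))
    then show ?thesis by (simp add: cblinear_simps[OF F(1)])
  qed
  have sF: "sa F" using F PF FP by (simp add: sa_def)
  have Px: "P x = x" if "F x = x" for x using PF[of x] that by simp
  show ?thesis
  proof (rule that[OF sF F(2)])
    show "B (F x) = F (B x)"
      if B: "cblinear B" "\<And>x. B (S x) = S (B x)" "\<And>x. B (P x) = P (B x)" for B x
    proof (rule F(6)[OF B(1)])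
      have BA: "B (A x) = A (B x)" for x by (simp add: A_def B cblinear_simps[OF B(1)])
      show "B (C x) = C (B x)" for x
        by (simp add: C_def BA Y(4)[OF B(1) BA B(3)] cblinear_simps[OF B(1)])
    qed
    show "t * q x \<le> Re (b (S x) x)" if "F x = x" for x
    proof -
      have "0 \<le> Re (b (Y x) x)" using Y(2) by (simp add: pos_def)
      then show ?thesis using bA[OF Px[OF that]] AY_eq[OF that] by simp
    qed
    show "x = 0" if x: "F x = x" "Re (b (S x) x) \<le> t * q x" for x
    proof -
      have "Re (b (Y x) x) \<le> 0" using bA[OF Px[OF x(1)]] AY_eq[OF x(1)] x(2) by simp
      moreover have "0 \<le> Re (b (Y x) x)" using Y(2) by (simp add: pos_def)
      ultimately have "Re (b (Y x) x) = 0" by linarith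
      then have "(Re (b (Y x) (Y x)))\<^sup>2 \<le> 0" using pos_Cauchy_Schwarz[OF Y(1,2), of x "Y x"] by simp
      then have "q (Y x) = 0" by (simp add: q_def)
      then have "Y x = 0" using q_eq_0[OF saD(3)[OF Y(1)]] by simp
      then have "C x = 0" using AY_eq[OF x(1)] by (simp add: C_def)
      then show ?thesis using F(5) x(1) by metis
    qed
    show "Re (b (S x) x) \<le> t * q x" if x: "P x = x" "F x = 0" for x
    proof -
      have "C x = 0" using x F(5) by blast
      then have "A x = - Y x" by (simp add: C_def eq_neg_iff_add_eq_0 add.commute)
      then have "Re (b (A x) x) = - Re (b (Y x) x)" using b_diff_left[of 0 "Y x" x] by simp
      moreover have "0 \<le> Re (b (Y x) x)" using Y(2) by (simp add: pos_def)
      ultimately show ?thesis using bA[OF x(1)] by simp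
    qed
  qed
qed

definition is_upper :: "real \<Rightarrow> ('a \<Rightarrow> 'a) \<Rightarrow> bool" where
  "is_upper t F \<longleftrightarrow> sa F \<and> (\<forall>x. F (F x) = F x)
    \<and> (\<forall>B. cblinear B \<longrightarrow> (\<forall>x. B (S x) = S (B x)) \<longrightarrow> (\<forall>x. B (P x) = P (B x)) \<longrightarrow> (\<forall>x. B (F x) = F (B x)))
    \<and> (\<forall>x. F x = x \<longrightarrow> t * q x \<le> Re (b (S x) x))
    \<and> (\<forall>x. F x = x \<longrightarrow> Re (b (S x) x) \<le> t * q x \<longrightarrow> x = 0)
    \<and> (\<forall>x. P x = x \<longrightarrow> F x = 0 \<longrightarrow> Re (b (S x) x) \<le> t * q x)"

text \<open>The spectral projection of the closed half line (-\<infinity>, t]. By strictness,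
  vectors with eigenvalue t are annihilated by the upper projection and thus belong here, which
  makes the family right continuous.\<close>

definition Et :: "real \<Rightarrow> 'a \<Rightarrow> 'a" where "Et t x = P x - (SOME F. is_upper t F) x"

lemma is_upper_SOME: "is_upper t (SOME F. is_upper t F)"
proof (rule someI_ex[of "is_upper t"])
  show "\<exists>F. is_upper t F"
  proof (rule upper_spectral_projection[of t])
    fix F assume F: "sa F" "\<And>x. F (F x) = F x"
      "\<And>B x. cblinear B \<Longrightarrow> (\<And>x. B (S x) = S (B x)) \<Longrightarrow> (\<And>x. B (P x) = P (B x)) \<Longrightarrow> B (F x) = F (B x)"
      "\<And>x. F x = x \<Longrightarrow> t * q x \<le> Re (b (S x) x)"
      "\<And>x. F x = x \<Longrightarrow> Re (b (S x) x) \<le> t * q x \<Longrightarrow> x = 0"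
      "\<And>x. P x = x \<Longrightarrow> F x = 0 \<Longrightarrow> Re (b (S x) x) \<le> t * q x"
    have "B (F x) = F (B x)" if "cblinear B" "\<forall>x. B (S x) = S (B x)" "\<forall>x. B (P x) = P (B x)" for B x
      by (rule F(3)[OF that(1)]) (simp_all add: that(2,3)[rule_format])
    then have "is_upper t F"
      unfolding is_upper_def by (intro conjI allI impI F(1,2,4,6)) (simp_all only: F(5))
    then show ?thesis by blast
  qed
qed

lemma Et_obtain:
  obtains F where "is_upper t F" "Et t = (\<lambda>x. P x - F x)"
  using that[OF is_upper_SOME] by (simp add: Et_def fun_eq_iff)

lemma is_upperD:
  assumes "is_upper t F"
  shows "sa F" "F (F x) = F x" "F x = x \<Longrightarrow> t * q x \<le> Re (b (S x) x)"
    "F x = x \<Longrightarrow> Re (b (S x) x) \<le> t * q x \<Longrightarrow> x = 0"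
    "P x = x \<Longrightarrow> F x = 0 \<Longrightarrow> Re (b (S x) x) \<le> t * q x"
    "cblinear B \<Longrightarrow> (\<And>x. B (S x) = S (B x)) \<Longrightarrow> (\<And>x. B (P x) = P (B x)) \<Longrightarrow> B (F x) = F (B x)"
  using assms by (simp_all add: is_upper_def)

lemma Et_sa: "sa (Et t)"
proof -
  obtain F where F: "is_upper t F" "Et t = (\<lambda>x. P x - F x)" by (rule Et_obtain)
  show ?thesis unfolding F(2) by (rule sa_diff[OF sa_P is_upperD(1)[OF F(1)]])
qed

lemma Et_idem: "Et t (Et t x) = Et t x"
proof -
  obtain F where F: "is_upper t F" "Et t = (\<lambda>x. P x - F x)" by (rule Et_obtain)
  note sF = is_upperD(1)[OF F(1)]
  show ?thesis unfolding F(2)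
    by (simp add: cblinear_simps(2)[OF P_lin] cblinear_simps(2)[OF saD(1)[OF sF]] PP saD(3,4)[OF sF]
        is_upperD(2)[OF F(1)])
qed

lemma Et_comm:
  assumes B: "cblinear B" "\<And>x. B (S x) = S (B x)" "\<And>x. B (P x) = P (B x)"
  shows "B (Et t x) = Et t (B x)"
proof -
  obtain F where F: "is_upper t F" "Et t = (\<lambda>x. P x - F x)" by (rule Et_obtain)
  show ?thesis unfolding F(2)
    by (simp add: cblinear_simps(2)[OF B(1)] is_upperD(6)[OF F(1) B] B(3))
qed

lemma Et_le:
  assumes x: "Et t x = x"
  shows "Re (b (S x) x) \<le> t * q x"
proof -
  obtain F where F: "is_upper t F" "Et t = (\<lambda>x. P x - F x)" by (rule Et_obtain)
  have Px: "P x = x" using saD(3)[OF Et_sa, of t x] x by simp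
  moreover have "F x = 0" using x Px by (simp add: F(2))
  ultimately show ?thesis by (rule is_upperD(5)[OF F(1)])
qed

lemma Et_gt:
  assumes x: "P x = x" "Et t x = 0"
  shows "t * q x \<le> Re (b (S x) x)" "Re (b (S x) x) \<le> t * q x \<Longrightarrow> x = 0"
proof -
  obtain F where F: "is_upper t F" "Et t = (\<lambda>x. P x - F x)" by (rule Et_obtain)
  have Fx: "F x = x" using x by (simp add: F(2))
  show "t * q x \<le> Re (b (S x) x)" "Re (b (S x) x) \<le> t * q x \<Longrightarrow> x = 0"
    using is_upperD(3,4)[OF F(1) Fx] .
qed

lemma S_form_bound: obtains L where "L \<ge> 0" "\<And>x. P x = x \<Longrightarrow> \<bar>Re (b (S x) x)\<bar> \<le> L * q x"
proof -
  obtain K where K: "K > 0" "\<And>x. norm (S x) \<le> K * norm (P x)" using sa_norm_bound[OF S] by blast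
  show ?thesis
  proof (rule that[of "bK * K / dl"])
    show "bK * K / dl \<ge> 0" using bK K dl by simp
    fix x assume x: "P x = x"
    have "\<bar>Re (b (S x) x)\<bar> \<le> bK * norm (S x) * norm x"
      using abs_Re_le_cmod[of "b (S x) x"] bK(2)[of "S x" x] by linarith
    also have "\<dots> \<le> bK * (K * norm x) * norm x"
      using K(2)[of x] x bK(1) by (intro mult_right_mono mult_left_mono) auto
    also have "\<dots> = bK * K * (norm x)\<^sup>2" by (simp add: power2_eq_square)
    also have "\<dots> \<le> bK * K * (q x / dl)" using bK K by (intro mult_left_mono norm_le_q x) auto
    finally show "\<bar>Re (b (S x) x)\<bar> \<le> bK * K / dl * q x" by simp
  qed
qed

lemma sa_proj_q: "sa Q \<Longrightarrow> Q (Q x) = Q x \<Longrightarrow> Re (b (Q x) x) = q (Q x)"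
  unfolding q_def using saD(2)[of Q "Q x" x] by simp

lemma Et_S: "S (Et t x) = Et t (S x)"
  by (rule Et_comm[OF saD(1)[OF S]]) (simp_all add: P_absorb[OF S])

lemma Et_P: "P (Et t x) = Et t x" "Et t (P x) = Et t x"
  using saD(3,4)[OF Et_sa] .

lemma Et_commute: "Et s (Et t x) = Et t (Et s x)"
  by (rule Et_comm[OF saD(1)[OF Et_sa]]) (simp_all add: Et_S Et_P)

lemmas Et_lin = cblinear_simps[OF saD(1)[OF Et_sa]]

text \<open>A vector in the range of \<open>Et s\<close> and in the kernel of \<open>Et t\<close>
  has form at most s q \<le> t q, so strictness forces it to vanish.\<close>

lemma Et_mono: assumes "s \<le> t" shows "Et t (Et s x) = Et s x"
proof -
  define y where "y = Et s x - Et t (Et s x)"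
  have "Et s y = y" by (simp add: y_def Et_lin Et_commute[of s t] Et_idem)
  moreover have "Et t y = 0" by (simp add: y_def Et_lin Et_idem)
  moreover have "P y = y" by (simp add: y_def cblinear_simps[OF P_lin] Et_P)
  moreover have "s * q y \<le> t * q y" using assms q_nonneg[OF \<open>P y = y\<close>] by (rule mult_right_mono)
  ultimately have "y = 0" using Et_le[of s y] Et_gt(2)[of y t] by simp
  then show ?thesis by (simp add: y_def)
qed

lemma Et_min: "Et s (Et t x) = Et (min s t) x"
  using Et_mono[of s t x] Et_mono[of t s x] Et_commute[of s t x] by (cases "s \<le> t") (simp_all add: min_def)

section \<open>Distribution functions and the associated measures\<close>

definition Fd :: "'a \<Rightarrow> real \<Rightarrow> real" where "Fd x t = Re (b (Et t x) x)"

lemma Fd_eq: "Fd x t = q (Et t x)"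
  unfolding Fd_def by (rule sa_proj_q[OF Et_sa Et_idem])

lemma Fd_mono: assumes "s \<le> t" shows "Fd x s \<le> Fd x t"
proof -
  have 1: "sa (\<lambda>x. Et t x - Et s x)" by (rule sa_diff[OF Et_sa Et_sa])
  have "Re (b (Et t x - Et s x) x) = q (Et t x - Et s x)"
    using assms by (intro sa_proj_q[OF 1]) (simp add: Et_lin Et_min min_def)
  moreover have "0 \<le> q (Et t x - Et s x)" by (rule q_nonneg[OF saD(3)[OF 1]])
  ultimately show ?thesis by (simp add: Fd_def b_diff_left)
qed

lemma Et_extremes: obtains L where "\<And>t x. t < - L \<Longrightarrow> Et t x = 0" "\<And>t x. t > L \<Longrightarrow> Et t x = P x"
proof -
  obtain L where L: "L \<ge> 0" "\<And>x. P x = x \<Longrightarrow> \<bar>Re (b (S x) x)\<bar> \<le> L * q x" using S_form_bound by blast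
  show ?thesis
  proof (rule that[of L])
    fix t x
    show "Et t x = 0" if "t < - L"
    proof -
      define y where "y = Et t x"
      have y: "P y = y" "Et t y = y" by (simp_all add: y_def Et_P Et_idem)
      have "- (L * q y) \<le> t * q y" using L(2)[OF y(1)] Et_le[OF y(2)] by linarith
      then have "(L + t) * q y \<ge> 0" by (simp add: algebra_simps)
      then have "q y \<le> 0" using that by (auto simp: zero_le_mult_iff)
      then show ?thesis using q_eq_0[OF y(1)] by (simp add: y_def)
    qed
    show "Et t x = P x" if "t > L"
    proof -
      define y where "y = P x - Et t x"
      have y: "P y = y" "Et t y = 0"
        by (simp_all add: y_def Et_P Et_idem Et_lin cblinear_simps[OF P_lin] PP)
      have "L * q y \<le> t * q y" using that q_nonneg[OF y(1)] by (intro mult_right_mono) auto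
      then have "y = 0" using L(2)[OF y(1)] by (intro Et_gt(2)[OF y]) linarith
      then show ?thesis by (simp add: y_def)
    qed
  qed
qed

text \<open>The limit of \<open>Et (s n) x - Et t x\<close> lies in the kernel of
  \<open>Et t\<close> and in the range of every \<open>Et (s m)\<close>. Its form is thus at most t
  q, and strictness makes it zero.\<close>

lemma Fd_seq: "(\<lambda>n. Fd x (t + 1 / real (Suc n))) \<longlonglongrightarrow> Fd x t"
proof -
  define s where "s n = t + 1 / real (Suc n)" for n
  have sle: "s m \<le> s n" if "n \<le> m" for m n using that by (simp add: s_def frac_le)
  \<comment> \<open>The points s n decrease, so it is the complements that increase and admit a
    monotone limit.\<close>
  define C where "C n x = P x - Et (s n) x" for n x
  have Csa: "sa (C n)" for n unfolding C_def by (rule sa_diff[OF sa_P Et_sa])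
  have Cproj: "C n (C n x) = C n x" for n x
    by (simp add: C_def Et_lin cblinear_simps[OF P_lin] PP Et_P Et_idem)
  have qP: "q (P x) = Re (b (P x) x)" for x by (simp add: q_def P_b PP)
  have bC: "Re (b (C n x) x) = q (P x) - Fd x (s n)" for n x by (simp add: C_def b_diff_left qP Fd_def)
  obtain L where L: "sa L" "\<And>x. (\<lambda>n. C n x) \<longlonglongrightarrow> L x"
  proof (rule monotone_operator_limit[of C 1])
    show "sa (C n)" for n by (rule Csa)
    show "pos (C 0)" unfolding pos_def
      using sa_proj_q[OF Csa Cproj] q_nonneg[OF saD(3)[OF Csa]] by simp
    show "Re (b (C n x) x) \<le> Re (b (C (Suc n) x) x)" for n x
      unfolding bC using Fd_mono[OF sle[of n "Suc n"]] by simp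
    show "Re (b (C n x) x) \<le> 1 * q (P x)" for n x
      unfolding bC Fd_eq using q_nonneg[OF Et_P(1)] by simp
  qed auto
  define y where "y = P x - L x - Et t x"
  have Elim: "(\<lambda>n. Et (s n) x) \<longlonglongrightarrow> P x - L x"
    using tendsto_diff[OF tendsto_const L(2)[of x], of "P x"] by (simp add: C_def)
  then have ylim: "(\<lambda>n. Et (s n) x - Et t x) \<longlonglongrightarrow> y" unfolding y_def by (intro tendsto_intros)
  have st: "t \<le> s n" for n by (simp add: s_def)
  have yP: "P y = y"
    by (rule LIMSEQ_unique[OF cblinear_tendsto[OF P_lin ylim]])
       (simp add: cblinear_simps[OF P_lin] Et_P ylim)
  have y0: "Et t y = 0"
  proof (rule LIMSEQ_unique[OF cblinear_tendsto[OF saD(1)[OF Et_sa] ylim]])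
    have "Et t (Et (s n) x - Et t x) = 0" for n
      using st[of n] by (simp add: Et_lin Et_min min_def)
    then show "(\<lambda>n. Et t (Et (s n) x - Et t x)) \<longlonglongrightarrow> 0" by simp
  qed
  have ys: "Et (s m) y = y" for m
  proof (rule LIMSEQ_unique[OF cblinear_tendsto[OF saD(1)[OF Et_sa] ylim]])
    have "\<forall>\<^sub>F n in sequentially. Et (s n) x - Et t x = Et (s m) (Et (s n) x - Et t x)"
      unfolding eventually_sequentially
    proof (intro exI[of _ m] allI impI)
      fix n assume "m \<le> n"
      then show "Et (s n) x - Et t x = Et (s m) (Et (s n) x - Et t x)"
        using sle[of m n] st[of m] by (simp add: Et_lin Et_mono)
    qed
    then show "(\<lambda>n. Et (s m) (Et (s n) x - Et t x)) \<longlonglongrightarrow> y"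
      by (rule Lim_transform_eventually[OF ylim])
  qed
  have slim: "s \<longlonglongrightarrow> t"
    using tendsto_add[OF tendsto_const LIMSEQ_inverse_real_of_nat, of t]
    by (simp add: inverse_eq_divide s_def[abs_def])
  have "Re (b (S y) y) \<le> t * q y"
    by (rule LIMSEQ_le_const[OF tendsto_mult[OF slim tendsto_const]]) (use Et_le[OF ys] in auto)
  then have "y = 0" by (rule Et_gt(2)[OF yP y0])
  then have "(\<lambda>n. Et (s n) x) \<longlonglongrightarrow> Et t x" using Elim by (simp add: y_def)
  from tendsto_q[OF this] show ?thesis by (simp add: Fd_eq s_def)
qed

lemma Fd_right_continuous: "continuous (at_right t) (Fd x)"
  unfolding continuous_within tendsto_iff eventually_at_right_field
proof (intro allI impI)
  fix e :: real assume e: "e > 0"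
  obtain n where n: "dist (Fd x (t + 1 / real (Suc n))) (Fd x t) < e"
    using metric_LIMSEQ_D[OF Fd_seq e, of x t] by blast
  have "dist (Fd x s) (Fd x t) < e" if "s > t" "s < t + 1 / real (Suc n)" for s
    using n Fd_mono[of t s x] Fd_mono[of s "t + 1 / real (Suc n)" x] that
    by (simp add: dist_real_def)
  then show "\<exists>b>t. \<forall>y>t. y < b \<longrightarrow> dist (Fd x y) (Fd x t) < e"
    by (intro exI[of _ "t + 1 / real (Suc n)"]) auto
qed

definition mu :: "'a \<Rightarrow> real measure" where "mu x = interval_measure (Fd x)"

lemma mu_sets [simp]: "sets (mu x) = sets borel" and mu_space [simp]: "space (mu x) = UNIV"
  by (simp_all add: mu_def)

lemma mu_Ioc: "s \<le> t \<Longrightarrow> emeasure (mu x) {s<..t} = ennreal (Fd x t - Fd x s)"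
  unfolding mu_def by (rule emeasure_interval_measure_Ioc) (auto intro: Fd_mono Fd_right_continuous)

text \<open>S is bounded, so \<open>Fd x\<close> vanishes far to the left and the half open
  intervals that exhaust the half line eventually have the constant measure
  \<open>Fd x t\<close>.\<close>

lemma mu_emeasure_atMost: "emeasure (mu x) {..t} = ennreal (Fd x t)"
proof -
  obtain L where L: "\<And>t x. t < - L \<Longrightarrow> Et t x = 0" "\<And>t x. t > L \<Longrightarrow> Et t x = P x"
    using Et_extremes by blast
  have lim: "(\<lambda>n. emeasure (mu x) {t - real n<..t}) \<longlonglongrightarrow> emeasure (mu x) (\<Union>n. {t - real n<..t})"
    by (rule Lim_emeasure_incseq) (auto intro!: incseq_SucI)
  have "(\<Union>n. {t - real n<..t}) = {..t}"
  proof (intro equalityI subsetI)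
    fix s assume "s \<in> {..t}"
    moreover obtain n where "t - s < real n" using reals_Archimedean2 by blast
    ultimately show "s \<in> (\<Union>n. {t - real n<..t})" by (auto intro!: exI[of _ n])
  qed auto
  moreover have "\<forall>\<^sub>F n in sequentially. ennreal (Fd x t) = emeasure (mu x) {t - real n<..t}"
  proof -
    obtain N where N: "t + L < real N" using reals_Archimedean2 by blast
    have "Fd x (t - real n) = 0" if "N \<le> n" for n
      using N that by (simp add: Fd_def L(1))
    then show ?thesis unfolding eventually_sequentially by (intro exI[of _ N]) (simp add: mu_Ioc)
  qed
  ultimately show ?thesis using lim Lim_transform_eventually[OF tendsto_const] LIMSEQ_unique by metis
qed

lemma mu_emeasure_UNIV: "emeasure (mu x) UNIV = ennreal (q (P x))"
proof -
  obtain L where L: "\<And>t x. t < - L \<Longrightarrow> Et t x = 0" "\<And>t x. t > L \<Longrightarrow> Et t x = P x"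
    using Et_extremes by blast
  have lim: "(\<lambda>n. emeasure (mu x) {..real n}) \<longlonglongrightarrow> emeasure (mu x) (\<Union>n. {..real n})"
    by (rule Lim_emeasure_incseq) (auto intro!: incseq_SucI)
  have "(\<Union>n. {..real n}) = UNIV"
  proof (intro equalityI subsetI)
    fix s :: real
    obtain n where "s < real n" using reals_Archimedean2 by blast
    then show "s \<in> (\<Union>n. {..real n})" by (auto intro!: exI[of _ n])
  qed auto
  moreover have "\<forall>\<^sub>F n in sequentially. ennreal (q (P x)) = emeasure (mu x) {..real n}"
  proof -
    obtain N where N: "L < real N" using reals_Archimedean2 by blast
    have "Fd x (real n) = q (P x)" if "N \<le> n" for n
      using N that by (simp add: Fd_eq L(2))
    then show ?thesis unfolding eventually_sequentially by (intro exI[of _ N]) (simp add: mu_emeasure_atMost)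
  qed
  ultimately show ?thesis using lim Lim_transform_eventually[OF tendsto_const] LIMSEQ_unique by metis
qed

lemma mu_finite: "finite_measure (mu x)"
  by (rule finite_measureI) (simp add: mu_emeasure_UNIV)

lemma mu_UNIV: "measure (mu x) UNIV = q (P x)"
  using q_nonneg[OF PP] by (simp add: measure_def mu_emeasure_UNIV)

lemma mu_atMost: "measure (mu x) {..t} = Fd x t"
  using q_nonneg[OF Et_P(1)] by (simp add: measure_def mu_emeasure_atMost Fd_eq)

lemma mu_compl: "A \<in> sets borel \<Longrightarrow> measure (mu x) (UNIV - A) = q (P x) - measure (mu x) A"
  using finite_measure.finite_measure_compl[OF mu_finite, of A x] by (simp add: mu_UNIV)

section \<open>Projections attached to Borel sets\<close>

definition commP :: "('a \<Rightarrow> 'a) \<Rightarrow> bool" where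
  "commP B \<longleftrightarrow> cblinear B \<and> (\<forall>x. B (S x) = S (B x)) \<and> (\<forall>x. B (P x) = P (B x))"

text \<open>A quadratic form determines its member of \<open>sa\<close>, so at most one operator
  represents A and Borel induction has only existence to prove. The commutation clause travels along
  the induction and later gives that the projections of two Borel sets commute.\<close>

definition represents :: "('a \<Rightarrow> 'a) \<Rightarrow> real set \<Rightarrow> bool" where
  "represents C A \<longleftrightarrow> sa C \<and> (\<forall>x. Re (b (C x) x) = measure (mu x) A)
     \<and> (\<forall>B. commP B \<longrightarrow> (\<forall>x. B (C x) = C (B x)))"

text \<open>The forms of the partial sums increase and stay below the total mass
  \<open>q (P x)\<close>, so the sum converges at every vector and not merely as a form.\<close>

lemma represents_sums:
  assumes A: "disjoint_family A" "\<And>i. A i \<in> sets borel" and C: "\<And>i. represents (C i) (A i)"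
  obtains L where "represents L (\<Union>i. A i)" "\<And>x. (\<lambda>n. \<Sum>i<n. C i x) \<longlonglongrightarrow> L x"
proof -
  have Csa: "sa (C i)" and Cmu: "Re (b (C i x) x) = measure (mu x) (A i)" for i x
    using C[of i] by (simp_all add: represents_def)
  define W where "W n x = (\<Sum>i<n. C i x)" for n x
  have W0: "W 0 = (\<lambda>x. 0)" and WS: "W (Suc n) = (\<lambda>x. W n x + C n x)" for n
    by (simp_all add: W_def fun_eq_iff)
  have Wsa: "sa (W n)" for n
    by (induction n) (simp_all add: W0 WS sa_0 sa_add Csa)
  have Wmu: "Re (b (W n x) x) = (\<Sum>i<n. measure (mu x) (A i))" for n x
    by (induction n) (simp_all add: W0 WS b_add_left Cmu)
  have WU: "(\<lambda>n. Re (b (W n x) x)) \<longlonglongrightarrow> measure (mu x) (\<Union>i. A i)" for x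
    unfolding Wmu using finite_measure.finite_measure_UNION[OF mu_finite, of A x] A
    by (auto simp: sums_def)
  obtain L where L: "sa L" "\<And>x. (\<lambda>n. W n x) \<longlonglongrightarrow> L x"
  proof (rule monotone_operator_limit[of W 1])
    show "sa (W n)" for n by (rule Wsa)
    show "pos (W 0)" by (simp add: pos_def W0)
    show "Re (b (W n x) x) \<le> Re (b (W (Suc n) x) x)" for n x by (simp add: Wmu)
    have inc: "incseq (\<lambda>n. Re (b (W n x) x))" for x by (rule incseq_SucI) (simp add: Wmu)
    show "Re (b (W n x) x) \<le> 1 * q (P x)" for n x
    proof -
      have "Re (b (W n x) x) \<le> measure (mu x) (\<Union>i. A i)" by (rule incseq_le[OF inc WU])
      also have "\<dots> \<le> measure (mu x) UNIV"
        by (rule finite_measure.finite_measure_mono[OF mu_finite]) (auto)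
      finally show ?thesis by (simp add: mu_UNIV)
    qed
  qed auto
  have "represents L (\<Union>i. A i)" unfolding represents_def
  proof (intro conjI allI impI)
    show "sa L" by (rule L)
    show "Re (b (L x) x) = measure (mu x) (\<Union>i. A i)" for x
      by (rule LIMSEQ_unique[OF tendsto_Re[OF tendsto_b[OF L(2) tendsto_const]] WU])
    fix B x assume B: "commP B"
    then have Bl: "cblinear B" by (simp add: commP_def)
    have "B (W n x) = W n (B x)" for n
      using C B by (induction n) (simp_all add: W0 WS cblinear_simps[OF Bl] represents_def)
    then have "(\<lambda>n. B (W n x)) \<longlonglongrightarrow> L (B x)" using L(2)[of "B x"] by simp
    then show "B (L x) = L (B x)" using cblinear_tendsto[OF Bl L(2)] LIMSEQ_unique by blast
  qed
  then show ?thesis using that[of L] L(2) by (simp add: W_def)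
qed

lemma represents_unique:
  "represents C A \<Longrightarrow> represents C' A \<Longrightarrow> C x = C' x"
  by (rule sa_eqI) (simp_all add: represents_def)

lemma represents_atMost: "represents (Et t) {..t}"
  unfolding represents_def commP_def using Et_sa Et_comm by (simp add: mu_atMost Fd_def)

lemma represents_empty: "represents (\<lambda>x. 0) {}"
  unfolding represents_def commP_def by (simp add: sa_0 cblinear_simps)

lemma represents_compl:
  assumes "A \<in> sets borel" "represents C A"
  shows "represents (\<lambda>x. P x - C x) (UNIV - A)"
proof -
  have qP: "q (P x) = Re (b (P x) x)" for x by (simp add: q_def P_b PP)
  show ?thesis
    using assms(2) unfolding represents_def commP_def
    by (simp add: sa_diff[OF sa_P] mu_compl[OF assms(1)] b_diff_left qP cblinear_simps)
qed

lemma represents_exists: "A \<in> sets borel \<Longrightarrow> \<exists>C. represents C A"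
proof (induction rule: borel_induct)
  case (union A)
  then obtain C where "\<And>i. represents (C i) (A i)" by metis
  then show ?case using represents_sums[OF union(1,2)] by metis
qed (use represents_atMost represents_empty represents_compl in blast)+

definition EB :: "real set \<Rightarrow> 'a \<Rightarrow> 'a" where "EB A = (SOME C. represents C A)"

lemma EB: "A \<in> sets borel \<Longrightarrow> represents (EB A) A"
  unfolding EB_def by (rule someI_ex[OF represents_exists])

lemma EB_sa: "A \<in> sets borel \<Longrightarrow> sa (EB A)"
  and EB_mu: "A \<in> sets borel \<Longrightarrow> Re (b (EB A x) x) = measure (mu x) A"
  and EB_comm: "A \<in> sets borel \<Longrightarrow> commP B \<Longrightarrow> B (EB A x) = EB A (B x)"
  using EB[of A] by (simp_all add: represents_def)

lemma EB_eqI: "represents C A \<Longrightarrow> A \<in> sets borel \<Longrightarrow> EB A x = C x"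
  by (rule represents_unique[OF EB])

lemma EB_atMost: "EB {..t} x = Et t x"
  by (rule EB_eqI[OF represents_atMost]) simp
lemma EB_empty: "EB {} x = 0"
  by (rule EB_eqI[OF represents_empty]) simp
lemma EB_compl: "A \<in> sets borel \<Longrightarrow> EB (UNIV - A) x = P x - EB A x"
  using represents_compl[OF _ EB] by (rule EB_eqI) auto

lemma EB_sums:
  assumes A: "disjoint_family A" "\<And>i. A i \<in> sets borel"
  shows "(\<lambda>n. \<Sum>i<n. EB (A i) x) \<longlonglongrightarrow> EB (\<Union>i. A i) x"
proof -
  obtain L where "represents L (\<Union>i. A i)" "\<And>x. (\<lambda>n. \<Sum>i<n. EB (A i) x) \<longlonglongrightarrow> L x"
    using represents_sums[OF A, of "\<lambda>i. EB (A i)"] EB[OF A(2)] by blast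
  then show ?thesis using EB_eqI[of L "\<Union>i. A i" x] A(2) by auto
qed

lemma EB_add:
  assumes "A \<in> sets borel" "C \<in> sets borel" "A \<inter> C = {}"
  shows "EB (A \<union> C) x = EB A x + EB C x"
proof (rule sa_eqI[OF EB_sa sa_add[OF EB_sa EB_sa]])
  fix x
  show "Re (b (EB (A \<union> C) x) x) = Re (b (EB A x + EB C x) x)"
    using assms finite_measure.finite_measure_Union[OF mu_finite, of A x C]
    by (simp add: EB_mu b_add_left)
qed (use assms in auto)

lemma commP_EB: "A \<in> sets borel \<Longrightarrow> commP (EB A)"
proof -
  assume A: "A \<in> sets borel"
  have "commP S" using saD(1)[OF S] by (simp add: commP_def P_absorb[OF S])
  then show ?thesis using EB_comm[OF A, of S] saD(1)[OF EB_sa[OF A]] P_absorb[OF EB_sa[OF A]]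
    by (simp add: commP_def)
qed

lemma EB_commute: "A \<in> sets borel \<Longrightarrow> C \<in> sets borel \<Longrightarrow> EB A (EB C x) = EB C (EB A x)"
  using EB_comm[OF _ commP_EB] by blast

text \<open>Induction on A with C fixed: multiplicativity against C passes from half lines to all
  Borel sets.\<close>

lemma EB_Int_aux:
  assumes C: "C \<in> sets borel" and base: "\<And>t x. EB ({..t} \<inter> C) x = EB {..t} (EB C x)"
    and A: "A \<in> sets borel"
  shows "EB (A \<inter> C) x = EB A (EB C x)"
  using A
proof (induction arbitrary: x rule: borel_induct)
  case (basic t)
  show ?case by (rule base)
next
  case empty
  show ?case by (simp add: EB_empty)
next
  case (compl A)
  have "EB ((A \<inter> C) \<union> ((UNIV - A) \<inter> C)) x = EB (A \<inter> C) x + EB ((UNIV - A) \<inter> C) x"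
    using compl(1) C by (intro EB_add sets.Int) auto
  moreover have "(A \<inter> C) \<union> ((UNIV - A) \<inter> C) = C" by blast
  ultimately have "EB ((UNIV - A) \<inter> C) x = EB C x - EB (A \<inter> C) x" by simp
  then show ?case by (simp only: compl(2) EB_compl[OF compl(1)] saD(3)[OF EB_sa[OF C]])
next
  case (union A)
  have "(\<lambda>n. \<Sum>i<n. EB (A i \<inter> C) x) \<longlonglongrightarrow> EB (\<Union>i. A i \<inter> C) x"
    using union C by (intro EB_sums) (auto simp: disjoint_family_on_def)
  then have "(\<lambda>n. \<Sum>i<n. EB (A i) (EB C x)) \<longlonglongrightarrow> EB (\<Union>i. A i \<inter> C) x"
    by (simp add: union(3))
  moreover have "(\<lambda>n. \<Sum>i<n. EB (A i) (EB C x)) \<longlonglongrightarrow> EB (\<Union>i. A i) (EB C x)"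
    using union by (intro EB_sums)
  ultimately have "EB (\<Union>i. A i \<inter> C) x = EB (\<Union>i. A i) (EB C x)" by (rule LIMSEQ_unique)
  then show ?case by simp
qed

text \<open>The induction runs twice. With C a half line the base case is \<open>Et_min\<close>; for
  general C the base case is the first run with its factors exchanged.\<close>

lemma EB_Int:
  assumes A: "A \<in> sets borel" and C: "C \<in> sets borel"
  shows "EB (A \<inter> C) x = EB A (EB C x)"
proof -
  have 1: "EB (A \<inter> {..t}) x = EB A (EB {..t} x)" if "A \<in> sets borel" for A t x
  proof (rule EB_Int_aux[OF _ _ that])
    fix s x
    have "{..s} \<inter> {..t} = {..min s t}" by auto
    then show "EB ({..s} \<inter> {..t}) x = EB {..s} (EB {..t} x)" by (simp add: EB_atMost Et_min)
  qed simp
  show ?thesis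
  proof (rule EB_Int_aux[OF C _ A])
    fix t x
    show "EB ({..t} \<inter> C) x = EB {..t} (EB C x)"
      using 1[OF C, of t x] EB_commute[OF C, of "{..t}" x] by (simp add: Int_commute)
  qed
qed

lemma EB_idem: "A \<in> sets borel \<Longrightarrow> EB A (EB A x) = EB A x"
  using EB_Int[of A A x] by simp

lemma EB_subset: "A \<in> sets borel \<Longrightarrow> C \<in> sets borel \<Longrightarrow> A \<subseteq> C \<Longrightarrow> EB C (EB A x) = EB A x"
  using EB_Int[of C A x] by (simp add: Int_absorb1)

lemma EB_upper:
  assumes A: "A \<in> sets borel" "A \<subseteq> {..v}" and x: "EB A x = x"
  shows "Re (b (S x) x) \<le> v * q x"
proof (rule Et_le)
  show "Et v x = x" using EB_subset[OF A(1) _ A(2), of x] x by (simp add: EB_atMost)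
qed

lemma EB_lower:
  assumes A: "A \<in> sets borel" "A \<subseteq> {u<..}" and x: "EB A x = x"
  shows "u * q x \<le> Re (b (S x) x)"
proof (rule Et_gt(1))
  show "P x = x" using saD(3)[OF EB_sa[OF A(1)], of x] x by simp
  have "{..u} \<inter> A = {}" using A(2) by fastforce
  then show "Et u x = 0" using EB_Int[of "{..u}" A x] A(1) x by (simp add: EB_atMost EB_empty)
qed

text \<open>On this spectral subspace C = S - (w - h) satisfies 0 \<le> C \<le> 2 h, hence C^2 \<le>
  2 h C. Expanding with C = (S - w) + h leaves (S - w)^2 \<le> h^2.\<close>

lemma EB_small:
  assumes A: "A \<in> sets borel" "A \<subseteq> {w - h<..w + h}" and x: "EB A x = x"
  shows "q (S x - w *\<^sub>R x) \<le> h\<^sup>2 * q x"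
proof -
  define Q where "Q = EB A"
  have Q: "sa Q" "\<And>x. Q (Q x) = Q x" unfolding Q_def using EB_sa[OF A(1)] EB_idem[OF A(1)] by auto
  have Q1: "A \<subseteq> {..w + h}" "A \<subseteq> {w - h<..}" using A(2) by auto
  have SQ: "S (Q x) = Q (S x)" for x
    using commP_EB[OF A(1)] by (simp add: commP_def Q_def)
  define C where "C x = S (Q x) - (w - h) *\<^sub>R Q x" for x
  have C: "sa C" unfolding C_def
    by (rule sa_diff[OF sa_compose[OF S Q(1) SQ] sa_scaleR[OF Q(1)]])
  have bC: "Re (b (C x) x) = Re (b (S (Q x)) (Q x)) - (w - h) * q (Q x)" for x
  proof -
    have "b (S (Q x)) x = b (Q (S (Q x))) x" by (simp add: SQ Q(2))
    then have "b (S (Q x)) x = b (S (Q x)) (Q x)" by (simp add: saD(2)[OF Q(1)])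
    then show ?thesis by (simp add: C_def b_diff_left b_scaleR_left sa_proj_q[OF Q])
  qed
  have QP: "q (Q x) \<le> q (P x)" for x
  proof -
    have "q (Q x) = measure (mu x) A" using EB_mu[OF A(1)] sa_proj_q[OF Q] by (simp add: Q_def)
    also have "\<dots> \<le> measure (mu x) UNIV"
      by (rule finite_measure.finite_measure_mono[OF mu_finite]) auto
    finally show ?thesis by (simp add: mu_UNIV)
  qed
  show ?thesis
  proof (cases "h \<ge> 0")
    case False
    then have "A = {}" using A(2) by force
    then have "x = 0" using x by (simp add: EB_empty)
    then show ?thesis by (simp add: cblinear_simps[OF saD(1)[OF S]] q_def)
  next
    case h: True
    have "q (C x) \<le> (2 * h) * Re (b (C x) x)"
    proof (rule pos_bound[OF C])
      show "pos C" unfolding pos_def bC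
        using EB_lower[OF A(1) Q1(2), of "Q _"] Q(2) by (simp add: Q_def)
      fix x
      have "Re (b (C x) x) \<le> (2 * h) * q (Q x)" unfolding bC
        using EB_upper[OF A(1) Q1(1), of "Q x"] Q(2) by (simp add: Q_def algebra_simps)
      also have "\<dots> \<le> (2 * h) * q (P x)" using h QP by (intro mult_left_mono) auto
      finally show "Re (b (C x) x) \<le> (2 * h) * q (P x)" .
    qed
    moreover have Qx: "Q x = x" using x by (simp add: Q_def)
    moreover have "C x = (S x - w *\<^sub>R x) + h *\<^sub>R x" by (simp add: C_def Qx scaleR_left_diff_distrib)
    ultimately have "q ((S x - w *\<^sub>R x) + h *\<^sub>R x) \<le> (2 * h) * Re (b ((S x - w *\<^sub>R x) + h *\<^sub>R x) x)" by simp
    moreover have "q ((S x - w *\<^sub>R x) + h *\<^sub>R x) = q (S x - w *\<^sub>R x) + 2 * (h * Re (b (S x - w *\<^sub>R x) x)) + h\<^sup>2 * q x"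
      by (simp only: q_add q_scaleR b_scaleR_right) simp
    moreover have "Re (b ((S x - w *\<^sub>R x) + h *\<^sub>R x) x) = Re (b (S x - w *\<^sub>R x) x) + h * q x"
      by (simp only: b_add_left b_scaleR_left q_def) simp
    ultimately show ?thesis by (simp add: power2_eq_square algebra_simps)
  qed
qed

lemma EB_null_UN:
  assumes A: "\<And>i::nat. A i \<in> sets borel" "\<And>i. EB (A i) x = 0" and C: "C \<in> sets borel" "C \<subseteq> (\<Union>i. A i)"
  shows "EB C x = 0"
proof -
  have "emeasure (mu x) (A i) = 0" for i
    using EB_mu[OF A(1), of i x] A(2)[of i] finite_measure.emeasure_eq_measure[OF mu_finite] by simp
  then have "(\<Union>i. A i) \<in> null_sets (mu x)" using A(1) by (intro null_sets_UN) auto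
  then have "C \<in> null_sets (mu x)" using null_sets_subset[of "\<Union>i. A i" "mu x" C] C by simp
  then have "measure (mu x) C = 0" by (simp add: measure_eq_0_null_sets)
  then have "q (EB C x) = 0"
    using EB_mu[OF C(1), of x] sa_proj_q[OF EB_sa[OF C(1)] EB_idem[OF C(1)], of x] by simp
  then show ?thesis using q_eq_0[OF saD(3)[OF EB_sa[OF C(1)]]] by simp
qed

text \<open>On the spectral subspace of a short interval around w the operator S - w is small by
  \<open>EB_small\<close>, which contradicts the assumed lower bound for vectors B (P x) unless they
  vanish there. Countably many such intervals cover A.\<close>

lemma EB_null:
  assumes B: "commP B" and A: "A \<in> sets borel"
    and lb: "\<And>w. w \<in> A \<Longrightarrow> \<exists>k>0. \<forall>x. k * norm (B (P x)) \<le> norm (S (B (P x)) - w *\<^sub>R B (P x))"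
  shows "EB A (B x) = 0"
proof -
  have "\<exists>h>0. \<forall>x. EB (ball w h) (B x) = 0" if w: "w \<in> A" for w
  proof -
    obtain k where k: "k > 0" "\<And>x. k * norm (B (P x)) \<le> norm (S (B (P x)) - w *\<^sub>R B (P x))"
      using lb[OF w] by blast
    \<comment> \<open>With this h the upper bound for the square of the norm of (S - w) y is k^2 / 2
      times that of y, against the lower bound k^2.\<close>
    define h where "h = k / sqrt (2 * bK / dl)"
    have h: "h > 0" using k bK dl by (simp add: h_def)
    have h2: "h\<^sup>2 * (bK / dl) = k\<^sup>2 / 2" using bK dl by (simp add: h_def power_divide)
    have "EB (ball w h) (B x) = 0" for x
    proof -
      define y where "y = EB (ball w h) (B x)"
      have Uy: "EB (ball w h) y = y" unfolding y_def by (rule EB_idem) simp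
      have "ball w h \<subseteq> {w - h<..w + h}" by (auto simp: dist_real_def)
      then have sm: "q (S y - w *\<^sub>R y) \<le> h\<^sup>2 * q y" by (intro EB_small[OF _ _ Uy]) auto
      have Py: "P y = y" using saD(3)[OF EB_sa, of "ball w h" y] Uy by simp
      have yB: "y = B (P (EB (ball w h) x))"
        unfolding y_def using EB_comm[OF _ B, of "ball w h" x] saD(3)[OF EB_sa, of "ball w h" x] by simp
      have "(k * norm y)\<^sup>2 \<le> (norm (S y - w *\<^sub>R y))\<^sup>2"
        using k yB by (intro power_mono) auto
      also have "\<dots> \<le> q (S y - w *\<^sub>R y) / dl"
        by (rule norm_le_q) (simp add: cblinear_simps[OF P_lin] Py saD(3)[OF S])
      also have "\<dots> \<le> (h\<^sup>2 * (bK * (norm y)\<^sup>2)) / dl"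
        using dl sm q_le[of y] by (intro divide_right_mono order_trans[OF sm] mult_left_mono) auto
      also have "\<dots> = (h\<^sup>2 * (bK / dl)) * (norm y)\<^sup>2" by simp
      finally have "k\<^sup>2 * (norm y)\<^sup>2 \<le> (k\<^sup>2 / 2) * (norm y)\<^sup>2" by (simp only: h2 power_mult_distrib)
      then have "(k\<^sup>2 / 2) * (norm y)\<^sup>2 \<le> 0" by simp
      then have "norm y = 0" using k(1) by (simp add: mult_le_0_iff)
      then show ?thesis by (simp add: y_def)
    qed
    then show ?thesis using h by blast
  qed
  then obtain h where h: "\<And>w. w \<in> A \<Longrightarrow> h w > 0" "\<And>w x. w \<in> A \<Longrightarrow> EB (ball w (h w)) (B x) = 0" by metis
  \<comment> \<open>A is merely a Borel set; a countable subcover is what countable additivity can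
    use.\<close>
  obtain F where F: "F \<subseteq> (\<lambda>w. ball w (h w)) ` A" "countable F" "\<Union>F = \<Union>((\<lambda>w. ball w (h w)) ` A)"
    by (rule Lindelof[of "(\<lambda>w. ball w (h w)) ` A"]) auto
  \<comment> \<open>The inserted empty set keeps the family nonempty, so that the natural numbers
    enumerate it.\<close>
  define U where "U = from_nat_into (insert {} F)"
  have rU: "range U = insert {} F" unfolding U_def using F(2) by (intro range_from_nat_into) auto
  have Ui: "U i = {} \<or> (\<exists>w\<in>A. U i = ball w (h w))" for i
    using rU F(1) by (metis image_iff insert_iff rangeI subsetD)
  show ?thesis
  proof (rule EB_null_UN[of U])
    show "U i \<in> sets borel" for i using Ui[of i] by auto
    show "EB (U i) (B x) = 0" for i using Ui[of i] h(2) by (auto simp: EB_empty)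
    have "A \<subseteq> \<Union>F" using F(3) h(1) by force
    then show "A \<subseteq> (\<Union>i. U i)" using rU by auto
  qed (rule A)
qed

section \<open>Resolvents of S on spectral subspaces\<close>

lemma form_lower_bound:
  assumes x: "P x = x" and c: "c * q x \<le> Re (b y x)" "c > 0"
  shows "c * dl / bK * norm x \<le> norm y"
proof (cases "x = 0")
  case False
  have "c * (dl * (norm x)\<^sup>2) \<le> c * q x" using c dl(2)[OF x] by (intro mult_left_mono) auto
  also have "\<dots> \<le> bK * norm y * norm x" using c(1) Re_b_le[of y x] by linarith
  finally have "norm x * (c * dl * norm x) \<le> norm x * (bK * norm y)"
    by (simp add: power2_eq_square mult_ac)
  then have "c * dl * norm x \<le> bK * norm y" using False by simp
  then show ?thesis using bK(1) by (simp add: field_simps)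
qed simp

text \<open>The gap splits A into a part above z, where the form of S - z is uniformly positive, and
  a part below z, where it is uniformly negative. The bounds on the two parts combine through the
  norms of their projections.\<close>

lemma EB_lower_bound:
  assumes A: "A \<in> sets borel" and eta: "\<eta> > 0" "A \<inter> {z - \<eta><..<z + \<eta>} = {}"
  shows "\<exists>k>0. \<forall>x. EB A x = x \<longrightarrow> k * norm x \<le> norm (S x - z *\<^sub>R x)"
proof -
  \<comment> \<open>The endpoint z + \<eta> may belong to A, so half the gap is given up to place A1
    inside an open half line.\<close>
  define c where "c = \<eta> / 2"
  have c: "c > 0" using eta by (simp add: c_def)
  define A1 where "A1 = A \<inter> {z + c<..}"
  define A2 where "A2 = A \<inter> {..z - c}"
  have A12: "A1 \<in> sets borel" "A2 \<in> sets borel" using A by (auto simp: A1_def A2_def)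
  have "x \<in> A1 \<union> A2" if "x \<in> A" for x
  proof -
    have "x \<notin> {z - \<eta><..<z + \<eta>}" using that eta(2) by blast
    then show ?thesis using that eta(1) by (auto simp: A1_def A2_def c_def)
  qed
  then have un: "A = A1 \<union> A2" by (auto simp: A1_def A2_def)
  have dis: "A1 \<inter> A2 = {}" using c by (auto simp: A1_def A2_def)
  have sub: "A1 \<subseteq> {z + c<..}" "A2 \<subseteq> {..z - c}" by (auto simp: A1_def A2_def)
  obtain K1 where K1: "K1 > 0" "\<And>x. norm (EB A1 x) \<le> K1 * norm x"
    using cblinear_bound[OF saD(1)[OF EB_sa[OF A12(1)]]] by blast
  obtain K2 where K2: "K2 > 0" "\<And>x. norm (EB A2 x) \<le> K2 * norm x"
    using cblinear_bound[OF saD(1)[OF EB_sa[OF A12(2)]]] by blast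
  define e where "e = c * dl / bK"
  have e: "e > 0" using c dl bK by (simp add: e_def)
  have comm: "S (EB A' x) - z *\<^sub>R EB A' x = EB A' (S x - z *\<^sub>R x)" if "A' \<in> sets borel" for A' x
    using commP_EB[OF that] by (simp add: commP_def cblinear_simps[OF saD(1)[OF EB_sa[OF that]]])
  have main: "e / (K1 + K2) * norm x \<le> norm (S x - z *\<^sub>R x)" if x: "EB A x = x" for x
  proof -
    define x1 x2 where "x1 = EB A1 x" and "x2 = EB A2 x"
    have i1: "EB A1 x1 = x1" "P x1 = x1" "EB A2 x2 = x2" "P x2 = x2"
      by (simp_all add: x1_def x2_def EB_idem A12 saD(3)[OF EB_sa])
    have "x = x1 + x2" using EB_add[OF A12 dis, of x] x by (simp add: un[symmetric] x1_def x2_def)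
    then have "norm x \<le> norm x1 + norm x2" by (simp add: norm_triangle_ineq)
    moreover have "e * norm x1 \<le> norm (S x1 - z *\<^sub>R x1)" unfolding e_def
    proof (rule form_lower_bound[OF i1(2) _ c])
      show "c * q x1 \<le> Re (b (S x1 - z *\<^sub>R x1) x1)"
        using EB_lower[OF A12(1) sub(1) i1(1)] by (simp add: b_diff_left b_scaleR_left q_def algebra_simps)
    qed
    moreover have "e * norm x2 \<le> norm (z *\<^sub>R x2 - S x2)" unfolding e_def
    proof (rule form_lower_bound[OF i1(4) _ c])
      show "c * q x2 \<le> Re (b (z *\<^sub>R x2 - S x2) x2)"
        using EB_upper[OF A12(2) sub(2) i1(3)] by (simp add: b_diff_left b_scaleR_left q_def algebra_simps)
    qed
    moreover have "norm (S x1 - z *\<^sub>R x1) \<le> K1 * norm (S x - z *\<^sub>R x)"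
      unfolding x1_def comm[OF A12(1)] by (rule K1)
    moreover have "norm (z *\<^sub>R x2 - S x2) \<le> K2 * norm (S x - z *\<^sub>R x)"
      unfolding x2_def by (subst norm_minus_commute) (simp only: comm[OF A12(2)] K2)
    ultimately have "e * norm x1 + e * norm x2 \<le> (K1 + K2) * norm (S x - z *\<^sub>R x)"
      by (simp add: distrib_right)
    moreover have "e * norm x \<le> e * norm x1 + e * norm x2"
      using \<open>norm x \<le> norm x1 + norm x2\<close> e by (simp add: distrib_left[symmetric])
    ultimately have "e * norm x \<le> (K1 + K2) * norm (S x - z *\<^sub>R x)" by linarith
    then show ?thesis using K1(1) K2(1) by (simp add: field_simps)
  qed
  have "e / (K1 + K2) > 0" using e K1(1) K2(1) by simp
  then show ?thesis using main by blast
qed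

lemma nonreal_lower_bound:
  assumes "Im z \<noteq> 0" and x: "P x = x"
  shows "\<bar>Im z\<bar> * dl / bK * norm x \<le> norm (S x - cscale z x)"
proof -
  \<comment> \<open>Multiplication by s turns the contribution of z into the real number
    \<open>\<bar>Im z\<bar> * q x\<close>, while the real value \<open>b (S x) x\<close> becomes
    imaginary.\<close>
  define s where "s = (if Im z > 0 then \<i> else - \<i>)"
  define y where "y = cscale s (S x - cscale z x)"
  have "b (S x) x = cnj (b (S x) x)" using saD(2)[OF S, of x x] b_commute[of "S x" x] by simp
  then have im: "Im (b (S x) x) = 0" by (simp add: complex_eq_iff)
  have "\<bar>Im z\<bar> * q x \<le> Re (b y x)"
    using assms(1) im by (auto simp: y_def s_def b_cscale_left b_diff_left b_self)
  then have "\<bar>Im z\<bar> * dl / bK * norm x \<le> norm y" using assms by (intro form_lower_bound) auto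
  then show ?thesis by (simp add: y_def s_def norm_cscale split: if_splits)
qed

text \<open>The lower bound for S - z makes its image W closed. A vector in \<open>range Q\<close>
  that is form-orthogonal to W is annihilated by S - cnj z, so the second lower bound shows that W
  is all of \<open>range Q\<close>.\<close>

lemma resolvent_range:
  assumes Q: "sa Q" "\<And>x. Q (Q x) = Q x" "\<And>x. S (Q x) = Q (S x)" and k: "k > 0"
    and lb: "\<And>x. Q x = x \<Longrightarrow> k * norm x \<le> norm (S x - cscale z x)"
      "\<And>x. Q x = x \<Longrightarrow> k * norm x \<le> norm (S x - cscale (cnj z) x)"
  shows "z \<in> resolvent_in (range Q) (range Q) S"
proof -
  define f where "f x = S x - cscale z x" for x
  have lin: "cblinear f" unfolding f_def
    by (rule cblinear_sub[OF saD(1)[OF S] cblinear_scale[OF cblinear_id]])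
  note rQ = projection_range_iff[of Q, OF Q(2)]
  note Qlin = cblinear_simps[OF saD(1)[OF Q(1)]]
  have Qf: "Q (f x) = f (Q x)" for x by (simp add: f_def Qlin Q(3))
  have inj: "inj_on f (range Q)"
  proof (rule inj_onI)
    fix x y assume xy: "x \<in> range Q" "y \<in> range Q" "f x = f y"
    have "Q (x - y) = x - y" using xy rQ by (simp add: Qlin)
    then have "k * norm (x - y) \<le> norm (f (x - y))" unfolding f_def by (rule lb)
    then show "x = y" using xy k by (simp add: cblinear_simps[OF lin] mult_le_0_iff)
  qed
  have sub: "f ` range Q \<subseteq> range Q" using Qf Q(2) rQ by (metis image_subsetI rangeI)
  have rQP: "range Q \<subseteq> range P" by (rule sa_range[OF Q(1)])
  define W where "W = f ` range Q"
  have cW: "closed W" unfolding W_def complete_eq_closed[symmetric]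
  proof (rule complete_isometric_image[OF k _ cblinear_bl[OF lin]])
    show "subspace (range Q)" by (intro csubspace_imp_subspace csubspace_range saD(1)[OF Q(1)])
    show "\<forall>x\<in>range Q. k * norm x \<le> norm (f x)" using lb(1) rQ by (auto simp: f_def)
    show "complete (range Q)" unfolding complete_eq_closed
      by (rule closed_range_projection[OF saD(1)[OF Q(1)] Q(2)])
  qed
  have sW: "csubspace W" unfolding W_def
    by (rule csubspace_image[OF csubspace_range[OF saD(1)[OF Q(1)]]]) (simp_all add: cblinear_simps[OF lin])
  have "W \<subseteq> range P" using sub rQP by (auto simp: W_def)
  then have "uniformly_positive G W" by (rule uniformly_positive_subset[OF P_pos])
  then obtain E where E: "cblinear E" "\<And>x. E (E x) = E x" "Gsym E" "range E = W"
    using form_projection[OF cW sW] by blast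
  have sur: "y \<in> f ` range Q" if y: "y \<in> range Q" for y
  proof -
    define v where "v = y - E y"
    have "E y \<in> W" using E(4) by blast
    then have "E y \<in> range Q" using sub by (auto simp: W_def)
    then have Qv: "Q v = v" using y rQ by (simp add: v_def Qlin)
    have Ev: "E v = 0" by (simp add: v_def cblinear_simps[OF E(1)] E(2))
    \<comment> \<open>Testing the orthogonality of v to W with the element f t gives
      \<open>b v (f t) = b t t\<close>, hence t = 0.\<close>
    define t where "t = S v - cscale (cnj z) v"
    have Qt: "Q t = t" using Qv Q(3)[of v] by (simp add: t_def Qlin)
    have "f t \<in> W" using rQ Qt by (auto simp: W_def)
    then have "E (f t) = f t" using E(4) projection_range_iff[of E "f t", OF E(2)] by blast
    then have "b v (f t) = b (E v) (f t)" using E(3)[unfolded Gsym_def, rule_format, of v "f t"] by simp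
    then have "b v (f t) = 0" by (simp add: Ev)
    moreover have "b v (f t) = b t t"
      by (simp add: f_def b_diff_right b_cscale_right saD(2)[OF S, symmetric]) (simp add: t_def b_diff_left b_cscale_left)
    ultimately have "q t = 0" by (simp add: q_def)
    moreover have "P t = t" using saD(3)[OF Q(1), of t] Qt by simp
    ultimately have "t = 0" using q_eq_0 by simp
    then have "k * norm v \<le> 0" using lb(2)[OF Qv] by (simp add: t_def)
    then have "v = 0" using k by (simp add: mult_le_0_iff)
    then show ?thesis using E(4) by (metis W_def eq_iff_diff_eq_0 rangeI v_def)
  qed
  have bd: "norm x \<le> (1 / k) * norm (f x)" if "x \<in> range Q" for x
    using lb(1)[of x] that rQ[of x] k by (simp add: f_def field_simps)
  have fe: "(\<lambda>x. S x - cscale z x) = f" by (simp add: f_def fun_eq_iff)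
  have im: "f ` range Q = range Q" using sub sur by blast
  have "\<exists>C. \<forall>x\<in>range Q. norm x \<le> C * norm (S x - cscale z x)"
    by (intro exI[of _ "1 / k"] ballI) (rule bd[unfolded f_def])
  then show ?thesis using inj im unfolding resolvent_in_def mem_Collect_eq fe by (intro conjI)
qed

lemma EB_resolvent:
  assumes A: "A \<in> sets borel"
    and z: "Im z \<noteq> 0 \<or> (\<exists>\<eta>>0. A \<inter> {Re z - \<eta><..<Re z + \<eta>} = {})"
  shows "z \<in> resolvent_in (range (EB A)) (range (EB A)) S"
proof -
  note Q = EB_sa[OF A] EB_idem[OF A]
  have SQ: "S (EB A x) = EB A (S x)" for x using commP_EB[OF A] by (simp add: commP_def)
  show ?thesis
  proof (cases "Im z = 0")
    case False
    have Px: "P x = x" if "EB A x = x" for x using saD(3)[OF EB_sa[OF A], of x] that by simp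
    show ?thesis
    proof (rule resolvent_range[OF Q SQ, of "\<bar>Im z\<bar> * dl / bK"])
      show "\<bar>Im z\<bar> * dl / bK > 0" using False dl bK by simp
      show "\<bar>Im z\<bar> * dl / bK * norm x \<le> norm (S x - cscale z x)" if "EB A x = x" for x
        using nonreal_lower_bound[OF False Px[OF that]] .
      show "\<bar>Im z\<bar> * dl / bK * norm x \<le> norm (S x - cscale (cnj z) x)" if "EB A x = x" for x
        using nonreal_lower_bound[of "cnj z", OF _ Px[OF that]] False by simp
    qed
  next
    case True
    then obtain \<eta> where "\<eta> > 0" "A \<inter> {Re z - \<eta><..<Re z + \<eta>} = {}" using z by blast
    from EB_lower_bound[OF A this] obtain k where k: "k > 0"
      "\<And>x. EB A x = x \<Longrightarrow> k * norm x \<le> norm (S x - Re z *\<^sub>R x)" by blast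
    have z1: "cscale z x = Re z *\<^sub>R x" "cscale (cnj z) x = Re z *\<^sub>R x" for x :: 'a
    proof -
      have "z = complex_of_real (Re z)" "cnj z = complex_of_real (Re z)" using True by (simp_all add: complex_eq_iff)
      then show "cscale z x = Re z *\<^sub>R x" "cscale (cnj z) x = Re z *\<^sub>R x" by (metis cscale_of_real)+
    qed
    show ?thesis by (rule resolvent_range[OF Q SQ k(1)]) (simp_all only: z1 k(2))
  qed
qed

end

text \<open>P is the smaller projection and S the part of S' in its range. Half line projections are
  pinned down by the sign of the shifted form on range and complement, so those of S are
  restrictions of those of S'. Equal distribution functions carry this over to all Borel
  sets.\<close>

lemma spectral_restriction:
  assumes A: "bounded_sa G P S" and B: "bounded_sa G P' S'"
    and PP': "\<And>x. P (P' x) = P x" "\<And>x. P' (P x) = P x"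
    and SP: "\<And>x. S' (P x) = S x" "\<And>x. P (S' x) = S x"
    and D: "\<Delta> \<in> sets borel"
  shows "bounded_sa.EB G P S \<Delta> x = bounded_sa.EB G P' S' \<Delta> (P x)"
proof -
  interpret A: bounded_sa G P S by (rule A)
  interpret B: bounded_sa G P' S' by (rule B)
  have EP': "A.Et t (P' x) = A.Et t x" "P' (A.Et t x) = A.Et t x" for t x
    by (metis A.Et_P PP')+
  have ES': "A.Et t (S' x) = S' (A.Et t x)" for t x
  proof -
    have "A.Et t (S' x) = A.Et t (P (S' x))" by (simp only: A.Et_P)
    also have "\<dots> = S (A.Et t x)" by (simp only: SP A.Et_S)
    also have "\<dots> = S' (P (A.Et t x))" by (simp only: SP)
    finally show ?thesis by (simp only: A.Et_P)
  qed
  have comm: "A.Et t (B.Et t x) = B.Et t (A.Et t x)" for t x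
    by (rule B.Et_comm[OF A.saD(1)[OF A.Et_sa]]) (simp_all add: ES' EP')
  have PcommB: "B.commP P"
    unfolding B.commP_def using A.P_lin by (simp add: SP PP')
  have PE: "P (B.Et t x) = B.Et t (P x)" for t x
    by (rule B.Et_comm[OF A.P_lin]) (simp_all add: SP PP')
  have Et_eq: "A.Et t x = B.Et t (P x)" for t x
  proof -
    \<comment> \<open>The part of \<open>A.Et t x\<close> missed by \<open>B.Et t\<close> lies at
      most at t for S and strictly above t for S', so it vanishes; x2 treats the converse
      inclusion.\<close>
    define x1 where "x1 = A.Et t x - A.Et t (B.Et t x)"
    have x1: "A.Et t x1 = x1" by (simp add: x1_def A.Et_lin A.Et_idem)
    have "x1 = 0"
    proof (rule B.Et_gt(2))
      show "P' x1 = x1" using EP'(2)[of t x1] x1 by simp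
      show "B.Et t x1 = 0" unfolding x1_def by (simp only: B.Et_lin comm B.Et_idem) simp
      have "S' x1 = S x1" using SP(1)[of x1] A.Et_P(1)[of t x1] x1 by simp
      then show "Re (A.b (S' x1) x1) \<le> t * A.q x1" using A.Et_le[OF x1] by simp
    qed
    define x2 where "x2 = B.Et t (P x) - B.Et t (A.Et t x)"
    have x2: "B.Et t x2 = x2" by (simp add: x2_def B.Et_lin B.Et_idem)
    have Px2: "P x2 = x2" by (simp add: x2_def cblinear_simps[OF A.P_lin] PE A.PP A.Et_P)
    have "x2 = 0"
    proof (rule A.Et_gt(2))
      show "P x2 = x2" by (rule Px2)
      show "A.Et t x2 = 0" by (simp add: x2_def A.Et_lin comm A.Et_P A.Et_idem)
      have "S' x2 = S x2" using SP(1)[of x2] Px2 by simp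
      then show "Re (A.b (S x2) x2) \<le> t * A.q x2" using B.Et_le[OF x2] by simp
    qed
    then show ?thesis using \<open>x1 = 0\<close> by (simp add: x1_def x2_def comm)
  qed
  have PEB: "P (B.EB \<Delta> y) = B.EB \<Delta> (P y)" for y by (rule B.EB_comm[OF D PcommB])
  have mu_eq: "B.mu (P y) = A.mu y" for y
  proof -
    have "B.Fd (P y) t = A.Fd y t" for t
    proof -
      have "A.b (A.Et t y) (P y) = A.b (P (A.Et t y)) y" by (simp only: A.P_b)
      then show ?thesis unfolding B.Fd_def A.Fd_def by (simp add: Et_eq[symmetric] A.Et_P)
    qed
    then have "B.Fd (P y) = A.Fd y" by blast
    then show ?thesis by (simp add: B.mu_def A.mu_def)
  qed
  note Bsa = B.EB_sa[OF D]
  show ?thesis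
  proof (rule A.sa_eqI[OF A.EB_sa[OF D]])
    show "A.sa (\<lambda>x. B.EB \<Delta> (P x))" unfolding A.sa_def A.Gsym_def
    proof (intro conjI allI)
      show "cblinear (\<lambda>x. B.EB \<Delta> (P x))" by (rule cblinear_compose[OF B.saD(1)[OF Bsa] A.P_lin])
      show "A.b (B.EB \<Delta> (P x)) y = A.b x (B.EB \<Delta> (P y))" for x y
        by (simp only: B.saD(2)[OF Bsa] A.P_b PEB)
      show "P (B.EB \<Delta> (P x)) = B.EB \<Delta> (P x)" for x by (simp only: PEB A.PP)
      show "B.EB \<Delta> (P (P x)) = B.EB \<Delta> (P x)" for x by (simp only: A.PP)
    qed
    fix y
    have "A.b (B.EB \<Delta> (P y)) (P y) = A.b (P (B.EB \<Delta> (P y))) y" by (simp only: A.P_b)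
    then have "A.b (B.EB \<Delta> (P y)) y = A.b (B.EB \<Delta> (P y)) (P y)" by (simp only: PEB A.PP)
    then show "Re (A.b (A.EB \<Delta> y) y) = Re (A.b (B.EB \<Delta> (P y)) y)"
      using A.EB_mu[OF D, of y] B.EB_mu[OF D, of "P y"] by (simp add: mu_eq)
  qed
qed

section \<open>Symmetric operators near points of positive type\<close>

locale gsymmetric = hermitian_form +
  fixes D :: "'a set" and T :: "'a \<Rightarrow> 'a"
  assumes sym: "G_symmetric G D T"
begin

lemma cdd: "closed_densely_defined D T"
  using sym by (simp add: G_symmetric_def)

sublocale subspace_operator UNIV D T
  using cdd by unfold_locales (auto simp: closed_densely_defined_def csubspace_UNIV)

lemma op_resolvent_rho: "op_resolvent D T = rho"
  by (simp add: op_resolvent_def)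

lemma T_sym: "x \<in> D \<Longrightarrow> y \<in> D \<Longrightarrow> b (T x) y = b x (T y)"
  using sym by (simp add: G_symmetric_def b_def)

lemma T_closed:
  assumes s: "\<And>n. s n \<in> D" "s \<longlonglongrightarrow> x" "(\<lambda>n. T (s n)) \<longlonglongrightarrow> y"
  shows "x \<in> D" "T x = y"
proof -
  have "closed {(x, T x) | x. x \<in> D}" using cdd by (simp add: closed_densely_defined_def)
  moreover have "(s n, T (s n)) \<in> {(x, T x) | x. x \<in> D}" for n using s(1) by blast
  moreover have "(\<lambda>n. (s n, T (s n))) \<longlonglongrightarrow> (x, y)" by (rule tendsto_Pair[OF s(2,3)])
  ultimately have "(x, y) \<in> {(x, T x) | x. x \<in> D}" by (rule closed_sequentially)
  then show "x \<in> D" "T x = y" by auto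
qed

section \<open>Operators commuting with T, and points of positive type\<close>

definition commT :: "('a \<Rightarrow> 'a) \<Rightarrow> bool" where
  "commT B \<longleftrightarrow> cblinear B \<and> (\<forall>x\<in>D. B x \<in> D \<and> B (T x) = T (B x))"

lemma res_comm:
  assumes B: "commT B" and l: "l \<in> rho"
  shows "B (res l x) = res l (B x)"
proof (rule res_eqI[OF l, symmetric])
  have Bl: "cblinear B" using B by (simp add: commT_def)
  have r: "res l x \<in> D" by (simp add: res_in l)
  then show "B (res l x) \<in> D" using B by (simp add: commT_def)
  have "T (B (res l x)) - cscale l (B (res l x)) = B (T (res l x) - cscale l (res l x))"
    using B r by (simp add: commT_def cblinear_simps[OF Bl])
  then show "T (B (res l x)) - cscale l (B (res l x)) = B x" by (simp add: res_right l)
qed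

lemma res_cblinear: "l \<in> rho \<Longrightarrow> cblinear (res l)"
  using res_bound[of l] by (auto intro!: cblinearI res_add res_cscale)

lemma commT_res: assumes l: "l \<in> rho" shows "commT (res l)"
  unfolding commT_def
proof (intro conjI ballI)
  show "cblinear (res l)" by (rule res_cblinear[OF l])
  fix x assume x: "x \<in> D"
  show "res l x \<in> D" by (simp add: res_in l)
  have "T (res l x) = x + cscale l (res l x)" using res_right[OF l, of x] by (simp add: algebra_simps)
  moreover have "res l (T x) = x + cscale l (res l x)"
    using res_left[OF l x] by (simp add: cblinear_simps[OF res_cblinear[OF l]] algebra_simps)
  ultimately show "res l (T x) = T (res l x)" by simp
qed

text \<open>D is the range of \<open>res l\<close>, so x = res l ((T - l) x) carries commutation
  with a single resolvent over to T.\<close>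

lemma commT_if_res_comm:
  assumes B: "cblinear B" and l: "l \<in> rho" and c: "\<And>x. B (res l x) = res l (B x)"
  shows "commT B"
  unfolding commT_def
proof (intro conjI ballI B)
  fix x assume x: "x \<in> D"
  have "B x = res l (B (T x - cscale l x))" using c[of "T x - cscale l x"] res_left[OF l x] by simp
  then have Bx: "B x = res l (B (T x) - cscale l (B x))" by (simp add: cblinear_simps[OF B])
  then show "B x \<in> D" using res_in[OF l, of "B (T x) - cscale l (B x)"] by simp
  have "T (B x) - cscale l (B x) = B (T x) - cscale l (B x)"
    using res_right[OF l, of "B (T x) - cscale l (B x)"] Bx by simp
  then show "B (T x) = T (B x)" by simp
qed

lemma res_sym:
  assumes l: "l \<in> rho" "cnj l \<in> rho"
  shows "b (res l x) y = b x (res (cnj l) y)"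
proof -
  define u v where "u = res l x" and "v = res (cnj l) y"
  have uv: "u \<in> D" "v \<in> D" using l by (simp_all add: u_def v_def res_in)
  have "b u y = b u (T v - cscale (cnj l) v)" using res_right[OF l(2), of y] by (simp add: v_def)
  also have "\<dots> = b (T u - cscale l u) v"
    using T_sym[OF uv] by (simp add: b_diff_left b_diff_right b_cscale_left b_cscale_right)
  also have "\<dots> = b x v" using res_right[OF l(1), of x] by (simp add: u_def)
  finally show ?thesis by (simp add: u_def v_def)
qed

text \<open>Turns the condition on sequences into a uniform inequality. Failure for all constants 1
  / (n + 1) yields unit vectors that place c in the approximate point spectrum and, at the same
  time, violate the liminf condition there.\<close>

lemma positive_type_point:
  assumes pt: "positive_type_set G D T J" and c: "complex_of_real c \<in> J"
  shows "\<exists>e>0. \<exists>d>0. \<forall>x\<in>D. norm (T x - c *\<^sub>R x) \<le> e * norm x \<longrightarrow> d * (norm x)\<^sup>2 \<le> q x"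
proof (rule ccontr)
  assume neg: "\<not> ?thesis"
  define f where "f n = 1 / real (Suc n)" for n
  have f: "f n > 0" for n by (simp add: f_def)
  have flim: "f \<longlonglongrightarrow> 0" unfolding f_def[abs_def] inverse_eq_divide[symmetric]
    by (rule LIMSEQ_inverse_real_of_nat)
  have "\<exists>x\<in>D. norm (T x - c *\<^sub>R x) \<le> f n * norm x \<and> q x < f n * (norm x)\<^sup>2" for n
    using neg f[of n] by (meson not_le)
  then obtain x where x: "\<And>n. x n \<in> D" "\<And>n. norm (T (x n) - c *\<^sub>R x n) \<le> f n * norm (x n)"
    "\<And>n. q (x n) < f n * (norm (x n))\<^sup>2" by metis
  have x0: "norm (x n) > 0" for n
  proof (rule ccontr)
    assume "\<not> norm (x n) > 0"
    then have "x n = 0" by simp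
    then show False using x(3)[of n] by (simp add: q_def)
  qed
  define u where "u n = (1 / norm (x n)) *\<^sub>R x n" for n
  have uD: "u n \<in> D" for n unfolding u_def by (intro csubspace_scaleR sD x)
  have un: "norm (u n) = 1" for n using x0[of n] by (simp add: u_def)
  have Tu: "T (u n) - cscale (complex_of_real c) (u n) = (1 / norm (x n)) *\<^sub>R (T (x n) - c *\<^sub>R x n)" for n
  proof -
    have "T (u n) = (1 / norm (x n)) *\<^sub>R T (x n)" unfolding u_def scaleR_cscale by (rule T_cscale[OF x(1)])
    then show ?thesis by (simp add: cscale_of_real u_def scaleR_right_diff_distrib)
  qed
  have lim: "(\<lambda>n. T (u n) - cscale (complex_of_real c) (u n)) \<longlonglongrightarrow> 0"
  proof (rule Lim_null_comparison[OF _ flim])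
    have "norm (T (u n) - cscale (complex_of_real c) (u n)) \<le> f n" for n
      unfolding Tu norm_scaleR using x(2)[of n] x0[of n] by (simp add: pos_divide_le_eq)
    then show "\<forall>\<^sub>F n in sequentially. norm (T (u n) - cscale (complex_of_real c) (u n)) \<le> f n" by simp
  qed
  have "complex_of_real c \<in> approx_point_spectrum D T"
    unfolding approx_point_spectrum_def using uD un lim by blast
  then have "complex_of_real c \<in> sigma_pp G D T" using pt c unfolding positive_type_set_def by blast
  then have "liminf (\<lambda>n. ereal (Re (cinner (G (u n)) (u n)))) > 0"
    unfolding sigma_pp_def using uD un lim by blast
  moreover have "liminf (\<lambda>n. ereal (Re (cinner (G (u n)) (u n)))) \<le> liminf (\<lambda>n. ereal (f n))"
  proof (rule Liminf_mono, rule always_eventually, rule allI)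
    fix n
    have "q (u n) = q (x n) / (norm (x n))\<^sup>2" unfolding u_def q_scaleR by (simp add: power_divide)
    also have "\<dots> \<le> f n" using x(3)[of n] x0[of n] by (simp add: field_simps)
    finally show "ereal (Re (cinner (G (u n)) (u n))) \<le> ereal (f n)" by (simp add: q_def b_def)
  qed
  moreover have "liminf (\<lambda>n. ereal (f n)) = 0"
    by (rule lim_imp_Liminf) (simp_all add: flim zero_ereal_def)
  ultimately show False by simp
qed

text \<open>If x is nearly an eigenvector for c, it is positive and the imaginary part of
  \<open>b (T x - cscale l x) x\<close> gives the bound with d / \<open>bK\<close>. Otherwise T - c
  is bounded below by e at x, and a shift by less than e / 2 leaves e / 2 \<ge>
  \<open>\<bar>Im l\<bar>\<close>.\<close>

lemma lower_bound_near_positive_point: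
  assumes e: "e > 0" and d: "d > 0"
    and p: "\<And>x. x \<in> D \<Longrightarrow> norm (T x - c *\<^sub>R x) \<le> e * norm x \<Longrightarrow> d * (norm x)\<^sup>2 \<le> q x"
    and l: "cmod (l - complex_of_real c) < e / 2" and x: "x \<in> D"
  shows "min 1 (d / bK) * \<bar>Im l\<bar> * norm x \<le> norm (T x - cscale l x)"
proof (cases "norm (T x - c *\<^sub>R x) \<le> e * norm x")
  case True
  show ?thesis
  proof (cases "x = 0")
    case False
    have "b (T x) x = cnj (b (T x) x)" using T_sym[OF x x] b_commute[of "T x" x] by simp
    then have im: "Im (b (T x) x) = 0" by (simp add: complex_eq_iff)
    have "\<bar>Im l\<bar> * (d * (norm x)\<^sup>2) \<le> \<bar>Im l\<bar> * q x" by (intro mult_left_mono p x True) simp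
    also have "\<dots> = \<bar>Im (b (T x - cscale l x) x)\<bar>"
    proof -
      have "0 \<le> q x" using p[OF x True] d by (meson less_imp_le mult_nonneg_nonneg order_trans zero_le_power2)
      then show ?thesis using im by (simp add: b_diff_left b_cscale_left b_self abs_mult)
    qed
    also have "\<dots> \<le> cmod (b (T x - cscale l x) x)" by (rule abs_Im_le_cmod)
    also have "\<dots> \<le> bK * norm (T x - cscale l x) * norm x" by (rule bK)
    finally have "norm x * (\<bar>Im l\<bar> * d * norm x) \<le> norm x * (bK * norm (T x - cscale l x))"
      by (simp add: power2_eq_square mult_ac)
    then have "\<bar>Im l\<bar> * d * norm x \<le> bK * norm (T x - cscale l x)" using False by simp
    then have "d / bK * (\<bar>Im l\<bar> * norm x) \<le> norm (T x - cscale l x)" using bK(1) by (simp add: field_simps)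
    moreover have "min 1 (d / bK) * (\<bar>Im l\<bar> * norm x) \<le> d / bK * (\<bar>Im l\<bar> * norm x)"
      by (intro mult_right_mono) auto
    ultimately show ?thesis by (simp add: mult.assoc)
  qed (simp add: T_0)
next
  case False
  have "T x - c *\<^sub>R x = (T x - cscale l x) + cscale (l - complex_of_real c) x"
    by (simp add: cscale_diff_left cscale_of_real)
  then have "norm (T x - c *\<^sub>R x) \<le> norm (T x - cscale l x) + cmod (l - complex_of_real c) * norm x"
    by (metis norm_cscale norm_triangle_ineq)
  moreover have "cmod (l - complex_of_real c) * norm x \<le> e / 2 * norm x" using l by (intro mult_right_mono) auto
  ultimately have 1: "e / 2 * norm x \<le> norm (T x - cscale l x)" using False by (simp add: field_simps)
  have "\<bar>Im l\<bar> \<le> e / 2" using abs_Im_le_cmod[of "l - complex_of_real c"] l by simp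
  then have "min 1 (d / bK) * \<bar>Im l\<bar> * norm x \<le> 1 * (e / 2) * norm x"
    using e by (intro mult_right_mono mult_mono) auto
  then show ?thesis using 1 by simp
qed

text \<open>Suppose m lies in \<open>rho\<close> within half the lower bound of l. Then T - m
  inherits the bound k / 2, and perturbation from m reaches l. So H - \<open>rho\<close> is
  relatively open in H, as is the intersection of H with \<open>rho\<close>.\<close>

lemma connected_resolvent_dichotomy:
  assumes H: "connected H"
    and lb: "\<And>l. l \<in> H \<Longrightarrow> \<exists>k>0. \<forall>x\<in>D. k * norm x \<le> norm (T x - cscale l x)"
  shows "H \<subseteq> rho \<or> H \<inter> rho = {}"
proof -
  obtain k where k: "\<And>l. l \<in> H \<Longrightarrow> k l > 0" "\<And>l x. l \<in> H \<Longrightarrow> x \<in> D \<Longrightarrow> k l * norm x \<le> norm (T x - cscale l x)"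
    using lb by metis
  define V where "V = (\<Union>l\<in>H - rho. ball l (k l / 2))"
  have "m \<notin> rho" if l: "l \<in> H" "l \<notin> rho" and m: "m \<in> ball l (k l / 2)" for l m
  proof
    assume mr: "m \<in> rho"
    have d: "cmod (l - m) < k l / 2" using m by (simp add: dist_norm)
    have "l \<in> rho"
    proof (rule resolvent_perturbation[OF mr])
      fix x assume x: "x \<in> D"
      have "T x - cscale l x = (T x - cscale m x) - cscale (l - m) x" by (simp add: cscale_diff_left)
      then have "norm (T x - cscale l x) \<le> norm (T x - cscale m x) + cmod (l - m) * norm x"
        by (metis norm_cscale norm_triangle_ineq4)
      moreover have "cmod (l - m) * norm x \<le> k l / 2 * norm x" using d by (intro mult_right_mono) auto
      ultimately have "k l / 2 * norm x \<le> norm (T x - cscale m x)" using k(2)[OF l(1) x] by simp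
      then show "norm x \<le> (2 / k l) * norm (T x - cscale m x)" using k(1)[OF l(1)] by (simp add: field_simps)
    qed (use k(1)[OF l(1)] d in \<open>auto simp: field_simps\<close>)
    then show False using l by simp
  qed
  then have "V \<inter> rho = {}" unfolding V_def by blast
  moreover have "H \<subseteq> rho \<union> V" using k(1) by (force simp: V_def)
  moreover have "open V" by (auto simp: V_def)
  ultimately have "rho \<inter> H = {} \<or> V \<inter> H = {}"
    by (intro connectedD[OF H open_rho]) auto
  then show ?thesis using \<open>H \<subseteq> rho \<union> V\<close> by blast
qed

text \<open>With \<open>s = 1\<close> or \<open>s = -1\<close>, the resolvent set spreads from one half disc to all half discs
  on the same side.\<close>
lemma half_discs_in_resolvent_set:
  assumes J: "connected J" and r: "\<And>c. c \<in> J \<Longrightarrow> r c > (0::real)" and s: "\<bar>s\<bar> = (1::real)"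
    and lb: "\<And>c l. c \<in> J \<Longrightarrow> l \<in> ball (complex_of_real c) (r c) \<Longrightarrow> Im l \<noteq> 0
       \<Longrightarrow> \<exists>k>0. \<forall>x\<in>D. k * norm x \<le> norm (T x - cscale l x)"
    and acc: "t \<in> J" "complex_of_real t islimpt ({z. 0 < s * Im z} \<inter> rho)"
    and c: "c \<in> J" and l: "l \<in> ball (complex_of_real c) (r c)" "0 < s * Im l"
  shows "l \<in> rho"
proof -
  define H where "H c = ball (complex_of_real c) (r c) \<inter> {z. 0 < s * Im z}" for c
  have "convex {z. 0 < s * Im z}"
  proof -
    have "{z. 0 < s * Im z} = {z. 0 < Im z} \<or> {z. 0 < s * Im z} = {z. Im z < 0}"
      using s by (cases "s = 1") (auto simp: abs_if split: if_splits)
    then show ?thesis using convex_halfspace_Im_gt[of 0] convex_halfspace_Im_lt[of 0] by auto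
  qed
  then have conn: "connected (H c)" for c
    unfolding H_def by (intro convex_connected convex_Int convex_ball)
  have dich: "H c \<subseteq> rho \<or> H c \<inter> rho = {}" if "c \<in> J" for c
  proof (rule connected_resolvent_dichotomy[OF conn])
    fix l assume "l \<in> H c"
    then have "l \<in> ball (complex_of_real c) (r c)" "Im l \<noteq> 0" by (auto simp: H_def)
    then show "\<exists>k>0. \<forall>x\<in>D. k * norm x \<le> norm (T x - cscale l x)" by (rule lb[OF that])
  qed
  define K where "K = {c \<in> J. H c \<subseteq> rho}"
  define U where "U = (\<Union>c\<in>K. ball c (r c))"
  define V where "V = (\<Union>c\<in>J - K. ball c (r c))"
  have disj: False if c1: "c1 \<in> K" and c2: "c2 \<in> J" "c2 \<notin> K" and x: "x \<in> ball c1 (r c1)" "x \<in> ball c2 (r c2)" for c1 c2 x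
  proof -
    \<comment> \<open>Overlapping real intervals force the half discs to meet: the point x is moved
      off the axis by half the room left in the two discs.\<close>
    define \<tau> where "\<tau> = min (r c1 - \<bar>x - c1\<bar>) (r c2 - \<bar>x - c2\<bar>) / 2"
    have \<tau>: "\<tau> > 0" using x by (auto simp: \<tau>_def dist_real_def abs_minus_commute)
    define z where "z = Complex x (s * \<tau>)"
    have zc: "cmod (z - complex_of_real c') < r c'" if "\<tau> < r c' - \<bar>x - c'\<bar>" for c'
    proof -
      have "cmod (z - complex_of_real c') \<le> \<bar>x - c'\<bar> + \<bar>s * \<tau>\<bar>"
        using cmod_le[of "z - complex_of_real c'"] by (simp add: z_def)
      then show ?thesis using that \<tau> s by (simp add: abs_mult)
    qed
    have sim: "0 < s * Im z" using s \<tau> by (auto simp: z_def abs_if split: if_splits)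
    have "z \<in> H c1" "z \<in> H c2"
      using zc[of c1] zc[of c2] \<tau> sim by (auto simp: H_def \<tau>_def dist_norm norm_minus_commute min_def split: if_splits)
    then show False using dich[OF c2(1)] c1 c2 by (auto simp: K_def)
  qed
  have "U \<inter> J = {} \<or> V \<inter> J = {}"
  proof (rule connectedD[OF J])
    show "U \<inter> V \<inter> J = {}" using disj by (auto simp: U_def V_def)
    show "J \<subseteq> U \<union> V" using r by (force simp: U_def V_def)
  qed (auto simp: U_def V_def)
  moreover have "t \<in> U"
  proof -
    obtain z where z: "z \<in> {z. 0 < s * Im z} \<inter> rho" "dist z (complex_of_real t) < r t"
      using acc(2) r[OF acc(1)] unfolding islimpt_approachable by blast
    then have "z \<in> H t \<inter> rho" by (simp add: H_def dist_commute)
    then have "t \<in> K" using dich[OF acc(1)] acc(1) by (auto simp: K_def)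
    then show ?thesis unfolding U_def using r[OF acc(1)] centre_in_ball by blast
  qed
  ultimately have "V \<inter> J = {}" using acc(1) by blast
  then have "c \<in> K" using c r[OF c] by (force simp: V_def)
  then show ?thesis using l by (auto simp: K_def H_def)
qed

text \<open>The resolvent grows at most like 1 / (k \<open>\<bar>Im l\<bar>\<close>). The constant k
  remains valid for every smaller radius, which later allows circles to shrink at fixed k.\<close>

definition regular_point :: "real \<Rightarrow> real \<Rightarrow> real \<Rightarrow> bool" where
  "regular_point c r k \<longleftrightarrow> 0 < r \<and> 0 < k
     \<and> (\<forall>l\<in>ball (complex_of_real c) r. Im l \<noteq> 0 \<longrightarrow> l \<in> rho)
     \<and> (\<forall>l\<in>ball (complex_of_real c) r. \<forall>x\<in>D. k * \<bar>Im l\<bar> * norm x \<le> norm (T x - cscale l x))"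

lemma regular_points:
  assumes J: "connected J" and pt: "positive_type_set G D T (complex_of_real ` J)"
    and up: "\<exists>t\<in>J. complex_of_real t islimpt ({z. 0 < Im z} \<inter> rho)"
    and low: "\<exists>t\<in>J. complex_of_real t islimpt ({z. Im z < 0} \<inter> rho)"
    and c: "c \<in> J"
  shows "\<exists>r k e d. regular_point c r k \<and> 0 < e \<and> 0 < d
    \<and> (\<forall>x\<in>D. norm (T x - c *\<^sub>R x) \<le> e * norm x \<longrightarrow> d * (norm x)\<^sup>2 \<le> q x)"
proof -
  have "\<exists>e>0. \<exists>d>0. \<forall>x\<in>D. norm (T x - c *\<^sub>R x) \<le> e * norm x \<longrightarrow> d * (norm x)\<^sup>2 \<le> q x" if "c \<in> J" for c
    using that by (intro positive_type_point[OF pt]) simp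
  then obtain e d where ed: "\<And>c. c \<in> J \<Longrightarrow> e c > 0" "\<And>c. c \<in> J \<Longrightarrow> d c > 0"
    "\<And>c x. c \<in> J \<Longrightarrow> x \<in> D \<Longrightarrow> norm (T x - c *\<^sub>R x) \<le> e c * norm x \<Longrightarrow> d c * (norm x)\<^sup>2 \<le> q x"
    by metis
  define r where "r c = e c / 2" for c
  define k where "k c = min 1 (d c / bK)" for c
  have r: "r c > 0" "k c > 0" if "c \<in> J" for c using ed(1,2)[OF that] bK(1) by (auto simp: r_def k_def)
  have lb: "k c * \<bar>Im l\<bar> * norm x \<le> norm (T x - cscale l x)"
    if "c \<in> J" "l \<in> ball (complex_of_real c) (r c)" "x \<in> D" for c l x
    unfolding k_def
    by (rule lower_bound_near_positive_point[OF ed(1,2)[OF that(1)] ed(3)[OF that(1)] _ that(3)])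
       (use that(2) in \<open>simp_all add: r_def dist_norm norm_minus_commute\<close>)
  have lb': "\<exists>k>0. \<forall>x\<in>D. k * norm x \<le> norm (T x - cscale l x)"
    if "c \<in> J" "l \<in> ball (complex_of_real c) (r c)" "Im l \<noteq> 0" for c l
    using lb[OF that(1,2)] r(2)[OF that(1)] that(3) by (intro exI[of _ "k c * \<bar>Im l\<bar>"]) auto
  have "l \<in> rho" if l: "l \<in> ball (complex_of_real c) (r c)" "Im l \<noteq> 0" for l
  proof (cases "Im l > 0")
    case True
    obtain t where t: "t \<in> J" "complex_of_real t islimpt ({z. 0 < Im z} \<inter> rho)" using up by blast
    show ?thesis
      by (rule half_discs_in_resolvent_set[OF J r(1), where s = 1 and t = t and c = c]) (use lb' t c l True in auto)
  next
    case False
    obtain t where t: "t \<in> J" "complex_of_real t islimpt ({z. Im z < 0} \<inter> rho)" using low by blast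
    show ?thesis
      by (rule half_discs_in_resolvent_set[OF J r(1), where s = "- 1" and t = t and c = c]) (use lb' t c l False in auto)
  qed
  then have "regular_point c (r c) (k c)"
    unfolding regular_point_def using r[OF c] lb[OF c] by blast
  then show ?thesis using ed[OF c] by blast
qed

end

section \<open>Contour integrals of the resolvent\<close>

text \<open>The mean over the circle. On it dl = 2 \<pi> \<i> (l - c) dt, so an integrand carrying
  the factor (l - c) has as its mean the contour integral divided by 2 \<pi> \<i>.\<close>

definition cI :: "real \<Rightarrow> real \<Rightarrow> (complex \<Rightarrow> 'b::banach) \<Rightarrow> 'b" where
  "cI c r F = integral {0..1} (\<lambda>t. F (circlepath (complex_of_real c) r t))"

lemma circlepath_in_sphere: "r > 0 \<Longrightarrow> circlepath z r t \<in> sphere z r"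
  by (simp add: circlepath dist_norm norm_mult)

lemma cI_continuous:
  assumes "continuous_on (sphere (complex_of_real c) r) F" "r > 0"
  shows "continuous_on {0..1} (\<lambda>t. F (circlepath (complex_of_real c) r t))"
proof (rule continuous_on_compose2[OF assms(1)])
  show "continuous_on {0..1} (circlepath (complex_of_real c) r)"
    unfolding circlepath by (intro continuous_intros)
qed (use circlepath_in_sphere[OF assms(2)] in blast)

lemma cI_integrable:
  fixes F :: "complex \<Rightarrow> 'b::banach"
  assumes "continuous_on (sphere (complex_of_real c) r) F" "r > 0"
  shows "(\<lambda>t. F (circlepath (complex_of_real c) r t)) integrable_on {0..1}"
  by (rule integrable_continuous_interval[OF cI_continuous[OF assms]])

lemma cI_linear:
  assumes "continuous_on (sphere (complex_of_real c) r) F" "r > 0" "bounded_linear f"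
  shows "f (cI c r F) = cI c r (\<lambda>l. f (F l))"
  using integral_linear[OF cI_integrable[OF assms(1,2)] assms(3)] by (simp add: cI_def o_def)

lemma cI_add:
  assumes "continuous_on (sphere (complex_of_real c) r) F" "continuous_on (sphere (complex_of_real c) r) H" "r > 0"
  shows "cI c r (\<lambda>l. F l + H l) = cI c r F + cI c r H"
  unfolding cI_def by (rule integral_add) (intro cI_integrable assms)+

lemma cI_cong:
  assumes "r > 0" "\<And>l. l \<in> sphere (complex_of_real c) r \<Longrightarrow> F l = H l"
  shows "cI c r F = cI c r H"
  unfolding cI_def by (rule integral_cong) (simp only: assms(2)[OF circlepath_in_sphere[OF assms(1)]])

lemma cI_bound:
  assumes "continuous_on (sphere (complex_of_real c) r) F" "r > 0"
    "\<And>l. l \<in> sphere (complex_of_real c) r \<Longrightarrow> norm (F l) \<le> M"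
  shows "norm (cI c r F) \<le> M"
  using integral_bound[OF _ cI_continuous[OF assms(1,2)], of M] assms(3)[OF circlepath_in_sphere[OF assms(2)]]
  by (simp add: cI_def)

text \<open>The centre is real, so conjugation acts on the circle as t \<mapsto> 1 - t, and a mean
  over t does not see the orientation.\<close>

lemma cI_reflect:
  assumes "continuous_on (sphere (complex_of_real c) r) F" "r > 0"
  shows "cI c r (\<lambda>l. F (cnj l)) = cI c r F"
proof -
  have "((\<lambda>t. F (circlepath (complex_of_real c) r t)) has_integral cI c r F) (cbox 0 1)"
    using cI_integrable[OF assms] by (simp add: cI_def integrable_integral)
  from has_integral_affinity[OF this, of "- 1" 1]
  have "((\<lambda>t. F (circlepath (complex_of_real c) r (1 - t))) has_integral cI c r F) ((\<lambda>x. 1 - x) ` {0..1})"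
    by simp
  moreover have "(\<lambda>x. 1 - x) ` {0..1} = {0..1::real}" by (simp add: image_diff_atLeastAtMost)
  moreover have "circlepath (complex_of_real c) r (1 - t) = cnj (circlepath (complex_of_real c) r t)" for t
  proof -
    have "circlepath (complex_of_real c) r (1 - t) = circlepath (complex_of_real c) r (- t)"
      using circlepath_add1[of "complex_of_real c" r "- t"] by simp
    then show ?thesis by (simp add: circlepath exp_cnj)
  qed
  ultimately have "((\<lambda>t. F (cnj (circlepath (complex_of_real c) r t))) has_integral cI c r F) {0..1}" by simp
  then show ?thesis unfolding cI_def by (rule integral_unique)
qed

lemma cI_swap:
  assumes "continuous_on (sphere (complex_of_real c) r \<times> sphere (complex_of_real c) r') (\<lambda>(l, m). F l m)" "r > 0" "r' > 0"
  shows "cI c r (\<lambda>l. cI c r' (\<lambda>m. F l m)) = cI c r' (\<lambda>m. cI c r (\<lambda>l. F l m))"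
proof -
  define f where "f s t = F (circlepath (complex_of_real c) r s) (circlepath (complex_of_real c) r' t)" for s t
  have "continuous_on (cbox (0, 0) (1, 1)) (\<lambda>z. (\<lambda>(l, m). F l m) (circlepath (complex_of_real c) r (fst z), circlepath (complex_of_real c) r' (snd z)))"
  proof (rule continuous_on_compose2[OF assms(1)])
    show "continuous_on (cbox (0, 0) (1, 1)) (\<lambda>z. (circlepath (complex_of_real c) r (fst z), circlepath (complex_of_real c) r' (snd z)))"
      unfolding circlepath by (intro continuous_intros)
  qed (use circlepath_in_sphere[OF assms(2)] circlepath_in_sphere[OF assms(3)] in auto)
  then have "continuous_on (cbox (0, 0) (1, 1)) (\<lambda>(s, t). f s t)"
    by (simp add: f_def case_prod_beta)
  from integral_swap_continuous[OF this] show ?thesis by (simp add: cI_def f_def)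
qed

lemma cI_contour:
  assumes "(\<phi> has_contour_integral (2 * complex_of_real pi * \<i> * v)) (circlepath (complex_of_real c) r)"
  shows "cI c r (\<lambda>l. \<phi> l * (l - c)) = v"
proof -
  have "((\<lambda>t. \<phi> (circlepath (complex_of_real c) r t) * vector_derivative (circlepath (complex_of_real c) r) (at t))
      has_integral 2 * complex_of_real pi * \<i> * v) {0..1}"
    using assms by (simp add: has_contour_integral)
  then have "((\<lambda>t. (2 * complex_of_real pi * \<i>) * (\<phi> (circlepath (complex_of_real c) r t) * (circlepath (complex_of_real c) r t - c)))
      has_integral 2 * complex_of_real pi * \<i> * v) {0..1}"
    unfolding vector_derivative_circlepath by (simp add: circlepath mult_ac)
  note int = has_integral_mult_right[OF this, of "inverse (2 * complex_of_real pi * \<i>)"]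
  have cancel: "inverse a * (a * X) = X" if "a \<noteq> 0" for a X :: complex
    using that by (simp add: mult.assoc[symmetric])
  have "inverse (2 * complex_of_real pi * \<i>) * ((2 * complex_of_real pi * \<i>) * X) = X" for X
    by (rule cancel) simp
  with int show ?thesis unfolding cI_def by (intro integral_unique) (simp only:)
qed

lemma cI_Cauchy:
  assumes "p holomorphic_on UNIV" "cmod (z - complex_of_real c) < r"
  shows "cI c r (\<lambda>l. p l / (l - z) * (l - c)) = p z"
  by (rule cI_contour[OF Cauchy_integral_circlepath_simple[OF holomorphic_on_subset[OF assms(1) subset_UNIV] assms(2)]])

lemma cI_Cauchy_0:
  assumes "p holomorphic_on ball (complex_of_real c) R" "0 < r" "r < R"
  shows "cI c r (\<lambda>l. p l * (l - c)) = 0"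
proof (rule cI_contour)
  have "sphere (complex_of_real c) r \<subseteq> ball (complex_of_real c) R" using assms(3) by auto
  then show "(p has_contour_integral 2 * complex_of_real pi * \<i> * 0) (circlepath (complex_of_real c) r)"
    using Cauchy_theorem_disc_simple[OF assms(1), of "circlepath (complex_of_real c) r"] assms(2) by simp
qed

text \<open>A double zero at each crossing: one order offsets the growth 1 /
  \<open>\<bar>Im l\<bar>\<close> of the resolvent, the other makes the product tend to zero and
  hence continuous on the circle. Being a real polynomial, the weight also keeps the integrals
  symmetric.\<close>

definition cw :: "real \<Rightarrow> real \<Rightarrow> complex \<Rightarrow> complex" where
  "cw c r l = ((l - complex_of_real c)\<^sup>2 - (complex_of_real r)\<^sup>2)\<^sup>2"

lemma cw_holomorphic: "cw c r holomorphic_on S"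
  unfolding cw_def by (intro holomorphic_intros)

lemma cw_cnj: "cw c r (cnj l) = cnj (cw c r l)"
  by (simp add: cw_def)

text \<open>On the circle \<open>u = l - c\<close> satisfies \<open>u\<^sup>2 - r\<^sup>2 = u (u - cnj u) = 2 \<i> u Im u\<close>.\<close>
lemma norm_cw:
  assumes "l \<in> sphere (complex_of_real c) r"
  shows "cmod (cw c r l) = 4 * r\<^sup>2 * (Im l)\<^sup>2"
proof -
  define u where "u = l - complex_of_real c"
  have u: "cmod u = r" using assms by (simp add: u_def dist_norm norm_minus_commute)
  have "(complex_of_real r)\<^sup>2 = u * cnj u"
    using complex_norm_square[of u] u by simp
  then have "u\<^sup>2 - (complex_of_real r)\<^sup>2 = u * (2 * \<i> * complex_of_real (Im u))"
    by (simp add: power2_eq_square right_diff_distrib[symmetric] complex_diff_cnj mult.commute)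
  then have "cmod (cw c r l) = (r * (2 * \<bar>Im u\<bar>))\<^sup>2"
    unfolding cw_def u_def[symmetric] by (simp add: norm_power norm_mult u)
  then show ?thesis by (simp add: u_def power_mult_distrib)
qed

lemma cw_eq_0: "cw c r l = 0 \<Longrightarrow> cmod (l - complex_of_real c) = \<bar>r\<bar>"
  by (simp add: cw_def power2_eq_iff) (metis norm_minus_cancel norm_of_real)

section \<open>Weighted resolvent integrals over circles around a regular point\<close>

locale contour = gsymmetric +
  fixes c r k :: real
  assumes reg: "regular_point c r k"
begin

lemma r0: "r > 0" and k0: "k > 0"
  and rho_disc: "cmod (l - complex_of_real c) < r \<Longrightarrow> Im l \<noteq> 0 \<Longrightarrow> l \<in> rho"
  and lower: "cmod (l - complex_of_real c) < r \<Longrightarrow> x \<in> D \<Longrightarrow> k * \<bar>Im l\<bar> * norm x \<le> norm (T x - cscale l x)"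
  using reg unfolding regular_point_def by (auto simp: dist_norm norm_minus_commute)

definition h :: "real \<Rightarrow> 'a \<Rightarrow> complex \<Rightarrow> 'a" where
  "h s x l = cscale (cw c s l) (res l x)"

lemma rho_sphere: "0 < s \<Longrightarrow> s < r \<Longrightarrow> l \<in> sphere (complex_of_real c) s \<Longrightarrow> cw c s l = 0 \<or> l \<in> rho"
  using rho_disc[of l] norm_cw[of l c s] by (cases "Im l = 0") (auto simp: dist_norm norm_minus_commute)

lemma h_bound:
  assumes s: "0 < s" "s < r" and l: "l \<in> sphere (complex_of_real c) s"
  shows "norm (h s x l) \<le> 4 * s\<^sup>2 / k * \<bar>Im l\<bar> * norm x"
proof (cases "Im l = 0")
  case True
  then show ?thesis using norm_cw[OF l] by (simp add: h_def)
next
  case False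
  have d: "cmod (l - complex_of_real c) < r" using s l by (simp add: dist_norm norm_minus_commute)
  have lr: "l \<in> rho" by (rule rho_disc[OF d False])
  have "k * \<bar>Im l\<bar> * norm (res l x) \<le> norm x"
    using lower[OF d res_in[OF lr]] res_right[OF lr] by simp
  then have "\<bar>Im l\<bar> * norm (res l x) \<le> norm x / k" using k0 by (simp add: field_simps)
  then have "4 * s\<^sup>2 * \<bar>Im l\<bar> * (\<bar>Im l\<bar> * norm (res l x)) \<le> 4 * s\<^sup>2 * \<bar>Im l\<bar> * (norm x / k)"
    by (intro mult_left_mono) auto
  moreover have "norm (h s x l) = 4 * s\<^sup>2 * \<bar>Im l\<bar> * (\<bar>Im l\<bar> * norm (res l x))"
    by (simp add: h_def norm_cscale norm_cw[OF l] power2_eq_square)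
  ultimately show ?thesis by (simp add: mult_ac)
qed

lemma h_bound':
  assumes s: "0 < s" "s < r" and l: "l \<in> sphere (complex_of_real c) s"
  shows "norm (h s x l) \<le> 4 * s ^ 3 / k * norm x"
proof -
  have "\<bar>Im l\<bar> \<le> s" using l abs_Im_le_cmod[of "l - complex_of_real c"] by (simp add: dist_norm norm_minus_commute)
  then have "4 * s\<^sup>2 / k * \<bar>Im l\<bar> * norm x \<le> 4 * s\<^sup>2 / k * s * norm x"
    using s k0 by (intro mult_right_mono mult_left_mono) auto
  then show ?thesis using h_bound[OF assms, of x] by (simp add: power2_eq_square power3_eq_cube mult.assoc)
qed

lemma h_continuous:
  assumes s: "0 < s" "s < r"
  shows "continuous_on (sphere (complex_of_real c) s) (h s x)"
  unfolding continuous_on_def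
proof
  fix l assume l: "l \<in> sphere (complex_of_real c) s"
  show "(h s x \<longlongrightarrow> h s x l) (at l within sphere (complex_of_real c) s)"
  proof (cases "Im l = 0")
    case False
    have "l \<in> rho" by (rule rho_disc) (use s l False in \<open>auto simp: dist_norm norm_minus_commute\<close>)
    then have "((\<lambda>m. res m x) \<longlongrightarrow> res l x) (at l within sphere (complex_of_real c) s)"
      using res_tendsto[of l x] tendsto_within_subset[of "\<lambda>m. res m x" _ l UNIV] by auto
    then show ?thesis unfolding h_def[abs_def] cw_def[abs_def] by (intro tendsto_intros) auto
  next
    case True
    then have "h s x l = 0" using norm_cw[OF l] by (simp add: h_def)
    moreover have "(h s x \<longlongrightarrow> 0) (at l within sphere (complex_of_real c) s)"
    proof (rule Lim_null_comparison)
      show "\<forall>\<^sub>F m in at l within sphere (complex_of_real c) s. norm (h s x m) \<le> 4 * s\<^sup>2 / k * \<bar>Im m\<bar> * norm x"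
        unfolding eventually_at_filter using h_bound[OF s] by (auto intro: always_eventually)
      have "((\<lambda>m. 4 * s\<^sup>2 / k * \<bar>Im m\<bar> * norm x) \<longlongrightarrow> 4 * s\<^sup>2 / k * \<bar>Im l\<bar> * norm x) (at l within sphere (complex_of_real c) s)"
        using k0 by (intro tendsto_intros) auto
      then show "((\<lambda>m. 4 * s\<^sup>2 / k * \<bar>Im m\<bar> * norm x) \<longlongrightarrow> 0) (at l within sphere (complex_of_real c) s)"
        using True by simp
    qed
    ultimately show ?thesis by simp
  qed
qed

text \<open>\<open>Kf s \<phi>\<close> is \<open>\<phi>(T) w(T)\<close> cut off to the interval \<open>(c - s, c + s)\<close>, where \<open>w = cw c s\<close> vanishes
  doubly at the two points in which the circle meets the real line.\<close>
definition Kf :: "real \<Rightarrow> (complex \<Rightarrow> complex) \<Rightarrow> 'a \<Rightarrow> 'a" where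
  "Kf s \<phi> x = - cI c s (\<lambda>l. cscale (\<phi> l * (l - c)) (h s x l))"

abbreviation cont :: "real \<Rightarrow> (complex \<Rightarrow> complex) \<Rightarrow> bool" where
  "cont s \<phi> \<equiv> continuous_on (sphere (complex_of_real c) s) \<phi>"

lemma Kf_continuous:
  assumes "0 < s" "s < r" "cont s \<phi>"
  shows "continuous_on (sphere (complex_of_real c) s) (\<lambda>l. cscale (\<phi> l * (l - c)) (h s x l))"
  by (intro continuous_intros assms h_continuous)

text \<open>The order s^4 matters later: the weighted resolvent contributes s^3 and the factor l -
  c, standing for dl, one more s.\<close>

lemma Kf_bound:
  assumes s: "0 < s" "s < r" "cont s \<phi>" and M: "\<And>l. l \<in> sphere (complex_of_real c) s \<Longrightarrow> cmod (\<phi> l) \<le> M"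
  shows "norm (Kf s \<phi> x) \<le> M * 4 * s ^ 4 / k * norm x"
  unfolding Kf_def norm_minus_cancel
proof (rule cI_bound[OF Kf_continuous[OF s] s(1)])
  fix l assume l: "l \<in> sphere (complex_of_real c) s"
  have "norm (cscale (\<phi> l * (l - c)) (h s x l)) = cmod (\<phi> l) * s * norm (h s x l)"
    using l by (simp add: norm_cscale norm_mult dist_norm norm_minus_commute)
  also have "\<dots> \<le> M * s * (4 * s ^ 3 / k * norm x)"
    using M[OF l] order_trans[OF norm_ge_zero M[OF l]] s by (intro mult_mono h_bound'[OF s(1,2) l]) auto
  finally show "norm (cscale (\<phi> l * (l - c)) (h s x l)) \<le> M * 4 * s ^ 4 / k * norm x"
    by (simp add: power3_eq_cube power4_eq_xxxx mult_ac)
qed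

lemma Kf_comm:
  assumes s: "0 < s" "s < r" "cont s \<phi>" and B: "commT B"
  shows "B (Kf s \<phi> x) = Kf s \<phi> (B x)"
proof -
  have Bl: "cblinear B" using B by (simp add: commT_def)
  have "B (Kf s \<phi> x) = - cI c s (\<lambda>l. B (cscale (\<phi> l * (l - c)) (h s x l)))"
    unfolding Kf_def cblinear_simps(3)[OF Bl] by (simp add: cI_linear[OF Kf_continuous[OF s] s(1) cblinear_bl[OF Bl]])
  also have "\<dots> = Kf s \<phi> (B x)" unfolding Kf_def
  proof (intro arg_cong[where f = uminus] cI_cong s)
    fix l assume "l \<in> sphere (complex_of_real c) s"
    from rho_sphere[OF s(1,2) this] have "B (h s x l) = h s (B x) l"
      by (auto simp: h_def cblinear_simps(4,6)[OF Bl] res_comm[OF B])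
    then show "B (cscale (\<phi> l * (l - c)) (h s x l)) = cscale (\<phi> l * (l - c)) (h s (B x) l)"
      by (simp only: cblinear_simps(6)[OF Bl])
  qed
  finally show ?thesis .
qed

lemma h_add: "0 < s \<Longrightarrow> s < r \<Longrightarrow> l \<in> sphere (complex_of_real c) s \<Longrightarrow> h s (x + y) l = h s x l + h s y l"
  using rho_sphere[of s l] res_add[of l x y] by (auto simp: h_def cscale_add_right)

lemma h_cscale: "0 < s \<Longrightarrow> s < r \<Longrightarrow> l \<in> sphere (complex_of_real c) s \<Longrightarrow> h s (cscale a x) l = cscale a (h s x l)"
  using rho_sphere[of s l] res_cscale[of l x a] by (auto simp: h_def cscale_left_commute[of a])

lemma Kf_cblinear:
  assumes s: "0 < s" "s < r" "cont s \<phi>"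
  shows "cblinear (Kf s \<phi>)"
proof -
  have "compact (\<phi> ` sphere (complex_of_real c) s)" using s(3) by (intro compact_continuous_image) auto
  then obtain M where M: "\<And>l. l \<in> sphere (complex_of_real c) s \<Longrightarrow> cmod (\<phi> l) \<le> M"
    by (metis bounded_iff compact_imp_bounded imageI)
  show ?thesis
  proof (rule cblinearI[OF _ _ Kf_bound[OF s M]])
    fix x y a
    have "cI c s (\<lambda>l. cscale (\<phi> l * (l - c)) (h s (x + y) l))
        = cI c s (\<lambda>l. cscale (\<phi> l * (l - c)) (h s x l) + cscale (\<phi> l * (l - c)) (h s y l))"
      by (rule cI_cong[OF s(1)]) (simp add: h_add[OF s(1,2)] cscale_add_right)
    then show "Kf s \<phi> (x + y) = Kf s \<phi> x + Kf s \<phi> y"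
      unfolding Kf_def by (simp add: cI_add[OF Kf_continuous[OF s] Kf_continuous[OF s] s(1)])
    have "cI c s (\<lambda>l. cscale (\<phi> l * (l - c)) (h s (cscale a x) l))
        = cI c s (\<lambda>l. cscale a (cscale (\<phi> l * (l - c)) (h s x l)))"
      by (rule cI_cong[OF s(1)]) (simp add: h_cscale[OF s(1,2)] cscale_left_commute[of a])
    then show "Kf s \<phi> (cscale a x) = cscale a (Kf s \<phi> x)"
      unfolding Kf_def by (simp add: cI_linear[OF Kf_continuous[OF s] s(1) bounded_linear_cscale, symmetric])
  qed
qed

lemma Kf_lincomb:
  assumes s: "0 < s" "s < r" "cont s \<phi>" "cont s \<psi>"
  shows "Kf s (\<lambda>l. \<phi> l + a * \<psi> l) x = Kf s \<phi> x + cscale a (Kf s \<psi> x)"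
proof -
  have "cI c s (\<lambda>l. cscale ((\<phi> l + a * \<psi> l) * (l - c)) (h s x l))
      = cI c s (\<lambda>l. cscale (\<phi> l * (l - c)) (h s x l) + cscale a (cscale (\<psi> l * (l - c)) (h s x l)))"
    by (rule cI_cong[OF s(1)]) (simp add: cscale_assoc cscale_add_left[symmetric] algebra_simps)
  also have "\<dots> = cI c s (\<lambda>l. cscale (\<phi> l * (l - c)) (h s x l)) + cI c s (\<lambda>l. cscale a (cscale (\<psi> l * (l - c)) (h s x l)))"
    by (rule cI_add[OF Kf_continuous[OF s(1-3)] _ s(1)])
       (intro continuous_on_cscale continuous_on_const Kf_continuous[OF s(1,2,4)])
  also have "\<dots> = cI c s (\<lambda>l. cscale (\<phi> l * (l - c)) (h s x l)) + cscale a (cI c s (\<lambda>l. cscale (\<psi> l * (l - c)) (h s x l)))"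
    by (simp only: cI_linear[OF Kf_continuous[OF s(1,2,4)] s(1) bounded_linear_cscale])
  finally show ?thesis by (simp add: Kf_def)
qed

text \<open>The form adjoint of \<open>res l\<close> is \<open>res (cnj l)\<close>. Weight and
  \<phi> respect conjugation, and reflecting the circle restores the original integral.\<close>

lemma Kf_sym:
  assumes s: "0 < s" "s < r" "cont s \<phi>" and real: "\<And>l. \<phi> (cnj l) = cnj (\<phi> l)"
  shows "Gsym (Kf s \<phi>)"
  unfolding Gsym_def
proof (intro allI)
  fix x y
  have left: "bounded_linear (\<lambda>u. b u y)" for y
    unfolding b_def by (rule bounded_linear_compose[OF bounded_linear_cinner_left cblinear_bl[OF cblinear_G]])
  define F where "F x y l = b (cscale (\<phi> l * (l - c)) (h s x l)) y" for x y l
  have contF: "continuous_on (sphere (complex_of_real c) s) (F x y)" for x y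
    unfolding F_def by (rule bounded_linear.continuous_on[OF left Kf_continuous[OF s]])
  have K: "b (Kf s \<phi> x) y = - cI c s (F x y)" for x y
    using cI_linear[OF Kf_continuous[OF s] s(1) left, of x y]
      linear_neg[OF bounded_linear.linear[OF left]] by (simp add: Kf_def F_def[abs_def])
  have "b x (Kf s \<phi> y) = cnj (b (Kf s \<phi> y) x)" by (rule b_commute)
  also have "\<dots> = - cI c s (\<lambda>l. cnj (F y x l))"
    unfolding K by (simp add: cI_linear[OF contF s(1) bounded_linear_cnj])
  also have "cI c s (\<lambda>l. cnj (F y x l)) = cI c s (\<lambda>l. F x y (cnj l))"
  proof (rule cI_cong[OF s(1)])
    fix l assume l: "l \<in> sphere (complex_of_real c) s"
    have cl: "cnj l \<in> sphere (complex_of_real c) s"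
      using l by (metis complex_cnj_complex_of_real complex_cnj_diff complex_mod_cnj dist_norm mem_sphere)
    have "cnj (cw c s l) * cnj (b (res l y) x) = cw c s (cnj l) * b (res (cnj l) x) y"
    proof (cases "cw c s l = 0")
      case True
      then show ?thesis by (simp add: cw_cnj)
    next
      case False
      then have rr: "l \<in> rho" "cnj l \<in> rho"
        using rho_sphere[OF s(1,2) l] rho_sphere[OF s(1,2) cl] by (auto simp: cw_cnj)
      have "cnj (b (res l y) x) = b (res (cnj l) x) y"
        using res_sym[of "cnj l" x y] rr b_commute[of "res l y" x] by simp
      then show ?thesis by (simp add: cw_cnj)
    qed
    then show "cnj (F y x l) = F x y (cnj l)"
      by (simp add: F_def h_def b_cscale_left real mult.assoc)
  qed
  also have "\<dots> = cI c s (F x y)" by (rule cI_reflect[OF contF s(1)])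
  finally show "b (Kf s \<phi> x) y = b x (Kf s \<phi> y)" by (simp add: K)
qed

text \<open>T is unbounded and cannot be moved under the integral. The integrand is written as a
  fixed bounded resolvent \<open>res m\<close> of a continuous function; \<open>res m\<close> leaves
  the integral and T - m then cancels it.\<close>

lemma Kf_T:
  assumes s: "0 < s" "s < r" "cont s \<phi>"
  shows "Kf s \<phi> x \<in> D"
    and "T (Kf s \<phi> x) = Kf s (\<lambda>l. l * \<phi> l) x - cscale (cI c s (\<lambda>l. \<phi> l * cw c s l * (l - c))) x"
proof -
  \<comment> \<open>A nonreal point inside the disc of radius r, hence a point of
    \<open>rho\<close>.\<close>
  define m where "m = complex_of_real c + \<i> * complex_of_real s"
  have m: "m \<in> rho" by (rule rho_disc) (use s in \<open>auto simp: m_def norm_mult\<close>)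
  define J where "J = cI c s (\<lambda>l. \<phi> l * cw c s l * (l - c))"
  have cw: "cont s (cw c s)" by (rule holomorphic_on_imp_continuous_on[OF cw_holomorphic])
  have step: "h s x l = res m (cscale (cw c s l) x + cscale (l - m) (h s x l))"
    if l: "l \<in> sphere (complex_of_real c) s" for l
  proof (cases "cw c s l = 0")
    case True
    then show ?thesis using cblinear_simps(4)[OF res_cblinear[OF m]] by (simp add: h_def)
  next
    case False
    then have lr: "l \<in> rho" using rho_sphere[OF s(1,2) l] by simp
    have "res l x = res m x + cscale (l - m) (res l (res m x))"
      using resolvent_identity[OF lr m, of x] by (simp add: algebra_simps)
    also have "res l (res m x) = res m (res l x)" by (rule res_comm[OF commT_res[OF lr] m])
    also have "res m x + cscale (l - m) (res m (res l x)) = res m (x + cscale (l - m) (res l x))"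
      by (simp only: cblinear_simps(1,6)[OF res_cblinear[OF m]])
    finally have "res l x = res m (x + cscale (l - m) (res l x))" .
    then have "h s x l = res m (cscale (cw c s l) (x + cscale (l - m) (res l x)))"
      unfolding h_def by (simp only: cblinear_simps(6)[OF res_cblinear[OF m]])
    also have "cscale (cw c s l) (x + cscale (l - m) (res l x)) = cscale (cw c s l) x + cscale (l - m) (h s x l)"
      by (simp add: h_def cscale_add_right cscale_left_commute[of "l - m"])
    finally show ?thesis .
  qed
  have c1: "continuous_on (sphere (complex_of_real c) s) (\<lambda>l. cscale (\<phi> l * cw c s l * (l - c)) x)"
    by (intro continuous_intros s cw)
  have c2: "cont s (\<lambda>l. l * \<phi> l + (- m) * \<phi> l)" by (intro continuous_intros s)
  define y where "y = cscale J x - (Kf s (\<lambda>l. l * \<phi> l) x + cscale (- m) (Kf s \<phi> x))"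
  have "- Kf s \<phi> x = cI c s (\<lambda>l. cscale (\<phi> l * (l - c)) (h s x l))" by (simp add: Kf_def)
  also have "\<dots> = cI c s (\<lambda>l. res m (cscale (\<phi> l * cw c s l * (l - c)) x + cscale ((l * \<phi> l + (- m) * \<phi> l) * (l - c)) (h s x l)))"
  proof (rule cI_cong[OF s(1)])
    fix l assume l: "l \<in> sphere (complex_of_real c) s"
    have "cscale (\<phi> l * (l - c)) (h s x l)
        = res m (cscale (\<phi> l * (l - c)) (cscale (cw c s l) x + cscale (l - m) (h s x l)))"
      by (subst step[OF l]) (simp only: cblinear_simps(6)[OF res_cblinear[OF m]])
    then show "cscale (\<phi> l * (l - c)) (h s x l)
        = res m (cscale (\<phi> l * cw c s l * (l - c)) x + cscale ((l * \<phi> l + (- m) * \<phi> l) * (l - c)) (h s x l))"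
      by (simp add: cscale_add_right cscale_assoc algebra_simps)
  qed
  also have "\<dots> = res m (cI c s (\<lambda>l. cscale (\<phi> l * cw c s l * (l - c)) x + cscale ((l * \<phi> l + (- m) * \<phi> l) * (l - c)) (h s x l)))"
    by (rule cI_linear[OF continuous_on_add[OF c1 Kf_continuous[OF s(1,2) c2]] s(1) cblinear_bl[OF res_cblinear[OF m]], symmetric])
  also have "cI c s (\<lambda>l. cscale (\<phi> l * cw c s l * (l - c)) x + cscale ((l * \<phi> l + (- m) * \<phi> l) * (l - c)) (h s x l))
     = cI c s (\<lambda>l. cscale (\<phi> l * cw c s l * (l - c)) x) - Kf s (\<lambda>l. l * \<phi> l + (- m) * \<phi> l) x"
    by (simp only: cI_add[OF c1 Kf_continuous[OF s(1,2) c2] s(1)] Kf_def) simp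
  also have "cI c s (\<lambda>l. cscale (\<phi> l * cw c s l * (l - c)) x) = cscale J x"
    unfolding J_def by (rule cI_linear[OF _ s(1) bounded_linear_cscale_left, symmetric]) (intro continuous_intros s cw)
  also have "Kf s (\<lambda>l. l * \<phi> l + (- m) * \<phi> l) x = Kf s (\<lambda>l. l * \<phi> l) x + cscale (- m) (Kf s \<phi> x)"
    by (rule Kf_lincomb[OF s(1,2) _ s(3)]) (intro continuous_intros s)
  finally have "- Kf s \<phi> x = res m y" by (simp only: y_def)
  then have K: "Kf s \<phi> x = res m (- y)" using cblinear_simps(3)[OF res_cblinear[OF m], of y] by (metis minus_minus)
  then show "Kf s \<phi> x \<in> D" using res_in[OF m] by simp
  have "T (Kf s \<phi> x) - cscale m (Kf s \<phi> x) = - y" using res_right[OF m, of "- y"] K by simp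
  then show "T (Kf s \<phi> x) = Kf s (\<lambda>l. l * \<phi> l) x - cscale (cI c s (\<lambda>l. \<phi> l * cw c s l * (l - c))) x"
    unfolding J_def[symmetric] by (simp add: y_def algebra_simps)
qed

text \<open>For entire \<phi> the scalar integral in \<open>Kf_T\<close> vanishes by Cauchy's
  theorem, so T - (c + z) acts as multiplication of the symbol by l - c - z.\<close>

lemma Kf_shift:
  fixes z :: complex
  assumes s: "0 < s" "s < r" and \<phi>: "\<phi> holomorphic_on UNIV"
  shows "T (Kf s \<phi> x) - cscale (c + z) (Kf s \<phi> x) = Kf s (\<lambda>l. (l - c - z) * \<phi> l) x"
proof -
  have cont\<phi>: "cont s \<phi>" using holomorphic_on_imp_continuous_on[OF \<phi>] continuous_on_subset by blast
  have "cI c s (\<lambda>l. (\<phi> l * cw c s l) * (l - c)) = 0"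
    by (rule cI_Cauchy_0[of _ c r]) (intro holomorphic_on_mult cw_holomorphic holomorphic_on_subset[OF \<phi>] s subset_UNIV)+
  then have "T (Kf s \<phi> x) = Kf s (\<lambda>l. l * \<phi> l) x" using Kf_T(2)[OF s cont\<phi>, of x] by simp
  moreover define a where "a = complex_of_real c + z"
  moreover have "Kf s (\<lambda>l. l * \<phi> l + (- a) * \<phi> l) x = Kf s (\<lambda>l. l * \<phi> l) x + cscale (- a) (Kf s \<phi> x)"
    by (rule Kf_lincomb[OF s _ cont\<phi>]) (intro continuous_intros cont\<phi>)
  moreover have "(\<lambda>l::complex. l * \<phi> l + (- a) * \<phi> l) = (\<lambda>l::complex. (l - c - z) * \<phi> l)"
    by (simp add: fun_eq_iff a_def algebra_simps)
  ultimately show ?thesis by (simp only: a_def[symmetric] cscale_minus_left) simp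
qed

text \<open>For z outside the circle this computes the resolvent on the range of
  \<open>Kf s (\<lambda>_. 1)\<close>, as products of integrals require. For z inside, the residue
  \<open>cw c s z\<close> appears, which inverts T - z on the kernel of
  \<open>Kf s (\<lambda>_. 1)\<close>.\<close>

lemma Kf_Cauchy_kernel:
  assumes s: "0 < s" "s < r" and z: "cmod (z - complex_of_real c) \<noteq> s"
  shows "Kf s (\<lambda>l. 1 / (l - z)) x \<in> D"
    and "T (Kf s (\<lambda>l. 1 / (l - z)) x) - cscale z (Kf s (\<lambda>l. 1 / (l - z)) x)
      = Kf s (\<lambda>_. 1) x - (if cmod (z - complex_of_real c) < s then cscale (cw c s z) x else 0)"
proof -
  have ne: "l - z \<noteq> 0" if "l \<in> sphere (complex_of_real c) s" for l
    using that z by (auto simp: dist_norm norm_minus_commute)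
  have c1: "cont s (\<lambda>l. 1 / (l - z))" by (intro continuous_intros) (use ne in auto)
  show "Kf s (\<lambda>l. 1 / (l - z)) x \<in> D" by (rule Kf_T(1)[OF s c1])
  have J: "cI c s (\<lambda>l. 1 / (l - z) * cw c s l * (l - c)) = (if cmod (z - complex_of_real c) < s then cw c s z else 0)"
  proof (cases "cmod (z - complex_of_real c) < s")
    case True
    then show ?thesis using cI_Cauchy[OF cw_holomorphic[of c s UNIV] True] by simp
  next
    case False
    then have "cmod (z - complex_of_real c) > s" using z by simp
    moreover have "cI c s (\<lambda>l. (1 / (l - z) * cw c s l) * (l - c)) = 0"
      if "s < R" "R \<le> cmod (z - complex_of_real c)" for R
    proof (rule cI_Cauchy_0[OF _ s(1) that(1)])
      have "l - z \<noteq> 0" if "l \<in> ball (complex_of_real c) R" for l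
        using that \<open>R \<le> _\<close> by (auto simp: dist_norm norm_minus_commute)
      then show "(\<lambda>l. 1 / (l - z) * cw c s l) holomorphic_on ball (complex_of_real c) R"
        by (intro holomorphic_intros cw_holomorphic) auto
    qed
    ultimately show ?thesis using False by simp
  qed
  have "Kf s (\<lambda>l. l * (1 / (l - z)) + (- z) * (1 / (l - z))) x
      = Kf s (\<lambda>l. l * (1 / (l - z))) x + cscale (- z) (Kf s (\<lambda>l. 1 / (l - z)) x)"
    by (rule Kf_lincomb[OF s _ c1]) (intro continuous_on_mult continuous_on_id c1)
  moreover have "Kf s (\<lambda>l. l * (1 / (l - z)) + (- z) * (1 / (l - z))) x = Kf s (\<lambda>_. 1) x"
    unfolding Kf_def
  proof (intro arg_cong[where f = uminus] cI_cong[OF s(1)])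
    fix l assume "l \<in> sphere (complex_of_real c) s"
    then have "l * (1 / (l - z)) + (- z) * (1 / (l - z)) = 1" using ne[of l] by (simp flip: diff_divide_distrib)
    then show "cscale ((l * (1 / (l - z)) + (- z) * (1 / (l - z))) * (l - c)) (h s x l) = cscale (1 * (l - c)) (h s x l)"
      by simp
  qed
  ultimately show "T (Kf s (\<lambda>l. 1 / (l - z)) x) - cscale z (Kf s (\<lambda>l. 1 / (l - z)) x)
      = Kf s (\<lambda>_. 1) x - (if cmod (z - complex_of_real c) < s then cscale (cw c s z) x else 0)"
    unfolding Kf_T(2)[OF s c1] J by (simp split: if_splits)
qed

text \<open>Multiplicativity for concentric circles. The larger circle sees the smaller integral
  through the Cauchy kernel; after exchanging the integrals, Cauchy's formula evaluates the outer
  weight at the inner points.\<close>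

lemma Kf_nested:
  assumes s: "0 < s" "s < s'" "s' < r"
  shows "Kf s' (\<lambda>_. 1) (Kf s (\<lambda>_. 1) x) = Kf s (cw c s') x"
proof -
  let ?S = "sphere (complex_of_real c)"
  have s': "0 < s'" "s < r" using s by auto
  have cw: "cont \<sigma> (cw c \<tau>)" for \<sigma> \<tau> by (rule holomorphic_on_imp_continuous_on[OF cw_holomorphic])
  define N where "N z l = cscale (cw c s' z * (z - c) * ((l - c) / (z - l))) (h s x l)" for z l :: complex
  have ne: "z - l \<noteq> 0" if "z \<in> ?S s'" "l \<in> ?S s" for z l
    using that s by (auto simp: dist_norm)
  have inner: "cscale (1 * (z - c)) (h s' (Kf s (\<lambda>_. 1) x) z) = cI c s (N z)" if z: "z \<in> ?S s'" for z
  proof -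
    have rz: "cw c s' z = 0 \<or> z \<in> rho" by (rule rho_sphere[OF s'(1) s(3) z])
    have cont1: "cont s (\<lambda>l. 1 / (l - z))"
    proof (intro continuous_intros ballI)
      show "l - z \<noteq> 0" if "l \<in> ?S s" for l using ne[OF z that] by auto
    qed
    have dz: "cmod (z - complex_of_real c) = s'" using z by (simp add: dist_norm norm_minus_commute)
    have "cscale (cw c s' z) (res z (Kf s (\<lambda>_. 1) x)) = cscale (cw c s' z) (Kf s (\<lambda>l. 1 / (l - z)) x)"
    proof (cases "cw c s' z = 0")
      case False
      then have zr: "z \<in> rho" using rz by simp
      have "res z (Kf s (\<lambda>_. 1) x) = Kf s (\<lambda>l. 1 / (l - z)) x"
        by (rule res_eqI[OF zr Kf_Cauchy_kernel(1)[OF s(1) s'(2)]])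
           (use Kf_Cauchy_kernel(2)[OF s(1) s'(2), of z x] dz s in auto)
      then show ?thesis by simp
    qed simp
    then have "cscale (1 * (z - c)) (h s' (Kf s (\<lambda>_. 1) x) z)
        = cscale (- ((z - c) * cw c s' z)) (cI c s (\<lambda>l. cscale (1 / (l - z) * (l - c)) (h s x l)))"
      by (simp add: h_def Kf_def cscale_assoc)
    also have "\<dots> = cI c s (\<lambda>l. cscale (- ((z - c) * cw c s' z)) (cscale (1 / (l - z) * (l - c)) (h s x l)))"
      by (rule cI_linear[OF Kf_continuous[OF s(1) s'(2) cont1] s(1) bounded_linear_cscale])
    also have "\<dots> = cI c s (N z)"
    proof (rule cI_cong[OF s(1)])
      fix l assume l: "l \<in> ?S s"
      have "- ((z - c) * cw c s' z) * (1 / (l - z) * (l - c)) = cw c s' z * (z - c) * ((l - c) / (z - l))"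
        using ne[OF z l] ne[OF z l] by (simp add: field_simps)
      then show "cscale (- ((z - c) * cw c s' z)) (cscale (1 / (l - z) * (l - c)) (h s x l)) = N z l"
        by (simp only: N_def cscale_assoc)
    qed
    finally show ?thesis .
  qed
  have contN: "continuous_on (?S s' \<times> ?S s) (\<lambda>(z, l). N z l)"
  proof -
    have hc: "continuous_on (?S s' \<times> ?S s) (\<lambda>p. h s x (snd p))"
      by (rule continuous_on_compose2[OF h_continuous[OF s(1) s'(2)] continuous_on_snd[OF continuous_on_id]]) auto
    show ?thesis unfolding N_def case_prod_beta cw_def
      by (intro continuous_intros hc) (use ne in auto)
  qed
  have "Kf s' (\<lambda>_. 1) (Kf s (\<lambda>_. 1) x) = - cI c s' (\<lambda>z. cI c s (N z))"
    unfolding Kf_def[of s'] by (intro arg_cong[where f = uminus] cI_cong[OF s'(1) inner])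
  also have "cI c s' (\<lambda>z. cI c s (N z)) = cI c s (\<lambda>l. cI c s' (\<lambda>z. N z l))"
    using cI_swap[OF contN s'(1) s(1)] by simp
  also have "\<dots> = cI c s (\<lambda>l. cscale (cw c s' l * (l - c)) (h s x l))"
  proof (rule cI_cong[OF s(1)])
    fix l assume l: "l \<in> ?S s"
    have dl: "cmod (l - complex_of_real c) < s'" using l s by (simp add: dist_norm norm_minus_commute)
    have cont2: "continuous_on (?S s') (\<lambda>z. cw c s' z / (z - l) * (z - c))"
      by (intro continuous_intros cw) (use ne l in auto)
    have "cI c s' (\<lambda>z. N z l) = cI c s' (\<lambda>z. cscale (cw c s' z / (z - l) * (z - c)) (cscale (l - c) (h s x l)))"
      by (rule cI_cong[OF s'(1)]) (simp add: N_def cscale_assoc field_simps)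
    also have "\<dots> = cscale (cI c s' (\<lambda>z. cw c s' z / (z - l) * (z - c))) (cscale (l - c) (h s x l))"
      by (rule cI_linear[OF cont2 s'(1) bounded_linear_cscale_left, symmetric])
    also have "cI c s' (\<lambda>z. cw c s' z / (z - l) * (z - c)) = cw c s' l"
      by (rule cI_Cauchy[OF cw_holomorphic dl])
    finally show "cI c s' (\<lambda>z. N z l) = cscale (cw c s' l * (l - c)) (h s x l)" by (simp add: cscale_assoc)
  qed
  finally show ?thesis by (simp add: Kf_def)
qed

text \<open>The polynomial \<open>(u\<^sup>2 - 3s\<^sup>2)\<^sup>2 + 16s\<^sup>4\<close> has the roots \<open>(\<plusminus>2 \<plusminus> \<i>) s\<close>, at distance \<open>s\<close> from the real
  line; applying it to \<open>T - c\<close> and bounding three of its factors from below controls the fourth.\<close>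
lemma T_near_c_on_range:
  assumes s: "0 < s" "3 * s < r"
  shows "norm (T (Kf s (\<lambda>_. 1) x) - c *\<^sub>R Kf s (\<lambda>_. 1) x)
    \<le> ((36 / k + 16) / k ^ 3 + 3) * s * norm (Kf s (\<lambda>_. 1) x)"
proof -
  have sr: "s < r" using s by simp
  define y where "y = Kf s (\<lambda>_. 1) x"
  \<comment> \<open>With this radius \<open>cw c s'\<close> is (u^2 - 3 s^2)^2 for u = l - c, the
    square occurring in the quartic polynomial.\<close>
  define s' where "s' = sqrt 3 * s"
  have "1 < sqrt 3" "sqrt 3 < 3" by (auto intro: real_less_lsqrt real_less_rsqrt)
  then have s': "s < s'" "s' < r" using s by (auto simp: s'_def intro: le_less_trans[OF _ s(2)])
  have s2: "(complex_of_real s')\<^sup>2 = 3 * (complex_of_real s)\<^sup>2"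
    by (simp add: s'_def power_mult_distrib flip: of_real_power)
  \<comment> \<open>The four roots have modulus \<open>sqrt 5 * s\<close>, below 3 s < r, so the
    lower bound of the regular point holds at each of them with constant k s.\<close>
  define z where "z j = (if j = (0::nat) then Complex (2 * s) s else if j = 1 then Complex (2 * s) (- s)
    else if j = 2 then Complex (- 2 * s) s else Complex (- 2 * s) (- s))" for j
  have zn: "cmod (z j) \<le> 3 * s" "\<bar>Im (z j)\<bar> = s" for j
  proof -
    have "sqrt (5 * s\<^sup>2) \<le> 3 * s" using s by (intro real_le_lsqrt) (auto simp: power_mult_distrib)
    then show "cmod (z j) \<le> 3 * s" by (simp add: z_def complex_norm power_mult_distrib)
    show "\<bar>Im (z j)\<bar> = s" using s by (simp add: z_def)
  qed
  have low: "k * s * norm (Kf s \<phi> x) \<le> norm (Kf s (\<lambda>l. (l - c - z j) * \<phi> l) x)"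
    if \<phi>: "\<phi> holomorphic_on UNIV" for \<phi> j
  proof -
    have cont\<phi>: "cont s \<phi>" using holomorphic_on_imp_continuous_on[OF \<phi>] continuous_on_subset by blast
    show ?thesis
      using lower[of "c + z j" "Kf s \<phi> x", OF _ Kf_T(1)[OF s(1) sr cont\<phi>]] zn[of j] s
      by (simp add: Kf_shift[OF s(1) sr \<phi>])
  qed
  define p1 where "p1 = (\<lambda>l::complex. (l - c - z 0) * 1)"
  define p2 where "p2 = (\<lambda>l::complex. (l - c - z 1) * p1 l)"
  define p3 where "p3 = (\<lambda>l::complex. (l - c - z 2) * p2 l)"
  define p4 where "p4 = (\<lambda>l::complex. (l - c - z 3) * p3 l)"
  have hol: "p1 holomorphic_on UNIV" "p2 holomorphic_on UNIV" "p3 holomorphic_on UNIV"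
    unfolding p1_def p2_def p3_def by (intro holomorphic_intros)+
  have ks: "k * s > 0" using k0 s by simp
  \<comment> \<open>Three of the factors are stripped off from below; only the factor of
    \<open>z 0\<close> stays in \<open>p1\<close>.\<close>
  have "(k * s) ^ 3 * norm (Kf s p1 x) = k * s * (k * s * (k * s * norm (Kf s p1 x)))"
    by (simp add: power3_eq_cube mult.assoc)
  also have "\<dots> \<le> k * s * (k * s * norm (Kf s p2 x))"
    using low[OF hol(1), of 1] ks by (intro mult_left_mono) (auto simp: p2_def)
  also have "\<dots> \<le> k * s * norm (Kf s p3 x)"
    using low[OF hol(2), of 2] ks by (intro mult_left_mono) (auto simp: p3_def)
  also have "\<dots> \<le> norm (Kf s p4 x)" using low[OF hol(3), of 3] by (simp add: p4_def)
  also have "p4 = (\<lambda>l. cw c s' l + (16 * (complex_of_real s) ^ 4) * 1)"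
  proof
    fix l
    define u where "u = l - complex_of_real c"
    define t where "t = complex_of_real s"
    have zz: "z 0 = (2 + \<i>) * t" "z 1 = (2 - \<i>) * t" "z 2 = (- 2 + \<i>) * t" "z 3 = (- 2 - \<i>) * t"
      by (simp_all add: z_def t_def complex_eq_iff)
    have rearrange: "d * (c' * (b' * a)) = (c' * d) * (a * b')" for a b' c' d :: complex
      by (simp add: mult_ac)
    have "(u - (2 + \<i>) * t) * (u - (2 - \<i>) * t) = u\<^sup>2 - 4 * t * u + 5 * t\<^sup>2"
      by (simp add: algebra_simps power2_eq_square)
    moreover have "(u - (- 2 + \<i>) * t) * (u - (- 2 - \<i>) * t) = u\<^sup>2 + 4 * t * u + 5 * t\<^sup>2"
      by (simp add: algebra_simps power2_eq_square)
    ultimately have "(u - (- 2 - \<i>) * t) * ((u - (- 2 + \<i>) * t) * ((u - (2 - \<i>) * t) * (u - (2 + \<i>) * t)))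
        = (u\<^sup>2 + 4 * t * u + 5 * t\<^sup>2) * (u\<^sup>2 - 4 * t * u + 5 * t\<^sup>2)"
      by (simp only: rearrange)
    also have "\<dots> = (u\<^sup>2 - 3 * t\<^sup>2)\<^sup>2 + 16 * t ^ 4" by (simp add: algebra_simps power2_eq_square power4_eq_xxxx)
    finally show "p4 l = cw c s' l + (16 * (complex_of_real s) ^ 4) * 1"
      by (simp add: p4_def p3_def p2_def p1_def cw_def s2 zz u_def[symmetric] t_def[symmetric] del: One_nat_def)
  qed
  also have "Kf s (\<lambda>l. cw c s' l + (16 * (complex_of_real s) ^ 4) * 1) x
      = Kf s' (\<lambda>_. 1) y + cscale (16 * (complex_of_real s) ^ 4) y"
    unfolding y_def Kf_nested[OF s(1) s'] using holomorphic_on_imp_continuous_on[OF cw_holomorphic]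
    by (intro Kf_lincomb[OF s(1) sr]) auto
  \<comment> \<open>The number 36 is the factor 4 of \<open>Kf_bound\<close> times s'^4 / s^4 =
    9.\<close>
  also have "norm \<dots> \<le> 36 * s ^ 4 / k * norm y + 16 * s ^ 4 * norm y"
  proof (rule order_trans[OF norm_triangle_ineq add_mono])
    have "norm (Kf s' (\<lambda>_. 1) y) \<le> 1 * 4 * s' ^ 4 / k * norm y"
      using s s' by (intro Kf_bound) auto
    moreover have "s' ^ 4 = 9 * s ^ 4"
    proof -
      have "s'\<^sup>2 = 3 * s\<^sup>2" by (simp add: s'_def power_mult_distrib)
      then have "(s'\<^sup>2)\<^sup>2 = (3 * s\<^sup>2)\<^sup>2" by simp
      then show ?thesis by (simp add: power_mult_distrib flip: power_mult)
    qed
    ultimately show "norm (Kf s' (\<lambda>_. 1) y) \<le> 36 * s ^ 4 / k * norm y" by simp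
    show "norm (cscale (16 * (complex_of_real s) ^ 4) y) \<le> 16 * s ^ 4 * norm y"
      using s by (simp add: norm_cscale norm_mult norm_power)
  qed
  also have "\<dots> = (k * s) ^ 3 * ((36 / k + 16) / k ^ 3 * s * norm y)"
    using k0 by (simp add: field_simps power3_eq_cube power4_eq_xxxx)
  finally have p1: "norm (Kf s p1 x) \<le> (36 / k + 16) / k ^ 3 * s * norm y"
    using ks by (simp only: mult_le_cancel_left_pos zero_less_power)
  have "T y - cscale (c + z 0) y = Kf s p1 x"
    unfolding y_def p1_def by (rule Kf_shift[OF s(1) sr]) simp
  then have "T y - c *\<^sub>R y = Kf s p1 x + cscale (z 0) y"
    by (simp add: cscale_add_left cscale_of_real algebra_simps)
  then have "norm (T y - c *\<^sub>R y) \<le> norm (Kf s p1 x) + cmod (z 0) * norm y"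
    by (metis norm_cscale norm_triangle_ineq)
  also have "\<dots> \<le> (36 / k + 16) / k ^ 3 * s * norm y + 3 * s * norm y"
    by (intro add_mono p1 mult_right_mono zn) simp
  finally show ?thesis by (simp add: y_def distrib_right)
qed

end

section \<open>Localizing projections\<close>

context gsymmetric
begin

section \<open>Commuting projections and resolvents on their ranges\<close>

lemma commT_id: "commT (\<lambda>x. x)"
  by (simp add: commT_def cblinear_id)
lemma commT_zero: "commT (\<lambda>x. 0)"
  by (simp add: commT_def cblinear_zero csubspace_0[OF sD] T_0)
lemma commT_add: "commT A \<Longrightarrow> commT B \<Longrightarrow> commT (\<lambda>x. A x + B x)"
  by (simp add: commT_def cblinear_add csubspace_add[OF sD] T_add)
lemma commT_sub: "commT A \<Longrightarrow> commT B \<Longrightarrow> commT (\<lambda>x. A x - B x)"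
  by (simp add: commT_def cblinear_sub csubspace_diff[OF sD] T_diff)
lemma commT_compose: "commT A \<Longrightarrow> commT B \<Longrightarrow> commT (\<lambda>x. A (B x))"
  by (simp add: commT_def cblinear_compose)

lemma commTD: assumes "commT B"
  shows "cblinear B" "x \<in> D \<Longrightarrow> B x \<in> D" "x \<in> D \<Longrightarrow> B (T x) = T (B x)"
  using assms by (auto simp: commT_def)

lemma commT_shift: "commT B \<Longrightarrow> x \<in> D \<Longrightarrow> B (T x - cscale z x) = T (B x) - cscale z (B x)"
  by (simp add: commTD cblinear_simps[OF commTD(1)])

lemma shift_diff: "x \<in> D \<Longrightarrow> y \<in> D \<Longrightarrow> T (x - y) - cscale z (x - y) = (T x - cscale z x) - (T y - cscale z y)"
  by (simp add: T_diff cscale_diff_right)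

text \<open>Membership in a range becomes the equation A x = x. Injectivity is part of the norm
  bound, and T - z maps into the range because A commutes with T.\<close>

lemma resolvent_in_range_iff:
  assumes A: "commT A" "\<And>x. A (A x) = A x"
  shows "z \<in> resolvent_in (range A) (D \<inter> range A) T \<longleftrightarrow>
    (\<exists>C. \<forall>x\<in>D. A x = x \<longrightarrow> norm x \<le> C * norm (T x - cscale z x))
    \<and> (\<forall>y. A y = y \<longrightarrow> (\<exists>x\<in>D. A x = x \<and> T x - cscale z x = y))"
  (is "_ \<longleftrightarrow> ?bd \<and> ?sur")
proof -
  note rA = projection_range_iff[of A, OF A(2)]
  define f where "f x = T x - cscale z x" for x
  have fe: "(\<lambda>x. T x - cscale z x) = f" by (simp add: f_def fun_eq_iff)
  have sub: "A (f x) = f x" if "x \<in> D" "A x = x" for x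
    using commT_shift[OF A(1) that(1), of z] that(2) by (simp add: f_def)
  show ?thesis
  proof
    assume "z \<in> resolvent_in (range A) (D \<inter> range A) T"
    then have res: "f ` (D \<inter> range A) = range A" "\<exists>C. \<forall>x\<in>D \<inter> range A. norm x \<le> C * norm (f x)"
      by (simp_all add: resolvent_in_def fe[symmetric])
    have ?bd using res(2) rA unfolding f_def by (metis IntI)
    moreover have ?sur
    proof (intro allI impI)
      fix y assume "A y = y"
      then have "y \<in> f ` (D \<inter> range A)" using res(1) rA by simp
      then show "\<exists>x\<in>D. A x = x \<and> T x - cscale z x = y" using rA by (auto simp: f_def)
    qed
    ultimately show "?bd \<and> ?sur" by blast
  next
    assume *: "?bd \<and> ?sur"
    then obtain C where C: "\<And>x. x \<in> D \<Longrightarrow> A x = x \<Longrightarrow> norm x \<le> C * norm (f x)" by (auto simp: f_def)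
    have sur: "\<exists>x\<in>D. A x = x \<and> f x = y" if "A y = y" for y using * that by (auto simp: f_def)
    have "inj_on f (D \<inter> range A)"
    proof (rule inj_onI)
      fix x y assume xy: "x \<in> D \<inter> range A" "y \<in> D \<inter> range A" "f x = f y"
      have "f (x - y) = 0" using shift_diff[of x y z] xy by (simp add: f_def)
      moreover have "A (x - y) = x - y" using xy rA by (simp add: cblinear_simps[OF commTD(1)[OF A(1)]])
      ultimately have "norm (x - y) \<le> 0" using C[of "x - y"] xy csubspace_diff[OF sD] by simp
      then show "x = y" by simp
    qed
    moreover have "f ` (D \<inter> range A) = range A"
    proof (intro equalityI subsetI)
      fix y assume "y \<in> f ` (D \<inter> range A)"
      then show "y \<in> range A" using sub rA by auto
    next
      fix y assume "y \<in> range A"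
      then have "A y = y" using rA by blast
      from sur[OF this] show "y \<in> f ` (D \<inter> range A)" using rA by (metis IntI imageI)
    qed
    moreover have "\<exists>C. \<forall>x\<in>D \<inter> range A. norm x \<le> C * norm (T x - cscale z x)"
    proof (intro exI[of _ C] ballI)
      fix x assume "x \<in> D \<inter> range A"
      then show "norm x \<le> C * norm (T x - cscale z x)" using C[of x] rA[of x] by (simp add: f_def)
    qed
    ultimately show "z \<in> resolvent_in (range A) (D \<inter> range A) T"
      unfolding resolvent_in_def mem_Collect_eq fe by (intro conjI)
  qed
qed

text \<open>A solution found in the larger range is carried into the smaller one by B, which
  commutes with T and fixes the right-hand side.\<close>

lemma resolvent_restrict:
  assumes A: "commT A" "\<And>x. A (A x) = A x" and B: "commT B" "\<And>x. B (B x) = B x"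
    and AB: "\<And>x. A (B x) = B x" and z: "z \<in> resolvent_in (range A) (D \<inter> range A) T"
  shows "z \<in> resolvent_in (range B) (D \<inter> range B) T"
proof -
  have Ax: "A x = x" if "B x = x" for x using AB[of x] that by simp
  obtain C where C: "\<And>x. x \<in> D \<Longrightarrow> A x = x \<Longrightarrow> norm x \<le> C * norm (T x - cscale z x)"
    and sur: "\<And>y. A y = y \<Longrightarrow> \<exists>x\<in>D. A x = x \<and> T x - cscale z x = y"
    using z resolvent_in_range_iff[OF A, of z] by auto
  have "\<exists>x\<in>D. B x = x \<and> T x - cscale z x = y" if y: "B y = y" for y
  proof -
    obtain x where x: "x \<in> D" "T x - cscale z x = y" using sur[OF Ax[OF y]] by blast
    have "T (B x) - cscale z (B x) = y" using commT_shift[OF B(1) x(1), of z] x(2) y by simp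
    then show ?thesis using commTD(2)[OF B(1) x(1)] B(2) by blast
  qed
  moreover have "norm x \<le> C * norm (T x - cscale z x)" if "x \<in> D" "B x = x" for x
    using C[OF that(1) Ax[OF that(2)]] .
  ultimately show ?thesis unfolding resolvent_in_range_iff[OF B] by blast
qed

lemma resolvent_direct_sum:
  assumes A: "commT A" "\<And>x. A (A x) = A x" and B: "commT B" "\<And>x. B (B x) = B x"
    and AB: "\<And>x. A (B x) = 0" "\<And>x. B (A x) = 0"
    and z: "z \<in> resolvent_in (range A) (D \<inter> range A) T" "z \<in> resolvent_in (range B) (D \<inter> range B) T"
  shows "z \<in> resolvent_in (range (\<lambda>x. A x + B x)) (D \<inter> range (\<lambda>x. A x + B x)) T"
proof -
  note Al = cblinear_simps[OF commTD(1)[OF A(1)]] and Bl = cblinear_simps[OF commTD(1)[OF B(1)]]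
  have idem: "A (A x + B x) + B (A x + B x) = A x + B x" for x by (simp add: Al Bl A(2) B(2) AB)
  obtain C1 where C1: "\<And>x. x \<in> D \<Longrightarrow> A x = x \<Longrightarrow> norm x \<le> C1 * norm (T x - cscale z x)"
    and sur1: "\<And>y. A y = y \<Longrightarrow> \<exists>x\<in>D. A x = x \<and> T x - cscale z x = y"
    using z(1) resolvent_in_range_iff[OF A, of z] by auto
  obtain C2 where C2: "\<And>x. x \<in> D \<Longrightarrow> B x = x \<Longrightarrow> norm x \<le> C2 * norm (T x - cscale z x)"
    and sur2: "\<And>y. B y = y \<Longrightarrow> \<exists>x\<in>D. B x = x \<and> T x - cscale z x = y"
    using z(2) resolvent_in_range_iff[OF B, of z] by auto
  obtain KA where KA: "KA > 0" "\<And>x. norm (A x) \<le> KA * norm x" using cblinear_bound[OF commTD(1)[OF A(1)]] by blast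
  obtain KB where KB: "KB > 0" "\<And>x. norm (B x) \<le> KB * norm x" using cblinear_bound[OF commTD(1)[OF B(1)]] by blast
  have "norm x \<le> (\<bar>C1\<bar> * KA + \<bar>C2\<bar> * KB) * norm (T x - cscale z x)" if x: "x \<in> D" "A x + B x = x" for x
  proof -
    have "norm x \<le> norm (A x) + norm (B x)" using x(2) norm_triangle_ineq[of "A x" "B x"] by simp
    moreover have "norm (A x) \<le> \<bar>C1\<bar> * (KA * norm (T x - cscale z x))"
    proof -
      have "norm (A x) \<le> C1 * norm (A (T x - cscale z x))"
        using C1[OF commTD(2)[OF A(1) x(1)] A(2)] commT_shift[OF A(1) x(1), of z] by simp
      also have "\<dots> \<le> \<bar>C1\<bar> * (KA * norm (T x - cscale z x))" by (intro mult_mono KA) auto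
      finally show ?thesis .
    qed
    moreover have "norm (B x) \<le> \<bar>C2\<bar> * (KB * norm (T x - cscale z x))"
    proof -
      have "norm (B x) \<le> C2 * norm (B (T x - cscale z x))"
        using C2[OF commTD(2)[OF B(1) x(1)] B(2)] commT_shift[OF B(1) x(1), of z] by simp
      also have "\<dots> \<le> \<bar>C2\<bar> * (KB * norm (T x - cscale z x))" by (intro mult_mono KB) auto
      finally show ?thesis .
    qed
    ultimately show ?thesis by (simp add: algebra_simps)
  qed
  moreover have "\<exists>x\<in>D. A x + B x = x \<and> T x - cscale z x = y" if y: "A y + B y = y" for y
  proof -
    obtain u where u: "u \<in> D" "A u = u" "T u - cscale z u = A y" using sur1[OF A(2)] by blast
    obtain v where v: "v \<in> D" "B v = v" "T v - cscale z v = B y" using sur2[OF B(2)] by blast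
    have "B u = 0" "A v = 0" using AB(2)[of u] AB(1)[of v] u(2) v(2) by simp_all
    moreover have "T (u + v) - cscale z (u + v) = y"
      using u v y by (simp add: T_add cscale_add_right algebra_simps)
    ultimately show ?thesis using u v csubspace_add[OF sD] by (intro bexI[of _ "u + v"]) (auto simp: Al Bl)
  qed
  ultimately show ?thesis unfolding resolvent_in_range_iff[OF commT_add[OF A(1) B(1)] idem] by blast
qed

text \<open>Only the complement is controlled over U: the spectrum of T on \<open>range P\<close>
  may leave U. Boundedness of T P turns T into a bounded selfadjoint operator there, and commuting
  with everything that commutes with T makes these projections commute with each other.\<close>

definition localizing :: "('a \<Rightarrow> 'a) \<Rightarrow> real set \<Rightarrow> bool" where
  "localizing P U \<longleftrightarrow> commT P \<and> (\<forall>x. P (P x) = P x) \<and> Gsym P \<and> uniformly_positive G (range P)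
     \<and> (\<forall>x. P x \<in> D) \<and> (\<exists>M. \<forall>x. norm (T (P x)) \<le> M * norm x)
     \<and> (\<forall>B. commT B \<longrightarrow> (\<forall>x. B (P x) = P (B x)))
     \<and> (\<forall>z\<in>U. complex_of_real z \<in> resolvent_in (range (\<lambda>x. x - P x)) (D \<inter> range (\<lambda>x. x - P x)) T)"

lemma localizingD:
  assumes "localizing P U"
  shows "commT P" "P (P x) = P x" "Gsym P" "uniformly_positive G (range P)" "P x \<in> D"
    "\<exists>M. \<forall>x. norm (T (P x)) \<le> M * norm x" "commT B \<Longrightarrow> B (P x) = P (B x)"
    "z \<in> U \<Longrightarrow> complex_of_real z \<in> resolvent_in (range (\<lambda>x. x - P x)) (D \<inter> range (\<lambda>x. x - P x)) T"
  using assms by (simp_all add: localizing_def)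

lemma localizing_mono: "localizing P U \<Longrightarrow> V \<subseteq> U \<Longrightarrow> localizing P V"
  unfolding localizing_def by blast

lemma localizing_empty: "localizing (\<lambda>x. 0) {}"
  using csubspace_0[OF sD] unfolding localizing_def
  by (auto simp: commT_zero Gsym_def uniformly_positive_def T_0 cblinear_simps(4)[OF commTD(1)]
      intro: exI[of _ 0] exI[of _ 1])

lemma localizing_complement:
  assumes P: "localizing P U"
  shows "commT (\<lambda>x. x - P x)" "(x - P x) - P (x - P x) = x - P x"
  using commT_sub[OF commT_id localizingD(1)[OF P]]
  by (simp_all add: cblinear_simps[OF commTD(1)[OF localizingD(1)[OF P]]] localizingD(2)[OF P])

text \<open>N = P + Q - P Q is the projection onto the sum of the two ranges. Its complement lies in
  both complements, so it inherits the resolvent points of each.\<close>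

lemma localizing_join:
  assumes P: "localizing P U" and Q: "localizing Q V"
  obtains N where "localizing N (U \<union> V)" "\<And>x. N (P x) = P x" "\<And>x. P (N x) = P x"
    "\<And>x. N (Q x) = Q x" "\<And>x. Q (N x) = Q x"
proof -
  note cP = localizingD(1)[OF P] and cQ = localizingD(1)[OF Q]
  note Pl = cblinear_simps[OF commTD(1)[OF cP]] and Ql = cblinear_simps[OF commTD(1)[OF cQ]]
  note PP = localizingD(2)[OF P] and QQ = localizingD(2)[OF Q]
  have PQ: "P (Q x) = Q (P x)" for x by (rule localizingD(7)[OF Q cP])
  define N where "N x = P x + Q x - P (Q x)" for x
  have NP: "N (P x) = P x" "P (N x) = P x" "N (Q x) = Q x" "Q (N x) = Q x" for x
    by (simp_all add: N_def Pl Ql PP QQ PQ)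
  have NN: "N (N x) = N x" for x
  proof -
    have "N (N x) = P (N x) + Q (N x) - P (Q (N x))" by (rule N_def)
    also have "\<dots> = N x" by (simp only: NP) (simp only: N_def)
    finally show ?thesis .
  qed
  have cN: "commT N" unfolding N_def by (intro commT_sub commT_add cP cQ) (rule commT_compose[OF cP cQ])
  have "localizing N (U \<union> V)" unfolding localizing_def
  proof (intro conjI allI impI ballI)
    show "commT N" by (rule cN)
    show "N (N x) = N x" for x by (rule NN)
    have "b (P (Q x)) y = b x (P (Q y))" for x y
      using localizingD(3)[OF P] localizingD(3)[OF Q] by (simp add: Gsym_def PQ)
    then show "Gsym N" using localizingD(3)[OF P] localizingD(3)[OF Q]
      by (simp add: Gsym_def N_def b_add_left b_add_right b_diff_left b_diff_right)
    show "N x \<in> D" for x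
      unfolding N_def by (intro csubspace_diff[OF sD] csubspace_add[OF sD] localizingD(5)[OF P] localizingD(5)[OF Q])
    show "uniformly_positive G (range N)"
    proof -
      obtain d1 where d1: "d1 > 0" "\<And>x. x \<in> range P \<Longrightarrow> q x \<ge> d1 * (norm x)\<^sup>2"
        using localizingD(4)[OF P] unfolding uniformly_positive_q by blast
      obtain d2 where d2: "d2 > 0" "\<And>x. x \<in> range Q \<Longrightarrow> q x \<ge> d2 * (norm x)\<^sup>2"
        using localizingD(4)[OF Q] unfolding uniformly_positive_q by blast
      have "q y \<ge> (min d1 d2 / 2) * (norm y)\<^sup>2" if y: "y \<in> range N" for y
      proof -
        \<comment> \<open>P y and v are form-orthogonal and lie in the ranges of P and Q, so their
          q-values add. The factor 1/2 in the bound pays for (a + b)^2 \<le> 2 (a^2 + b^2).\<close>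
        define v where "v = y - P y"
        have Ny: "N y = y" using projection_range_iff[of N y, OF NN] y by blast
        have "v = Q y - P (Q y)" using Ny by (simp add: v_def N_def algebra_simps)
        then have "v = Q (y - P y)" by (simp add: Ql PQ)
        then have v: "v \<in> range Q" by blast
        have "b (P y) v = b (P (P y)) v" by (simp add: PP)
        also have "\<dots> = b (P y) (P v)" using localizingD(3)[OF P] by (simp add: Gsym_def)
        also have "P v = 0" by (simp add: v_def Pl PP)
        finally have "q y = q (P y) + q v" using q_add[of "P y" v] by (simp add: v_def)
        moreover have "min d1 d2 * (norm (P y))\<^sup>2 \<le> q (P y)"
          using d1(2)[of "P y"] by (intro order_trans[OF mult_right_mono[of "min d1 d2" d1]]) auto
        moreover have "min d1 d2 * (norm v)\<^sup>2 \<le> q v"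
          using d2(2)[OF v] by (intro order_trans[OF mult_right_mono[of "min d1 d2" d2]]) auto
        ultimately have 1: "min d1 d2 * ((norm (P y))\<^sup>2 + (norm v)\<^sup>2) \<le> q y" by (simp add: distrib_left)
        have "norm y \<le> norm (P y) + norm v" using norm_triangle_ineq[of "P y" v] by (simp add: v_def)
        then have "(norm y)\<^sup>2 \<le> (norm (P y) + norm v)\<^sup>2" by (intro power_mono) auto
        also have "\<dots> \<le> 2 * ((norm (P y))\<^sup>2 + (norm v)\<^sup>2)"
          using sum_squares_bound[of "norm (P y)" "norm v"] by (simp add: power2_sum)
        finally have "(min d1 d2 / 2) * (norm y)\<^sup>2 \<le> (min d1 d2 / 2) * (2 * ((norm (P y))\<^sup>2 + (norm v)\<^sup>2))"
          using d1(1) d2(1) by (intro mult_left_mono) auto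
        also have "\<dots> = min d1 d2 * ((norm (P y))\<^sup>2 + (norm v)\<^sup>2)" by simp
        finally show ?thesis using 1 by linarith
      qed
      moreover have "min d1 d2 / 2 > 0" using d1(1) d2(1) by simp
      ultimately show ?thesis unfolding uniformly_positive_q by blast
    qed
    show "\<exists>M. \<forall>x. norm (T (N x)) \<le> M * norm x"
    proof -
      obtain M1 where M1: "\<And>x. norm (T (P x)) \<le> M1 * norm x" using localizingD(6)[OF P] by blast
      obtain M2 where M2: "\<And>x. norm (T (Q x)) \<le> M2 * norm x" using localizingD(6)[OF Q] by blast
      obtain K where K: "K > 0" "\<And>x. norm (Q x) \<le> K * norm x" using cblinear_bound[OF commTD(1)[OF cQ]] by blast
      have "norm (T (N x)) \<le> (M1 + M2 + \<bar>M1\<bar> * K) * norm x" for x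
      proof -
        have "T (N x) = T (P x) + T (Q x) - T (P (Q x))"
          unfolding N_def by (simp add: T_diff T_add localizingD(5)[OF P] localizingD(5)[OF Q] csubspace_add[OF sD])
        then have "norm (T (N x)) \<le> norm (T (P x)) + norm (T (Q x)) + norm (T (P (Q x)))"
          by (metis (no_types) norm_triangle_ineq norm_triangle_ineq4 add_right_mono order_trans)
        moreover have "norm (T (P (Q x))) \<le> \<bar>M1\<bar> * (K * norm x)"
          by (rule order_trans[OF M1]) (intro mult_mono K, auto)
        ultimately show ?thesis using M1[of x] M2[of x] by (simp add: algebra_simps)
      qed
      then show ?thesis by blast
    qed
    show "B (N x) = N (B x)" if B: "commT B" for B x
      unfolding N_def by (simp add: cblinear_simps[OF commTD(1)[OF B]] localizingD(7)[OF P B] localizingD(7)[OF Q B])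
    fix z assume z: "z \<in> U \<union> V"
    have cN': "commT (\<lambda>x. x - N x)" by (rule commT_sub[OF commT_id cN])
    have NN': "(x - N x) - N (x - N x) = x - N x" for x by (simp add: cblinear_simps[OF commTD(1)[OF cN]] NN)
    have ab: "(x - N x) - P (x - N x) = x - N x" "(x - N x) - Q (x - N x) = x - N x" for x
      by (simp_all add: Pl Ql NP)
    show "complex_of_real z \<in> resolvent_in (range (\<lambda>x. x - N x)) (D \<inter> range (\<lambda>x. x - N x)) T"
    proof (cases "z \<in> U")
      case True
      show ?thesis
        by (rule resolvent_restrict[OF localizing_complement[OF P] cN' NN' ab(1) localizingD(8)[OF P True]])
    next
      case False
      then have "z \<in> V" using z by blast
      then show ?thesis
        by (rule resolvent_restrict[OF localizing_complement[OF Q] cN' NN' ab(2) localizingD(8)[OF Q]])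
    qed
  qed
  then show ?thesis using that NP by blast
qed

lemma localizing_near_regular_point:
  assumes reg: "regular_point c r k" and e: "e > 0" and d: "d > 0"
    and p: "\<And>x. x \<in> D \<Longrightarrow> norm (T x - c *\<^sub>R x) \<le> e * norm x \<Longrightarrow> d * (norm x)\<^sup>2 \<le> q x"
  shows "\<exists>P U. open U \<and> c \<in> U \<and> localizing P U"
proof -
  interpret contour G D T c r k by unfold_locales (rule reg)
  define C where "C = (36 / k + 16) / k ^ 3 + 3"
  have C: "C > 0" unfolding C_def using k0 by (intro add_nonneg_pos divide_nonneg_nonneg) auto
  \<comment> \<open>The first entry ensures 3 s < r; the second brings T - c below e on the range of
    X, where positive type then applies.\<close>
  define s where "s = min (r / 4) (e / C)"
  have s0: "s > 0" and s3: "3 * s < r" and sC: "C * s \<le> e"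
    using r0 e C by (auto simp: s_def min_def field_simps)
  have sr: "s < r" using s0 s3 by simp
  define X where "X = Kf s (\<lambda>_. 1)"
  have Xl: "cblinear X" unfolding X_def by (rule Kf_cblinear[OF s0 sr]) simp
  have Xsym: "Gsym X" unfolding X_def by (rule Kf_sym[OF s0 sr]) simp_all
  have XD: "X x \<in> D" for x unfolding X_def by (rule Kf_T(1)[OF s0 sr]) simp
  have Xcomm: "B (X x) = X (B x)" if "commT B" for B x
    unfolding X_def by (rule Kf_comm[OF s0 sr _ that]) simp
  have Xe: "norm (T y - c *\<^sub>R y) \<le> e * norm y" if y: "y \<in> range X" for y
  proof -
    obtain x where "y = X x" using y by blast
    then have "norm (T y - c *\<^sub>R y) \<le> C * s * norm y" using T_near_c_on_range[OF s0 s3, of x] by (simp add: C_def X_def)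
    also have "\<dots> \<le> e * norm y" by (intro mult_right_mono sC) simp
    finally show ?thesis .
  qed
  have up: "uniformly_positive G (range X)"
    unfolding uniformly_positive_q using p[OF _ Xe] XD d by (intro exI[of _ d]) blast
  obtain P where P: "cblinear P" "\<And>x. P (P x) = P x" "Gsym P" "range P = closure (range X)"
    "\<And>x. P x = 0 \<longleftrightarrow> X x = 0"
    "\<And>B x. cblinear B \<Longrightarrow> (\<And>x. B (X x) = X (B x)) \<Longrightarrow> B (P x) = P (B x)"
    by (rule support_projection[OF Xl Xsym up]) blast
  define m where "m = complex_of_real c + \<i> * complex_of_real s"
  have m: "m \<in> rho" by (rule rho_disc) (use s0 sr in \<open>auto simp: m_def norm_mult\<close>)
  have Pcomm: "B (P x) = P (B x)" if "commT B" for B x by (rule P(6)[OF commTD(1)[OF that] Xcomm[OF that]])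
  have cP: "commT P" by (rule commT_if_res_comm[OF P(1) m]) (rule Pcomm[OF commT_res[OF m], symmetric])
  have cX: "commT X" by (rule commT_if_res_comm[OF Xl m]) (rule Xcomm[OF commT_res[OF m], symmetric])
  \<comment> \<open>On the range of X the operator T is bounded by e + \<open>\<bar>c\<bar>\<close>,
    so images of Cauchy sequences are Cauchy, and closedness of T extends domain and estimate to the
    closure.\<close>
  have Pe: "y \<in> D \<and> norm (T y - c *\<^sub>R y) \<le> e * norm y" if y: "y \<in> range P" for y
  proof -
    obtain u where u: "\<And>n. u n \<in> range X" "u \<longlonglongrightarrow> y" using y P(4) closure_sequential by metis
    have uD: "u n \<in> D" for n using u(1)[of n] XD by auto
    have "Cauchy (\<lambda>n. T (u n))"
    proof (rule metric_CauchyI)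
      fix \<epsilon> :: real assume "\<epsilon> > 0"
      define \<epsilon>' where "\<epsilon>' = \<epsilon> / (e + \<bar>c\<bar> + 1)"
      have \<epsilon>': "\<epsilon>' > 0" using \<open>\<epsilon> > 0\<close> e by (simp add: \<epsilon>'_def)
      have "Cauchy u" using u(2) by (rule LIMSEQ_imp_Cauchy)
      then obtain N0 where N0: "\<And>m n. m \<ge> N0 \<Longrightarrow> n \<ge> N0 \<Longrightarrow> dist (u m) (u n) < \<epsilon>'"
        using metric_CauchyD[OF _ \<epsilon>'] by blast
      have "dist (T (u m)) (T (u n)) < \<epsilon>" if "m \<ge> N0" "n \<ge> N0" for m n
      proof -
        define v where "v = u m - u n"
        have v: "v \<in> range X" unfolding v_def by (intro csubspace_diff[OF csubspace_range[OF Xl]] u)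
        have nv: "norm v < \<epsilon>'" using N0[OF that] by (simp add: v_def dist_norm)
        have Tv: "T (u m) - T (u n) = T v" by (simp add: v_def T_diff uD)
        have "norm (T v) \<le> norm (T v - c *\<^sub>R v) + norm (c *\<^sub>R v)"
          using norm_triangle_ineq[of "T v - c *\<^sub>R v" "c *\<^sub>R v"] by simp
        also have "\<dots> \<le> (e + \<bar>c\<bar>) * norm v" using Xe[OF v] by (simp add: distrib_right)
        also have "\<dots> \<le> (e + \<bar>c\<bar>) * \<epsilon>'" using nv e by (intro mult_left_mono) auto
        also have "\<dots> < (e + \<bar>c\<bar> + 1) * \<epsilon>'" using \<epsilon>' by simp
        also have "\<dots> = \<epsilon>" using e by (simp add: \<epsilon>'_def)
        finally show ?thesis by (simp add: dist_norm Tv)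
      qed
      then show "\<exists>M. \<forall>m\<ge>M. \<forall>n\<ge>M. dist (T (u m)) (T (u n)) < \<epsilon>" by blast
    qed
    then obtain w where w: "(\<lambda>n. T (u n)) \<longlonglongrightarrow> w" using Cauchy_convergent_iff convergent_def by blast
    have yD: "y \<in> D" "T y = w" using T_closed[OF uD u(2) w] by auto
    have "norm (w - c *\<^sub>R y) \<le> e * norm y"
      by (rule LIMSEQ_le[OF tendsto_norm[OF tendsto_diff[OF w tendsto_scaleR[OF tendsto_const u(2)]]]
            tendsto_mult[OF tendsto_const tendsto_norm[OF u(2)]]]) (use Xe u(1) in auto)
    then show ?thesis using yD by simp
  qed
  define U where "U = {c - s<..<c + s}"
  have "localizing P U" unfolding localizing_def
  proof (intro conjI allI impI ballI)
    show "commT P" by (rule cP)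
    show "P (P x) = P x" for x by (rule P)
    show "Gsym P" by (rule P)
    show "uniformly_positive G (range P)" unfolding P(4) by (rule uniformly_positive_closure[OF up])
    show "P x \<in> D" for x using Pe by blast
    show "B (P x) = P (B x)" if "commT B" for B x by (rule Pcomm[OF that])
    obtain K where K: "K > 0" "\<And>x. norm (P x) \<le> K * norm x" using cblinear_bound[OF P(1)] by blast
    have "norm (T (P x)) \<le> ((e + \<bar>c\<bar>) * K) * norm x" for x
    proof -
      have "norm (T (P x)) \<le> norm (T (P x) - c *\<^sub>R P x) + norm (c *\<^sub>R P x)"
        using norm_triangle_ineq[of "T (P x) - c *\<^sub>R P x" "c *\<^sub>R P x"] by simp
      also have "\<dots> \<le> (e + \<bar>c\<bar>) * norm (P x)" using Pe[of "P x"] by (simp add: distrib_right)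
      also have "\<dots> \<le> (e + \<bar>c\<bar>) * (K * norm x)" using e by (intro mult_left_mono K) auto
      finally show ?thesis by simp
    qed
    then show "\<exists>M. \<forall>x. norm (T (P x)) \<le> M * norm x" by blast
    fix z assume z: "z \<in> U"
    define zc where "zc = complex_of_real z"
    have zs: "cmod (zc - complex_of_real c) < s"
      using z by (simp add: zc_def U_def abs_less_iff flip: of_real_diff)
    have w0: "cw c s zc \<noteq> 0" using cw_eq_0[of c s zc] zs s0 by auto
    \<comment> \<open>Dividing the Cauchy kernel formula by - \<open>cw c s zc\<close> gives (T - z)
      B = 1 - X / \<open>cw c s zc\<close>, so B inverts T - z where X vanishes, that is, on the
      kernel of P.\<close>
    define B where "B x = cscale (- (1 / cw c s zc)) (Kf s (\<lambda>l. 1 / (l - zc)) x)" for x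
    have cont1: "cont s (\<lambda>l. 1 / (l - zc))"
      by (intro continuous_intros) (use zs in \<open>auto simp: dist_norm norm_minus_commute\<close>)
    have Bl: "cblinear B" unfolding B_def by (rule cblinear_scale[OF Kf_cblinear[OF s0 sr cont1]])
    have "B (res m x) = res m (B x)" for x
      unfolding B_def using Kf_comm[OF s0 sr cont1 commT_res[OF m]]
      by (simp add: cblinear_simps(3,6)[OF res_cblinear[OF m]])
    then have cB: "commT B" by (rule commT_if_res_comm[OF Bl m])
    have TB: "B x \<in> D" "T (B x) - cscale zc (B x) = x - cscale (1 / cw c s zc) (X x)" for x
    proof -
      let ?K = "Kf s (\<lambda>l. 1 / (l - zc)) x"
      have K: "?K \<in> D" "T ?K - cscale zc ?K = X x - cscale (cw c s zc) x"
        using Kf_Cauchy_kernel[OF s0 sr, of zc x] zs by (simp_all add: X_def)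
      show "B x \<in> D" unfolding B_def by (rule csubspace_cscale[OF sD K(1)])
      have "T (B x) - cscale zc (B x) = cscale (- (1 / cw c s zc)) (T ?K - cscale zc ?K)"
        unfolding B_def T_cscale[OF K(1)] by (simp only: cscale_left_commute[of zc] cscale_diff_right)
      also have "\<dots> = x - cscale (1 / cw c s zc) (X x)"
        unfolding K(2) using w0 by (simp add: cscale_diff_right cscale_assoc)
      finally show "T (B x) - cscale zc (B x) = x - cscale (1 / cw c s zc) (X x)" .
    qed
    have cP': "commT (\<lambda>x. x - P x)" by (rule commT_sub[OF commT_id cP])
    have PP': "(x - P x) - P (x - P x) = x - P x" for x by (simp add: cblinear_simps[OF P(1)] P(2))
    have X0: "X x = 0" if "x - P x = x" for x using that P(5)[of x] by simp
    obtain KB where KB: "KB > 0" "\<And>x. norm (B x) \<le> KB * norm x" using cblinear_bound[OF Bl] by blast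
    have "norm x \<le> KB * norm (T x - cscale zc x)" if x: "x \<in> D" "x - P x = x" for x
    proof -
      have "B (T x - cscale zc x) = x" using commT_shift[OF cB x(1), of zc] TB(2)[of x] X0[OF x(2)] by simp
      then show ?thesis using KB(2)[of "T x - cscale zc x"] by simp
    qed
    moreover have "\<exists>x\<in>D. x - P x = x \<and> T x - cscale zc x = y" if y: "y - P y = y" for y
    proof -
      have "P (B y) = B (P y)" by (rule Pcomm[OF cB, symmetric])
      then have "B y - P (B y) = B y" using y cblinear_simps(4)[OF Bl] by simp
      moreover have "T (B y) - cscale zc (B y) = y" using TB(2)[of y] X0[OF y] by simp
      ultimately show ?thesis using TB(1)[of y] by blast
    qed
    ultimately show "complex_of_real z \<in> resolvent_in (range (\<lambda>x. x - P x)) (D \<inter> range (\<lambda>x. x - P x)) T"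
      unfolding resolvent_in_range_iff[OF cP' PP'] zc_def by blast
  qed
  moreover have "open U" "c \<in> U" using s0 by (auto simp: U_def)
  ultimately show ?thesis by blast
qed

lemma localizing_compact:
  assumes loc: "\<And>c. c \<in> K \<Longrightarrow> \<exists>P U. open U \<and> c \<in> U \<and> localizing P U" and K: "compact K"
  shows "\<exists>P. localizing P K"
proof -
  obtain P U where PU: "\<And>c. c \<in> K \<Longrightarrow> open (U c)" "\<And>c. c \<in> K \<Longrightarrow> c \<in> U c" "\<And>c. c \<in> K \<Longrightarrow> localizing (P c) (U c)"
    using loc by metis
  have "K \<subseteq> (\<Union>c\<in>K. U c)" using PU(2) by blast
  then obtain F where F: "F \<subseteq> K" "finite F" "K \<subseteq> (\<Union>c\<in>F. U c)"
    using compactE_image[OF K, of K U] PU(1) by blast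
  have "\<exists>Q. localizing Q (\<Union>c\<in>F. U c)" using F(2,1)
  proof (induction F rule: finite_induct)
    case empty
    then show ?case using localizing_empty by auto
  next
    case (insert c F)
    then obtain Q where "localizing Q (\<Union>c\<in>F. U c)" by blast
    with PU(3)[of c] insert.prems obtain N where "localizing N (U c \<union> (\<Union>c\<in>F. U c))"
      using localizing_join by (metis insert_subset)
    then show ?case by auto
  qed
  then show ?thesis using localizing_mono[OF _ F(3)] by blast
qed

end

section \<open>The closed graph theorem\<close>

text \<open>By Baire the closure of some V n has interior in L. Every vector is then approximated up
  to half its norm by one whose image is controlled; iterating gives a geometric series, summed by
  closedness of the graph.\<close>

lemma closed_graph_bounded:
  fixes T :: "'a::banach \<Rightarrow> 'b::banach"
  assumes L: "closed L" "subspace L"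
    and diff: "\<And>x y. x \<in> L \<Longrightarrow> y \<in> L \<Longrightarrow> T (x - y) = T x - T y"
    and scale: "\<And>c x. x \<in> L \<Longrightarrow> T (c *\<^sub>R x) = c *\<^sub>R T x"
    and graph: "\<And>s x y. (\<And>n. s n \<in> L) \<Longrightarrow> s \<longlonglongrightarrow> x \<Longrightarrow> (\<lambda>n. T (s n)) \<longlonglongrightarrow> y \<Longrightarrow> T x = y"
  shows "\<exists>M. \<forall>x\<in>L. norm (T x) \<le> M * norm x"
proof -
  define V where "V n = {x \<in> L. norm (T x) \<le> real n}" for n
  have VL: "closure (V n) \<subseteq> L" for n by (rule closure_minimal) (use L in \<open>auto simp: V_def\<close>)
  have "\<exists>n. top_of_set L interior_of closure (V n) \<noteq> {}"
  proof (rule ccontr)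
    assume neg: "\<not> ?thesis"
    have "completely_metrizable_space (top_of_set L)"
      by (rule completely_metrizable_space_closedin[OF completely_metrizable_space_euclidean]) (use L in simp)
    moreover have "countable (range (\<lambda>n. closure (V n)))" by simp
    moreover have "closedin (top_of_set L) A \<and> top_of_set L interior_of A = {}" if "A \<in> range (\<lambda>n. closure (V n))" for A
      using that neg closed_subset[OF VL closed_closure] by auto
    ultimately have "top_of_set L interior_of \<Union>(range (\<lambda>n. closure (V n))) = {}"
      by (intro Baire_category_alt) auto
    moreover have "\<Union>(range (\<lambda>n. closure (V n))) = L"
    proof (intro equalityI subsetI)
      fix x assume "x \<in> L"
      moreover obtain n where "norm (T x) < real n" using reals_Archimedean2 by blast
      ultimately have "x \<in> V n" by (simp add: V_def)
      then show "x \<in> \<Union>(range (\<lambda>n. closure (V n)))" using closure_subset[of "V n"] by blast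
    qed (use VL in blast)
    moreover have "top_of_set L interior_of L = L"
      using interior_of_topspace[of "top_of_set L"] by simp
    ultimately show False using subspace_0[OF L(2)] by simp
  qed
  then obtain n x0 where "x0 \<in> top_of_set L interior_of closure (V n)" by blast
  then obtain U where U: "openin (top_of_set L) U" "x0 \<in> U" "U \<subseteq> closure (V n)"
    unfolding interior_of_def by blast
  then obtain W where W: "open W" "U = L \<inter> W" unfolding openin_open by blast
  obtain r where r: "r > 0" "ball x0 r \<subseteq> W" using W U openE by blast
  have x0L: "x0 \<in> L" using U W by blast
  have near: "u \<in> closure (V n)" if "u \<in> L" "dist x0 u < r" for u
    using that r W U by auto
  define C where "C = 4 * real n / r"
  have approx: "\<exists>v\<in>L. norm (T v) \<le> C * norm u \<and> norm (u - v) \<le> norm u / 2" if u: "u \<in> L" for u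
  proof (cases "u = 0")
    case True
    have "T 0 = 0" using diff[of 0 0] subspace_0[OF L(2)] by simp
    then show ?thesis using True subspace_0[OF L(2)] by (intro bexI[of _ 0]) auto
  next
    case False
    define c where "c = r / (2 * norm u)"
    have c: "c > 0" using False r by (simp add: c_def)
    define u' where "u' = c *\<^sub>R u"
    have nu': "norm u' = r / 2" using False r by (simp add: u'_def c_def)
    have "x0 + u' \<in> closure (V n)"
      using r nu' by (intro near subspace_add subspace_scale L x0L) (auto simp: u'_def u L subspace_scale dist_norm)
    then obtain a where a: "a \<in> V n" "dist a (x0 + u') < r / 8"
      using r unfolding closure_approachable by (meson divide_pos_pos zero_less_numeral)
    have "x0 \<in> closure (V n)" using U by blast
    then obtain d where d: "d \<in> V n" "dist d x0 < r / 8"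
      using r unfolding closure_approachable by (meson divide_pos_pos zero_less_numeral)
    \<comment> \<open>Both x0 + u' and x0 are limits of V n, so the difference approximates u'
      within r / 4, half the norm of u', while the norm of its image is at most 2 n.\<close>
    define v' where "v' = a - d"
    have v'L: "v' \<in> L" using a d by (auto simp: v'_def V_def intro: subspace_diff L)
    have "T v' = T a - T d" using a d by (simp add: v'_def V_def diff)
    then have Tv': "norm (T v') \<le> 2 * real n"
      using a d norm_triangle_ineq4[of "T a" "T d"] by (simp add: V_def)
    have uv: "u' - v' = (d - x0) - (a - (x0 + u'))" by (simp add: v'_def)
    have "norm (u' - v') \<le> norm (d - x0) + norm (a - (x0 + u'))"
      unfolding uv by (rule norm_triangle_ineq4)
    then have uv': "norm (u' - v') \<le> r / 4" using a(2) d(2) by (simp add: dist_norm)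
    define v where "v = (1 / c) *\<^sub>R v'"
    have "norm (T v) = norm (T v') / c" using c by (simp add: v_def scale[OF v'L])
    also have "\<dots> \<le> 2 * real n / c" using Tv' c by (intro divide_right_mono) auto
    also have "\<dots> = C * norm u" using False r by (simp add: C_def c_def)
    finally have 1: "norm (T v) \<le> C * norm u" .
    have "u - v = (1 / c) *\<^sub>R (u' - v')" using c by (simp add: v_def u'_def scaleR_right_diff_distrib)
    then have "norm (u - v) = norm (u' - v') / c" using c by simp
    also have "\<dots> \<le> (r / 4) / c" using uv' c by (intro divide_right_mono) auto
    also have "\<dots> = norm u / 2" using False r by (simp add: c_def)
    finally have 2: "norm (u - v) \<le> norm u / 2" .
    have "v \<in> L" unfolding v_def by (intro subspace_scale L v'L)
    then show ?thesis using 1 2 by blast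
  qed
  then obtain g where g: "\<And>u. u \<in> L \<Longrightarrow> g u \<in> L" "\<And>u. u \<in> L \<Longrightarrow> norm (T (g u)) \<le> C * norm u"
    "\<And>u. u \<in> L \<Longrightarrow> norm (u - g u) \<le> norm u / 2" by metis
  have C0: "C \<ge> 0" using r by (simp add: C_def)
  have "norm (T u) \<le> (2 * C) * norm u" if u: "u \<in> L" for u
  proof -
    \<comment> \<open>The remainders after k approximations; their norms at least halve in each
      step.\<close>
    define R where "R = rec_nat u (\<lambda>_ w. w - g w)"
    have R0: "R 0 = u" and RS: "R (Suc k) = R k - g (R k)" for k by (simp_all add: R_def)
    have RL: "R k \<in> L" for k by (induction k) (simp_all add: R0 RS u subspace_diff[OF L(2)] g)
    have Rn: "norm (R k) \<le> norm u * (1/2) ^ k" for k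
    proof (induction k)
      case (Suc k)
      have "norm (R (Suc k)) \<le> norm (R k) / 2" unfolding RS by (rule g(3)[OF RL])
      then show ?case using Suc by simp
    qed (simp add: R0)
    have R_lim: "R \<longlonglongrightarrow> 0"
    proof (rule Lim_null_comparison)
      show "\<forall>\<^sub>F k in sequentially. norm (R k) \<le> norm u * (1/2) ^ k" using Rn by simp
      show "(\<lambda>k. norm u * (1/2) ^ k) \<longlonglongrightarrow> 0"
        by (rule tendsto_mult_right_zero) (simp add: LIMSEQ_power_zero)
    qed
    define a where "a k = T (g (R k))" for k
    have an: "norm (a k) \<le> (C * norm u) * (1/2) ^ k" for k
      unfolding a_def using g(2)[OF RL, of k] mult_left_mono[OF Rn[of k] C0] by (simp add: mult.assoc)
    have geo: "(\<lambda>k. (C * norm u) * (1/2) ^ k) sums ((C * norm u) * 2)"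
      using geometric_sums[of "1/2 :: real"] by (intro sums_mult) simp
    have sum_a: "summable a" by (rule summable_comparison_test'[OF sums_summable[OF geo]]) (rule an)
    have "T (u - R k) = (\<Sum>j<k. a j)" for k
    proof (induction k)
      case 0
      show ?case using diff[OF u u] by (simp add: R0)
    next
      case (Suc k)
      have e: "u - R (Suc k) = (u - R k) - (0 - g (R k))" by (simp add: RS)
      have tz: "T (0 - g (R k)) = - a k"
        using diff[OF subspace_0[OF L(2)] g(1)[OF RL], of k] diff[OF u u] by (simp add: a_def)
      have "T (u - R (Suc k)) = T (u - R k) - T (0 - g (R k))"
        unfolding e by (intro diff subspace_diff L u RL subspace_0 g)
      then show ?case by (simp only: tz Suc) simp
    qed
    then have "(\<lambda>k. T (u - R k)) \<longlonglongrightarrow> suminf a" using summable_LIMSEQ[OF sum_a] by simp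
    moreover have "(\<lambda>k. u - R k) \<longlonglongrightarrow> u" using tendsto_diff[OF tendsto_const R_lim, of u] by simp
    ultimately have "T u = suminf a" by (intro graph[of "\<lambda>k. u - R k"] subspace_diff L u RL)
    moreover have "norm (suminf a) \<le> (C * norm u) * 2"
      by (rule norm_sums_le[OF summable_sums[OF sum_a] geo an])
    ultimately show ?thesis by simp
  qed
  then show ?thesis by blast
qed

section \<open>The local spectral function\<close>

context gsymmetric
begin

section \<open>Spectral projections of T obtained from a localizing projection\<close>

lemma localizing_bounded_sa:
  assumes P: "localizing P U"
  shows "bounded_sa G P (\<lambda>x. T (P x))"
proof -
  note cP = localizingD(1)[OF P] and PD = localizingD(5)[OF P] and PP = localizingD(2)[OF P]
  note Pl = cblinear_simps[OF commTD(1)[OF cP]]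
  interpret positive_range G P
    by unfold_locales (rule commTD(1)[OF cP] localizingD(2-4)[OF P])+
  have PT: "P (T (P x)) = T (P x)" for x using commTD(3)[OF cP PD, of x] by (simp add: PP)
  obtain M where M: "\<And>x. norm (T (P x)) \<le> M * norm x" using localizingD(6)[OF P] by blast
  have "cblinear (\<lambda>x. T (P x))"
    by (rule cblinearI[OF _ _ M]) (simp_all add: Pl T_add[OF PD PD] T_cscale[OF PD])
  moreover have "b (T (P x)) y = b x (T (P y))" for x y
  proof -
    have "b (T (P x)) y = b (P (T (P x))) y" by (simp only: PT)
    also have "\<dots> = b (T (P x)) (P y)" by (rule P_b)
    also have "\<dots> = b (P x) (T (P y))" by (rule T_sym[OF PD PD])
    also have "\<dots> = b x (P (T (P y)))" by (rule P_b)
    finally show ?thesis by (simp only: PT)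
  qed
  ultimately have "sa (\<lambda>x. T (P x))" unfolding sa_def Gsym_def by (simp add: PT PP)
  then show ?thesis by unfold_locales
qed

abbreviation Es :: "('a \<Rightarrow> 'a) \<Rightarrow> real set \<Rightarrow> 'a \<Rightarrow> 'a" where
  "Es P \<equiv> bounded_sa.EB G P (\<lambda>x. T (P x))"

lemma Es_props:
  assumes P: "localizing P U" and A: "A \<in> sets borel"
  shows "commT B \<Longrightarrow> B (Es P A x) = Es P A (B x)" "commT (Es P A)" "Es P A x \<in> D"
    "P (Es P A x) = Es P A x" "Es P A (P x) = Es P A x" "Es P A (Es P A x) = Es P A x"
    "Gsym (Es P A)" "uniformly_positive G (range (Es P A))"
proof -
  interpret bounded_sa G P "\<lambda>x. T (P x)" by (rule localizing_bounded_sa[OF P])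
  note cP = localizingD(1)[OF P]
  note sE = EB_sa[OF A]
  show PE: "P (Es P A x) = Es P A x" "Es P A (P x) = Es P A x" for x using saD(3,4)[OF sE] .
  show D: "Es P A x \<in> D" for x using localizingD(5)[OF P, of "Es P A x"] by (simp only: PE)
  show "Es P A (Es P A x) = Es P A x" by (rule EB_idem[OF A])
  show "Gsym (Es P A)" using sE by (simp add: sa_def)
  show "uniformly_positive G (range (Es P A))" by (rule uniformly_positive_subset[OF P_pos sa_range[OF sE]])
  show "B (Es P A x) = Es P A (B x)" if B: "commT B" for B x
  proof (rule EB_comm[OF A])
    have BP: "B (P x) = P (B x)" for x by (rule localizingD(7)[OF P B])
    have "B (T (P x)) = T (P (B x))" for x using commTD(3)[OF B localizingD(5)[OF P], of x] by (simp only: BP)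
    then show "commP B" unfolding commP_def using BP commTD(1)[OF B] by blast
  qed
  show "commT (Es P A)" unfolding commT_def
  proof (intro conjI ballI)
    show "cblinear (Es P A)" by (rule saD(1)[OF sE])
    fix x assume x: "x \<in> D"
    show "Es P A x \<in> D" by (rule D)
    have "Es P A (T x) = Es P A (P (T x))" by (simp only: PE)
    also have "P (T x) = T (P x)" by (rule commTD(3)[OF cP x])
    also have "Es P A (T (P x)) = T (P (Es P A x))" using commP_EB[OF A] by (simp add: commP_def)
    finally show "Es P A (T x) = T (Es P A x)" by (simp only: PE)
  qed
qed

lemma Es_null:
  assumes P: "localizing P U" and A: "A \<in> sets borel" and B: "cblinear B"
    and comm: "\<And>x. B (P x) = P (B x)" "\<And>x. B (T (P x)) = T (P (B x))"
    and lb: "\<And>w. w \<in> A \<Longrightarrow> \<exists>C. \<forall>x. norm (B (P x)) \<le> C * norm (T (B (P x)) - cscale (complex_of_real w) (B (P x)))"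
  shows "Es P A (B x) = 0"
proof -
  interpret bounded_sa G P "\<lambda>x. T (P x)" by (rule localizing_bounded_sa[OF P])
  show ?thesis
  proof (rule EB_null[where B = B, OF _ A])
    show "commP B" unfolding commP_def using B comm by simp
    fix w assume "w \<in> A"
    then obtain C where C: "\<And>x. norm (B (P x)) \<le> C * norm (T (B (P x)) - cscale (complex_of_real w) (B (P x)))"
      using lb by blast
    have "1 / (\<bar>C\<bar> + 1) * norm (B (P x)) \<le> norm (T (P (B (P x))) - w *\<^sub>R B (P x))" for x
    proof -
      have PB: "P (B (P x)) = B (P x)" by (simp add: comm(1)[symmetric] PP)
      have "norm (B (P x)) \<le> C * norm (T (B (P x)) - w *\<^sub>R B (P x))" using C[of x] by (simp add: cscale_of_real)
      also have "\<dots> \<le> (\<bar>C\<bar> + 1) * norm (T (B (P x)) - w *\<^sub>R B (P x))" by (intro mult_right_mono) auto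
      finally show ?thesis by (simp add: PB field_simps)
    qed
    moreover have "1 / (\<bar>C\<bar> + 1) > 0" by (intro divide_pos_pos) auto
    ultimately show "\<exists>k>0. \<forall>x. k * norm (B (P x)) \<le> norm (T (P (B (P x))) - w *\<^sub>R B (P x))" by blast
  qed
qed

lemma Es_resolvent_null:
  assumes P: "localizing P U" and A: "A \<in> sets borel" and rho: "\<And>w. w \<in> A \<Longrightarrow> complex_of_real w \<in> rho"
  shows "Es P A x = 0"
proof -
  have "\<exists>C. \<forall>x. norm (P x) \<le> C * norm (T (P x) - cscale (complex_of_real w) (P x))" if w: "w \<in> A" for w
  proof -
    from rho[OF w] obtain C where "\<And>x. x \<in> D \<Longrightarrow> norm x \<le> C * norm (T x - cscale (complex_of_real w) x)"
      unfolding resolvent_in_def by blast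
    then show ?thesis using localizingD(5)[OF P] by blast
  qed
  then show ?thesis by (rule Es_null[OF P A cblinear_id refl refl])
qed

text \<open>Both sides are compared with the join N. On the complement of P all points of A are
  resolvent points of T, so the spectral projection of N for A vanishes there and equals that of P;
  likewise for Q.\<close>

lemma Es_independent:
  assumes P: "localizing P U" and Q: "localizing Q V" and A: "A \<in> sets borel" "A \<subseteq> U" "A \<subseteq> V"
  shows "Es P A x = Es Q A x"
proof -
  obtain N where N: "localizing N (U \<union> V)" "\<And>x. N (P x) = P x" "\<And>x. P (N x) = P x"
    "\<And>x. N (Q x) = Q x" "\<And>x. Q (N x) = Q x"
    using localizing_join[OF P Q] by blast
  have main: "Es N A x = Es P A x"
    if P: "localizing P U" and AU: "A \<subseteq> U" and NP: "\<And>x. N (P x) = P x" "\<And>x. P (N x) = P x" for P U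
  proof -
    note cP = localizingD(1)[OF P] and cN = localizingD(1)[OF N(1)]
    note Pl = cblinear_simps[OF commTD(1)[OF cP]] and Nl = cblinear_simps[OF commTD(1)[OF cN]]
    have "Es P A x = Es N A (P x)"
    proof (rule spectral_restriction[OF localizing_bounded_sa[OF P] localizing_bounded_sa[OF N(1)]])
      show "T (N (P x)) = T (P x)" for x by (simp only: NP)
      show "P (T (N x)) = T (P x)" for x using commTD(3)[OF cP localizingD(5)[OF N(1)], of x] by (simp only: NP)
    qed (use NP A in auto)
    moreover have "Es N A (x - P x) = 0"
    proof (rule Es_null[OF N(1) A(1), of "\<lambda>x. x - P x"])
      show "cblinear (\<lambda>x. x - P x)" by (rule cblinear_sub[OF cblinear_id commTD(1)[OF cP]])
      show "N x - P (N x) = N (x - P x)" for x by (simp add: NP Nl)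
      show "T (N x) - P (T (N x)) = T (N (x - P x))" for x
        using commTD(3)[OF cP localizingD(5)[OF N(1)], of x]
        by (simp add: NP Nl T_diff localizingD(5)[OF N(1)] localizingD(5)[OF P])
      fix w assume "w \<in> A"
      then have "complex_of_real w \<in> resolvent_in (range (\<lambda>x. x - P x)) (D \<inter> range (\<lambda>x. x - P x)) T"
        using AU by (intro localizingD(8)[OF P]) auto
      then obtain C where C: "\<And>x. x \<in> D \<Longrightarrow> x - P x = x \<Longrightarrow> norm x \<le> C * norm (T x - cscale (complex_of_real w) x)"
        using resolvent_in_range_iff[OF localizing_complement[OF P]] by blast
      have "norm (N x - P (N x)) \<le> C * norm (T (N x - P (N x)) - cscale (complex_of_real w) (N x - P (N x)))" for x
        by (rule C) (simp_all add: csubspace_diff[OF sD] localizingD(2,5)[OF P] localizingD(5)[OF N(1)] Pl)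
      then show "\<exists>C. \<forall>x. norm (N x - P (N x)) \<le> C * norm (T (N x - P (N x)) - cscale (complex_of_real w) (N x - P (N x)))"
        by blast
    qed
    moreover have "Es N A (x - P x) = Es N A x - Es N A (P x)"
      using cblinear_simps(2)[OF commTD(1)[OF Es_props(2)[OF N(1) A(1)]]] .
    ultimately show ?thesis by simp
  qed
  show ?thesis using main[OF P A(2) N(2,3)] main[OF Q A(3) N(4,5)] by simp
qed

lemma resolvent_in_cong:
  assumes "\<And>x. x \<in> Dm \<Longrightarrow> S x = T x"
  shows "resolvent_in M Dm S = resolvent_in M Dm T"
  unfolding resolvent_in_def using assms
  by (simp add: inj_on_def cong: image_cong)

lemma Es_resolvent:
  assumes P: "localizing P U" and A: "A \<in> sets borel"
    and z: "Im z \<noteq> 0 \<or> (\<exists>\<eta>>0. A \<inter> {Re z - \<eta><..<Re z + \<eta>} = {})"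
  shows "z \<in> resolvent_in (range (Es P A)) (D \<inter> range (Es P A)) T"
proof -
  interpret bounded_sa G P "\<lambda>x. T (P x)" by (rule localizing_bounded_sa[OF P])
  have "D \<inter> range (Es P A) = range (Es P A)" using Es_props(3)[OF P A] by auto
  moreover have "resolvent_in (range (Es P A)) (range (Es P A)) (\<lambda>x. T (P x))
      = resolvent_in (range (Es P A)) (range (Es P A)) T"
    by (rule resolvent_in_cong) (use Es_props(4)[OF P A] in auto)
  ultimately show ?thesis using EB_resolvent[OF A z] by simp
qed

text \<open>Removing a null part from A opens the gap around a real point that
  \<open>Es_resolvent\<close> asks for.\<close>

lemma Es_diff_null:
  assumes P: "localizing P U" and A: "A \<in> sets borel" "B \<in> sets borel" and null: "\<And>x. Es P (A \<inter> B) x = 0"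
  shows "Es P A = Es P (A - B)"
proof
  fix x
  interpret bounded_sa G P "\<lambda>x. T (P x)" by (rule localizing_bounded_sa[OF P])
  have "Es P ((A - B) \<union> (A \<inter> B)) x = Es P (A - B) x + Es P (A \<inter> B) x"
    using A by (intro EB_add) auto
  moreover have "(A - B) \<union> (A \<inter> B) = A" by blast
  ultimately show "Es P A x = Es P (A - B) x" by (simp add: null)
qed

text \<open>A neighbourhood of z free of spectrum in A meets A in a null set. Deleting it changes
  nothing in the projection but separates A from z.\<close>

lemma Es_spectrum:
  assumes P: "localizing P U" and A: "A \<in> sets borel"
  shows "spectrum_in (range (Es P A)) (D \<inter> range (Es P A)) T \<subseteq> closure (- rho \<inter> complex_of_real ` A)"
proof
  fix z assume "z \<in> spectrum_in (range (Es P A)) (D \<inter> range (Es P A)) T"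
  then have nz: "z \<notin> resolvent_in (range (Es P A)) (D \<inter> range (Es P A)) T" by (simp add: spectrum_in_def)
  show "z \<in> closure (- rho \<inter> complex_of_real ` A)"
  proof (rule ccontr)
    assume "z \<notin> closure (- rho \<inter> complex_of_real ` A)"
    then obtain \<eta> where \<eta>: "\<eta> > 0" "\<And>w. w \<in> - rho \<inter> complex_of_real ` A \<Longrightarrow> dist w z \<ge> \<eta>"
      unfolding closure_approachable by (meson not_less)
    define B where "B = {Re z - \<eta><..<Re z + \<eta>}"
    have Im: "Im z = 0" using Es_resolvent[OF P A, of z] nz by blast
    have B: "B \<in> sets borel" by (simp add: B_def)
    have "Es P (A \<inter> B) x = 0" for x
    proof (rule Es_resolvent_null[OF P])
      fix w assume w: "w \<in> A \<inter> B"
      have "dist (complex_of_real w) z < \<eta>"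
      proof -
        have "complex_of_real w - z = complex_of_real (w - Re z)" using Im by (simp add: complex_eq_iff)
        then have "dist (complex_of_real w) z = \<bar>w - Re z\<bar>" unfolding dist_norm by (simp only: norm_of_real real_norm_def)
        then show ?thesis using w by (auto simp: B_def)
      qed
      then show "complex_of_real w \<in> rho" using \<eta>(2)[of "complex_of_real w"] w by force
    qed (use A B in auto)
    then have "Es P A = Es P (A - B)" by (rule Es_diff_null[OF P A B])
    moreover have "z \<in> resolvent_in (range (Es P (A - B))) (D \<inter> range (Es P (A - B))) T"
      using \<eta>(1) by (intro Es_resolvent[OF P]) (use A B in \<open>auto simp: B_def\<close>)
    ultimately show False using nz by simp
  qed
qed

text \<open>The range of 1 - E is the direct sum of the range of 1 - P and the spectral subspace of
  the complement of A. A point z of A lies in U and is regular for the first; for the second, the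
  part of the complement near z is null and can be deleted.\<close>

lemma Es_complement_spectrum:
  assumes P: "localizing P U" and A: "A \<in> sets borel" "A \<subseteq> U"
  shows "spectrum_in (range (\<lambda>x. x - Es P A x)) (D \<inter> range (\<lambda>x. x - Es P A x)) T
    \<subseteq> closure (- rho - complex_of_real ` A)"
proof
  fix z assume "z \<in> spectrum_in (range (\<lambda>x. x - Es P A x)) (D \<inter> range (\<lambda>x. x - Es P A x)) T"
  then have nz: "z \<notin> resolvent_in (range (\<lambda>x. x - Es P A x)) (D \<inter> range (\<lambda>x. x - Es P A x)) T"
    by (simp add: spectrum_in_def)
  interpret S: bounded_sa G P "\<lambda>x. T (P x)" by (rule localizing_bounded_sa[OF P])
  note El = cblinear_simps[OF commTD(1)[OF Es_props(2)[OF P A(1)]]]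
  have cE': "commT (\<lambda>x. x - Es P A x)" by (rule commT_sub[OF commT_id Es_props(2)[OF P A(1)]])
  have EE': "(x - Es P A x) - Es P A (x - Es P A x) = x - Es P A x" for x
    by (simp add: El Es_props(6)[OF P A(1)])
  have nrho: "z \<notin> rho"
  proof
    assume "z \<in> rho"
    then have "z \<in> resolvent_in (range (\<lambda>x::'a. x)) (D \<inter> range (\<lambda>x. x)) T" by simp
    from resolvent_restrict[OF commT_id _ cE' EE' _ this] show False using nz by simp
  qed
  show "z \<in> closure (- rho - complex_of_real ` A)"
  proof (rule ccontr)
    assume nc: "z \<notin> closure (- rho - complex_of_real ` A)"
    then have "z \<in> complex_of_real ` A" using nrho closure_subset[of "- rho - complex_of_real ` A"] by blast
    then obtain t where t: "t \<in> A" "z = complex_of_real t" by blast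
    obtain \<eta> where \<eta>: "\<eta> > 0" "\<And>w. w \<in> - rho - complex_of_real ` A \<Longrightarrow> dist w z \<ge> \<eta>"
      using nc unfolding closure_approachable by (meson not_less)
    have tU: "t \<in> U" using A(2) t(1) by blast
    define I where "I = {t - \<eta><..<t + \<eta>}"
    define C where "C = UNIV - A"
    have bor: "C \<in> sets borel" "I \<in> sets borel" using A(1) by (auto simp: C_def I_def)
    have "Es P (C \<inter> I) x = 0" for x
    proof (rule Es_resolvent_null[OF P])
      fix w assume w: "w \<in> C \<inter> I"
      have "dist (complex_of_real w) z = \<bar>w - t\<bar>"
        unfolding t(2) dist_norm of_real_diff[symmetric] norm_of_real by simp
      then have "dist (complex_of_real w) z < \<eta>" using w by (auto simp: I_def)
      then have "complex_of_real w \<notin> - rho - complex_of_real ` A" using \<eta>(2)[of "complex_of_real w"] by force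
      moreover have "complex_of_real w \<notin> complex_of_real ` A" using w by (auto simp: C_def)
      ultimately show "complex_of_real w \<in> rho" by blast
    qed (use bor in auto)
    then have "Es P C = Es P (C - I)" by (rule Es_diff_null[OF P bor])
    moreover have "z \<in> resolvent_in (range (Es P (C - I))) (D \<inter> range (Es P (C - I))) T"
      using \<eta>(1) t by (intro Es_resolvent[OF P]) (use bor in \<open>auto simp: I_def\<close>)
    ultimately have r2: "z \<in> resolvent_in (range (Es P C)) (D \<inter> range (Es P C)) T" by simp
    have r1: "z \<in> resolvent_in (range (\<lambda>x. x - P x)) (D \<inter> range (\<lambda>x. x - P x)) T"
      unfolding t(2) by (rule localizingD(8)[OF P tU])
    have Cx: "Es P C x = P x - Es P A x" for x unfolding C_def by (rule S.EB_compl[OF A(1)])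
    have sum: "(\<lambda>x. (x - P x) + Es P C x) = (\<lambda>x. x - Es P A x)" by (simp add: Cx)
    have "z \<in> resolvent_in (range (\<lambda>x. (x - P x) + Es P C x)) (D \<inter> range (\<lambda>x. (x - P x) + Es P C x)) T"
    proof (rule resolvent_direct_sum[OF localizing_complement[OF P] Es_props(2)[OF P bor(1)] Es_props(6)[OF P bor(1)] _ _ r1 r2])
      show "Es P C x - P (Es P C x) = 0" for x by (simp add: Es_props(4)[OF P bor(1)])
      show "Es P C (x - P x) = 0" for x
        by (simp add: cblinear_simps(2)[OF commTD(1)[OF Es_props(2)[OF P bor(1)]]] Es_props(5)[OF P bor(1)])
    qed
    then show False using nz by (simp only: sum)
  qed
qed

text \<open>The resolvents of \<open>T\<close> on \<open>L\<close> and on the range of \<open>1 - P\<close> are intertwined by \<open>1 - P\<close> and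
  have disjoint singularities, so they glue to an entire function vanishing at infinity.\<close>
lemma spectral_subspace_in_range:
  assumes P: "localizing P U" and \<Delta>: "compact \<Delta>" "\<Delta> \<subseteq> U"
    and L: "closed L" "csubspace L" "L \<subseteq> D" "T ` L \<subseteq> L"
    and spec: "spectrum_in L L T \<subseteq> complex_of_real ` \<Delta>" and x: "x \<in> L"
  shows "P x = x"
proof -
  define W where "W v = v - P v" for v
  have cW: "commT W" and WW: "W (W v) = W v" for v
    using localizing_complement[OF P] by (simp_all add: W_def[abs_def])
  have Wfun: "(\<lambda>x. x - P x) = W" by (simp add: W_def fun_eq_iff)
  note Wl = cblinear_simps[OF commTD(1)[OF cW]]
  interpret M: subspace_operator L L T
    by unfold_locales (use L in \<open>auto intro: T_add T_cscale\<close>)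
  interpret R: subspace_operator "range W" "D \<inter> range W" T
  proof
    show "closed (range W)" by (rule closed_range_projection[OF commTD(1)[OF cW] WW])
    show "csubspace (range W)" by (rule csubspace_range[OF commTD(1)[OF cW]])
    then show "csubspace (D \<inter> range W)" using sD by (auto simp: csubspace_def)
  qed (auto intro: T_add T_cscale)
  have cover: "l \<in> R.rho" if "l \<notin> M.rho" for l
  proof -
    have "l \<in> complex_of_real ` \<Delta>" using spec that by (auto simp: spectrum_in_def)
    then show ?thesis using localizingD(8)[OF P] \<Delta>(2) unfolding Wfun by blast
  qed
  obtain m where m: "\<And>v. v \<in> L \<Longrightarrow> norm (T v) \<le> m * norm v"
  proof -
    \<comment> \<open>Boundedness of T on L is what makes the resolvent on L decay at
      infinity.\<close>
    have "\<exists>M. \<forall>v\<in>L. norm (T v) \<le> M * norm v"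
    proof (rule closed_graph_bounded[OF L(1) csubspace_imp_subspace[OF L(2)] M.T_diff])
      show "T (c *\<^sub>R v) = c *\<^sub>R T v" if "v \<in> L" for c v
        using M.T_cscale[OF that, of "complex_of_real c"] by (simp add: cscale_of_real)
      show "T v = y" if "\<And>n. s n \<in> L" "s \<longlonglongrightarrow> v" "(\<lambda>n. T (s n)) \<longlonglongrightarrow> y" for s v y
        using T_closed(2)[OF _ that(2,3)] that(1) L(3) by blast
    qed
    then show ?thesis using that by blast
  qed
  obtain K where K: "K > 0" "\<And>v. norm (W v) \<le> K * norm v" using cblinear_bound[OF commTD(1)[OF cW]] by blast
  have "bounded (complex_of_real ` \<Delta>)"
    using \<Delta>(1) by (intro compact_imp_bounded compact_continuous_image continuous_intros)
  then obtain B where B: "\<And>l. l \<in> complex_of_real ` \<Delta> \<Longrightarrow> cmod l \<le> B"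
    unfolding bounded_iff by blast
  have far: "l \<in> M.rho" if "cmod l > B" for l
    using that B[of l] spec by (auto simp: spectrum_in_def)
  have zero: "cinner (W (M.res l x)) y = 0" if l: "l \<in> M.rho" for l y
  proof -
    define g1 where "g1 l = cinner (W (M.res l x)) y" for l
    define g2 where "g2 l = cinner (R.res l (W x)) y" for l
    have "g1 holomorphic_on M.rho" unfolding g1_def
      by (rule M.res_holomorphic[OF bounded_linear_compose[OF bounded_linear_cinner_left cblinear_bl[OF commTD(1)[OF cW]]] _ x])
         (simp add: Wl cinner_cscale_left)
    moreover have "g2 holomorphic_on R.rho" unfolding g2_def
      by (rule R.res_holomorphic[OF bounded_linear_cinner_left]) (simp_all add: cinner_cscale_left)
    moreover have "g1 l = g2 l" if l: "l \<in> M.rho" "l \<in> R.rho" for l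
    proof -
      have v: "M.res l x \<in> D" using M.res_in[OF l(1) x] L(3) by blast
      have "R.res l (W x) = W (M.res l x)"
      proof (rule R.res_eqI[OF l(2)])
        show "W (M.res l x) \<in> D \<inter> range W" using commTD(2)[OF cW v] by blast
        show "T (W (M.res l x)) - cscale l (W (M.res l x)) = W x"
          using commT_shift[OF cW v, of l] M.res_right[OF l(1) x] by simp
      qed
      then show ?thesis by (simp add: g1_def g2_def)
    qed
    ultimately have "(\<lambda>l. if l \<in> M.rho then g1 l else g2 l) holomorphic_on (M.rho \<union> R.rho)"
      by (intro holomorphic_on_If_Un M.open_rho R.open_rho)
    moreover have "M.rho \<union> R.rho = UNIV" using cover by blast
    ultimately have hol: "(\<lambda>l. if l \<in> M.rho then g1 l else g2 l) holomorphic_on UNIV" by simp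
    have lim: "((\<lambda>l. if l \<in> M.rho then g1 l else g2 l) \<longlongrightarrow> 0) at_infinity"
    proof (rule Lim_null_comparison)
      show "\<forall>\<^sub>F l in at_infinity. norm (if l \<in> M.rho then g1 l else g2 l) \<le> (K * norm x * norm y) / (- m + cmod l)"
        unfolding eventually_at_infinity
      proof (intro exI[of _ "max (B + 1) (m + 1)"] allI impI)
        fix l :: complex assume l: "max (B + 1) (m + 1) \<le> cmod l"
        then have lr: "l \<in> M.rho" by (intro far) auto
        have lm: "- m + cmod l > 0" using l by auto
        define v where "v = M.res l x"
        have vL: "v \<in> L" unfolding v_def by (rule M.res_in[OF lr x])
        have "cscale l v = T v - x" using M.res_right[OF lr x] by (simp add: v_def algebra_simps)
        then have "norm (cscale l v) \<le> norm (T v) + norm x"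
          using norm_triangle_ineq4[of "T v" x] by simp
        then have "cmod l * norm v \<le> m * norm v + norm x" using m[OF vL] by (simp add: norm_cscale)
        then have "norm v \<le> norm x / (- m + cmod l)" using lm by (simp add: field_simps)
        then have "K * norm v * norm y \<le> K * (norm x / (- m + cmod l)) * norm y"
          using K(1) by (intro mult_right_mono mult_left_mono) auto
        moreover have "cmod (g1 l) \<le> K * norm v * norm y"
          unfolding g1_def v_def[symmetric]
          by (rule order_trans[OF cinner_Cauchy_Schwarz]) (intro mult_right_mono K norm_ge_zero)
        ultimately show "norm (if l \<in> M.rho then g1 l else g2 l) \<le> (K * norm x * norm y) / (- m + cmod l)"
          using lr by simp
      qed
      have "filterlim (\<lambda>l::complex. - m + cmod l) at_top at_infinity"
        by (rule filterlim_tendsto_add_at_top[OF tendsto_const filterlim_norm_at_top])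
      then show "((\<lambda>l. (K * norm x * norm y) / (- m + cmod l)) \<longlongrightarrow> 0) at_infinity"
        by (intro tendsto_divide_0[OF tendsto_const] filterlim_at_top_imp_at_infinity)
    qed
    from Liouville_weak_0[OF hol lim, of l] show ?thesis using l by (simp add: g1_def)
  qed
  define l where "l = complex_of_real (\<bar>B\<bar> + 1)"
  have l: "l \<in> M.rho"
  proof (rule far)
    have "cmod l = \<bar>B\<bar> + 1" unfolding l_def norm_of_real by simp
    then show "B < cmod l" by simp
  qed
  \<comment> \<open>A single l suffices: applying T - l to this equation gives W x = 0.\<close>
  have W0: "W (M.res l x) = 0" by (rule cinner_all_0_imp_0[OF zero[OF l]])
  have v: "M.res l x \<in> D" using M.res_in[OF l x] L(3) by blast
  have "W x = 0" using commT_shift[OF cW v, of l] M.res_right[OF l x] W0 by (simp add: T_0)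
  then show ?thesis by (simp add: W_def)
qed

text \<open>L lies in \<open>range P\<close>, so it carries a form projection E, which commutes with
  T P because L is invariant and T is symmetric. Off \<Delta> the operator T - w is bounded below on
  L, so the spectral projection of the complement of \<Delta> annihilates L.\<close>

lemma Es_maximal:
  assumes P: "localizing P U" and \<Delta>: "compact \<Delta>" "\<Delta> \<subseteq> U"
    and L: "closed L" "csubspace L" "L \<subseteq> D" "T ` L \<subseteq> L"
    and spec: "spectrum_in L L T \<subseteq> complex_of_real ` \<Delta>" and x: "x \<in> L"
  shows "Es P \<Delta> x = x"
proof -
  interpret S: bounded_sa G P "\<lambda>x. T (P x)" by (rule localizing_bounded_sa[OF P])
  have PL: "P v = v" if "v \<in> L" for v by (rule spectral_subspace_in_range[OF P \<Delta> L spec that])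
  have "L \<subseteq> range P"
  proof
    fix v assume "v \<in> L"
    from PL[OF this] show "v \<in> range P" by (metis rangeI)
  qed
  then have "uniformly_positive G L" by (rule uniformly_positive_subset[OF S.P_pos])
  then obtain E where E: "cblinear E" "\<And>x. E (E x) = E x" "Gsym E" "range E = L"
    using form_projection[OF L(1,2)] by blast
  have EL: "E v \<in> L" for v using E(4) by blast
  have bE: "b (E v) w = b v (E w)" for v w using E(3) by (simp add: Gsym_def)
  have fixE: "E v = v" if "v \<in> L" for v using that E(4) projection_range_iff[of E v, OF E(2)] by blast
  have q0: "v = 0" if "v \<in> L" "\<And>w. w \<in> L \<Longrightarrow> b v w = 0" for v
    using S.q_eq_0[OF PL[OF that(1)]] that by (simp add: q_def)
  have EP: "E (P v) = P (E v)" for v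
  proof -
    have "E (P v) - E v = 0"
    proof (rule q0)
      show "E (P v) - E v \<in> L" by (intro csubspace_diff L EL)
      fix w assume w: "w \<in> L"
      have "b (E (P v)) w = b v w" by (simp add: bE fixE[OF w] S.P_b PL[OF w])
      then show "b (E (P v) - E v) w = 0" by (simp add: b_diff_left bE fixE[OF w])
    qed
    then show ?thesis by (simp add: PL[OF EL])
  qed
  have TL: "T v \<in> L" if "v \<in> L" for v using L(4) that by blast
  have ES: "E (T (P v)) = T (P (E v))" for v
  proof -
    have "E (T (P v)) - T (E v) = 0"
    proof (rule q0)
      show "E (T (P v)) - T (E v) \<in> L" by (intro csubspace_diff L EL TL)
      fix w assume w: "w \<in> L"
      have "b (E (T (P v))) w = b (T (P v)) w" by (simp add: bE fixE[OF w])
      also have "\<dots> = b v (T w)" using S.saD(2)[OF S.S, of v w] by (simp add: PL[OF w])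
      also have "\<dots> = b (E v) (T w)" by (simp add: bE fixE[OF TL[OF w]])
      also have "\<dots> = b (T (E v)) w" using L(3) EL w by (intro T_sym[symmetric]) auto
      finally show "b (E (T (P v)) - T (E v)) w = 0" by (simp add: b_diff_left)
    qed
    then show ?thesis by (simp add: PL[OF EL])
  qed
  have bor: "\<Delta> \<in> sets borel" using \<Delta>(1) by (intro borel_closed compact_imp_closed)
  have "Es P (UNIV - \<Delta>) (E x) = 0"
  proof (rule Es_null[OF P _ E(1) EP ES])
    fix w assume "w \<in> UNIV - \<Delta>"
    then have "complex_of_real w \<in> resolvent_in L L T" using spec by (auto simp: spectrum_in_def)
    then obtain C where "\<And>v. v \<in> L \<Longrightarrow> norm v \<le> C * norm (T v - cscale (complex_of_real w) v)"
      unfolding resolvent_in_def by blast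
    then show "\<exists>C. \<forall>v. norm (E (P v)) \<le> C * norm (T (E (P v)) - cscale (complex_of_real w) (E (P v)))"
      using EL by blast
  qed (use bor in auto)
  then show ?thesis using S.EB_compl[OF bor, of x] fixE[OF x] PL[OF x] by simp
qed

lemma positive_type_spectral_function:
  assumes J: "open J" "connected J"
    and up: "\<exists>t\<in>J. complex_of_real t islimpt ({z. 0 < Im z} \<inter> rho)"
    and low: "\<exists>t\<in>J. complex_of_real t islimpt ({z. Im z < 0} \<inter> rho)"
    and pt: "positive_type_set G D T (complex_of_real ` J)"
  shows "\<exists>E. local_spectral_function D T J E
     \<and> (\<forall>\<Delta>\<in>Rsys J. uniformly_positive G (range (E \<Delta>))
          \<and> (\<forall>x y. cinner (G (E \<Delta> x)) y = cinner (G x) (E \<Delta> y))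
          \<and> (compact \<Delta> \<longrightarrow> maximal_spectral_subspace D T (complex_of_real ` \<Delta>) (range (E \<Delta>))))"
proof -
  have loc: "\<exists>P. localizing P K" if K: "compact K" "K \<subseteq> J" for K
  proof (rule localizing_compact[OF _ K(1)])
    fix c assume "c \<in> K"
    then have "c \<in> J" using K by blast
    from regular_points[OF J(2) pt up low this] obtain r k e d where "regular_point c r k" "0 < e" "0 < d"
      "\<And>x. x \<in> D \<Longrightarrow> norm (T x - c *\<^sub>R x) \<le> e * norm x \<Longrightarrow> d * (norm x)\<^sup>2 \<le> q x" by blast
    then show "\<exists>P U. open U \<and> c \<in> U \<and> localizing P U" by (rule localizing_near_regular_point)
  qed
  have Rs: "\<Delta> \<in> sets borel" "compact (closure \<Delta>)" "closure \<Delta> \<subseteq> J" if "\<Delta> \<in> Rsys J" for \<Delta>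
    using that by (auto simp: Rsys_def compact_closure)
  \<comment> \<open>Each set uses some localizing projection for its own closure; by
    \<open>Es_independent\<close> any other one that covers the set gives the same operator.\<close>
  define E where "E \<Delta> = Es (SOME P. localizing P (closure \<Delta>)) \<Delta>" for \<Delta>
  have E_eq: "E \<Delta> = Es P \<Delta>" if "\<Delta> \<in> sets borel" "compact (closure \<Delta>)" "closure \<Delta> \<subseteq> J" "localizing P U" "\<Delta> \<subseteq> U" for \<Delta> P U
  proof
    fix x
    have "localizing (SOME P. localizing P (closure \<Delta>)) (closure \<Delta>)"
      by (rule someI_ex[OF loc[OF that(2,3)]])
    then show "E \<Delta> x = Es P \<Delta> x"
      unfolding E_def by (rule Es_independent[OF _ that(4,1) closure_subset that(5)])
  qed
  have ex1: "\<exists>P U. localizing P U \<and> \<Delta> \<subseteq> U \<and> E \<Delta> = Es P \<Delta>" if \<Delta>: "\<Delta> \<in> Rsys J" for \<Delta>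
  proof -
    obtain P where P: "localizing P (closure \<Delta>)" using loc[OF Rs(2,3)[OF \<Delta>]] by blast
    then show ?thesis using E_eq[OF Rs[OF \<Delta>] P closure_subset] closure_subset by blast
  qed
  have ex2: "\<exists>P U. localizing P U \<and> E \<Delta>1 = Es P \<Delta>1 \<and> E \<Delta>2 = Es P \<Delta>2
      \<and> E (\<Delta>1 \<inter> \<Delta>2) = Es P (\<Delta>1 \<inter> \<Delta>2) \<and> E (\<Delta>1 \<union> \<Delta>2) = Es P (\<Delta>1 \<union> \<Delta>2)"
    if \<Delta>1: "\<Delta>1 \<in> Rsys J" and \<Delta>2: "\<Delta>2 \<in> Rsys J" for \<Delta>1 \<Delta>2
  proof -
    \<comment> \<open>A common localizing projection for both sets reduces the algebraic laws to
      those of one spectral measure.\<close>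
    define K where "K = closure \<Delta>1 \<union> closure \<Delta>2"
    have K: "compact K" "K \<subseteq> J" using Rs[OF \<Delta>1] Rs[OF \<Delta>2] by (auto simp: K_def)
    obtain P where P: "localizing P K" using loc[OF K] by blast
    have "E A = Es P A" if A: "A \<in> sets borel" "A \<subseteq> K" for A
    proof (rule E_eq[OF A(1) _ _ P A(2)])
      have "closure A \<subseteq> K" using A(2) K(1) by (simp add: closure_minimal compact_imp_closed)
      then show "closure A \<subseteq> J" using K by blast
      show "compact (closure A)" using bounded_subset[OF compact_imp_bounded[OF K(1)] A(2)] by (simp add: compact_closure)
    qed
    moreover have "\<Delta>1 \<subseteq> K" "\<Delta>2 \<subseteq> K" using closure_subset by (auto simp: K_def)
    ultimately show ?thesis using P Rs(1)[OF \<Delta>1] Rs(1)[OF \<Delta>2] by (intro exI[of _ P] exI[of _ K]) auto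
  qed
  have lsf: "local_spectral_function D T J E"
    unfolding local_spectral_function_def op_spectrum_def spectrum_in_def[of UNIV]
  proof (intro conjI ballI allI impI)
    fix \<Delta> assume \<Delta>: "\<Delta> \<in> Rsys J"
    then obtain P U where P: "localizing P U" "\<Delta> \<subseteq> U" and Eq: "E \<Delta> = Es P \<Delta>" using ex1 by blast
    note pr = Es_props[OF P(1) Rs(1)[OF \<Delta>]]
    show "cblinear (E \<Delta>)" unfolding Eq by (rule commTD(1)[OF pr(2)])
    show "E \<Delta> \<circ> E \<Delta> = E \<Delta>" unfolding Eq by (simp add: fun_eq_iff pr(6))
    show "E \<Delta> \<circ> B = B \<circ> E \<Delta>" if "cblinear B \<and> (\<forall>x\<in>D. B x \<in> D \<and> B (T x) = T (B x))" for B
    proof -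
      have "commT B" using that by (simp add: commT_def)
      then show ?thesis unfolding Eq by (simp add: fun_eq_iff pr(1))
    qed
    show "spectrum_in (range (E \<Delta>)) (D \<inter> range (E \<Delta>)) T \<subseteq> closure (- rho \<inter> complex_of_real ` \<Delta>)"
      unfolding Eq by (rule Es_spectrum[OF P(1) Rs(1)[OF \<Delta>]])
    show "spectrum_in (range (\<lambda>x. x - E \<Delta> x)) (D \<inter> range (\<lambda>x. x - E \<Delta> x)) T
        \<subseteq> closure (- rho - complex_of_real ` \<Delta>)"
      unfolding Eq by (rule Es_complement_spectrum[OF P(1) Rs(1)[OF \<Delta>] P(2)])
  next
    fix \<Delta>1 \<Delta>2 assume \<Delta>: "\<Delta>1 \<in> Rsys J" "\<Delta>2 \<in> Rsys J"
    obtain P U where P: "localizing P U" and Eq: "E \<Delta>1 = Es P \<Delta>1" "E \<Delta>2 = Es P \<Delta>2"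
      "E (\<Delta>1 \<inter> \<Delta>2) = Es P (\<Delta>1 \<inter> \<Delta>2)" "E (\<Delta>1 \<union> \<Delta>2) = Es P (\<Delta>1 \<union> \<Delta>2)" using ex2[OF \<Delta>] by blast
    interpret S: bounded_sa G P "\<lambda>x. T (P x)" by (rule localizing_bounded_sa[OF P])
    show "E (\<Delta>1 \<inter> \<Delta>2) = E \<Delta>1 \<circ> E \<Delta>2"
      unfolding Eq by (simp add: fun_eq_iff S.EB_Int Rs(1)[OF \<Delta>(1)] Rs(1)[OF \<Delta>(2)])
    show "E (\<Delta>1 \<union> \<Delta>2) = (\<lambda>x. E \<Delta>1 x + E \<Delta>2 x)" if "\<Delta>1 \<inter> \<Delta>2 = {}"
      unfolding Eq by (simp add: fun_eq_iff S.EB_add Rs(1)[OF \<Delta>(1)] Rs(1)[OF \<Delta>(2)] that)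
  qed
  moreover have "uniformly_positive G (range (E \<Delta>))
      \<and> (\<forall>x y. cinner (G (E \<Delta> x)) y = cinner (G x) (E \<Delta> y))
      \<and> (compact \<Delta> \<longrightarrow> maximal_spectral_subspace D T (complex_of_real ` \<Delta>) (range (E \<Delta>)))"
    if \<Delta>: "\<Delta> \<in> Rsys J" for \<Delta>
  proof (intro conjI impI)
    obtain P U where P: "localizing P U" "\<Delta> \<subseteq> U" and Eq: "E \<Delta> = Es P \<Delta>" using ex1[OF \<Delta>] by blast
    note pr = Es_props[OF P(1) Rs(1)[OF \<Delta>]]
    show "uniformly_positive G (range (E \<Delta>))" unfolding Eq by (rule pr(8))
    show "\<forall>x y. cinner (G (E \<Delta> x)) y = cinner (G x) (E \<Delta> y)"
      using pr(7) unfolding Eq Gsym_def b_def .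
    assume comp: "compact \<Delta>"
    note lin = commTD(1)[OF pr(2)]
    have sub: "range (Es P \<Delta>) \<subseteq> D" using pr(3) by blast
    have "spectrum_in (range (Es P \<Delta>)) (range (Es P \<Delta>)) T \<subseteq> closure (- rho \<inter> complex_of_real ` \<Delta>)"
      using Es_spectrum[OF P(1) Rs(1)[OF \<Delta>]] sub by (simp add: Int_absorb1)
    \<comment> \<open>For compact \<Delta> the spectrum in \<Delta> is already closed, which removes
      the closure from the spectral inclusion.\<close>
    moreover have "closed (- rho \<inter> complex_of_real ` \<Delta>)"
      using open_rho comp by (intro closed_Int compact_imp_closed compact_continuous_image continuous_intros) auto
    ultimately have spec: "spectrum_in (range (Es P \<Delta>)) (range (Es P \<Delta>)) T \<subseteq> - rho \<inter> complex_of_real ` \<Delta>"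
      by (simp add: closure_closed)
    have inv: "T ` range (Es P \<Delta>) \<subseteq> range (Es P \<Delta>)"
    proof (rule image_subsetI)
      fix y assume "y \<in> range (Es P \<Delta>)"
      then obtain x where "y = Es P \<Delta> (Es P \<Delta> x)" using pr(6) by (metis rangeE)
      then have "T y = Es P \<Delta> (T (Es P \<Delta> x))" using commTD(3)[OF pr(2) pr(3)] by simp
      then show "T y \<in> range (Es P \<Delta>)" by blast
    qed
    have max: "L \<subseteq> range (Es P \<Delta>)"
      if L: "closed L \<and> csubspace L \<and> L \<subseteq> D \<and> T ` L \<subseteq> L
        \<and> spectrum_in L L T \<subseteq> - rho \<inter> complex_of_real ` \<Delta>" for L
    proof
      fix x assume x: "x \<in> L"
      have "Es P \<Delta> x = x" by (rule Es_maximal[OF P(1) comp P(2) _ _ _ _ _ x]) (use L in auto)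
      then show "x \<in> range (Es P \<Delta>)" by (metis rangeI)
    qed
    show "maximal_spectral_subspace D T (complex_of_real ` \<Delta>) (range (E \<Delta>))"
      unfolding maximal_spectral_subspace_def op_spectrum_def spectrum_in_def[of UNIV] Eq
      using closed_range_projection[OF lin pr(6)] csubspace_range[OF lin] sub inv spec max by blast
  qed
  ultimately show ?thesis by blast
qed

end

section \<open>Reduction of negative type to positive type\<close>

lemma bounded_selfadjoint_uminus: "bounded_selfadjoint G \<Longrightarrow> bounded_selfadjoint (\<lambda>x. - G x)"
  using cblinear_sub[OF cblinear_zero, of G] by (simp add: bounded_selfadjoint_def)

lemma G_symmetric_uminus: "G_symmetric G D T \<Longrightarrow> G_symmetric (\<lambda>x. - G x) D T"
  by (simp add: G_symmetric_def)

lemma negative_type_set_uminus: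
  assumes "negative_type_set G D T S"
  shows "positive_type_set (\<lambda>x. - G x) D T S"
proof -
  have "sigma_mm G D T \<subseteq> sigma_pp (\<lambda>x. - G x) D T"
  proof
    fix l assume l: "l \<in> sigma_mm G D T"
    have lim: "liminf (\<lambda>n. ereal (Re (cinner (- G (x n)) (x n)))) > 0"
      if "limsup (\<lambda>n. ereal (Re (cinner (G (x n)) (x n)))) < 0" for x :: "nat \<Rightarrow> 'a"
    proof -
      have "liminf (\<lambda>n. ereal (Re (cinner (- G (x n)) (x n)))) = - limsup (\<lambda>n. ereal (Re (cinner (G (x n)) (x n))))"
        using ereal_Liminf_uminus[of sequentially "\<lambda>n. ereal (Re (cinner (G (x n)) (x n)))"] by simp
      then show ?thesis using that by (simp add: ereal_less_uminus_reorder)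
    qed
    show "l \<in> sigma_pp (\<lambda>x. - G x) D T"
      unfolding sigma_pp_def mem_Collect_eq
    proof (intro conjI allI impI)
      show "l \<in> approx_point_spectrum D T" using l by (simp add: sigma_mm_def)
      fix x :: "nat \<Rightarrow> 'a"
      assume "(\<forall>n. x n \<in> D \<and> norm (x n) = 1) \<and> (\<lambda>n. T (x n) - cscale l (x n)) \<longlonglongrightarrow> 0"
      then have "limsup (\<lambda>n. ereal (Re (cinner (G (x n)) (x n)))) < 0"
        using l unfolding sigma_mm_def by blast
      then show "liminf (\<lambda>n. ereal (Re (cinner (- G (x n)) (x n)))) > 0" by (rule lim)
    qed
  qed
  then show ?thesis using assms unfolding negative_type_set_def positive_type_set_def by blast
qed

lemma uniformly_positive_uminus: "uniformly_positive (\<lambda>x. - G x) L \<Longrightarrow> uniformly_negative G L"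
  unfolding uniformly_positive_def uniformly_negative_def by (simp add: le_minus_iff)

theorem theoremt:
  fixes G0 :: "'a::complex_hilbert \<Rightarrow> 'a"
    and D :: "'a set" and T :: "'a \<Rightarrow> 'a" and J :: "real set"
  assumes G0: "bounded_selfadjoint G0"
    and T: "G_symmetric G0 D T"
    and J: "open J" "is_interval J"
    and acc_up: "\<exists>t\<in>J. complex_of_real t islimpt ({z. 0 < Im z} \<inter> op_resolvent D T)"
    and acc_low: "\<exists>t\<in>J. complex_of_real t islimpt ({z. Im z < 0} \<inter> op_resolvent D T)"
  shows "(positive_type_set G0 D T (complex_of_real ` J) \<longrightarrow>
            (\<exists>E. local_spectral_function D T J E
               \<and> (\<forall>\<Delta>\<in>Rsys J.
                    uniformly_positive G0 (range (E \<Delta>))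
                  \<and> (\<forall>x y. cinner (G0 (E \<Delta> x)) y = cinner (G0 x) (E \<Delta> y))
                  \<and> (compact \<Delta> \<longrightarrow>
                       maximal_spectral_subspace D T (complex_of_real ` \<Delta>) (range (E \<Delta>))))))
       \<and> (negative_type_set G0 D T (complex_of_real ` J) \<longrightarrow>
            (\<exists>E. local_spectral_function D T J E
               \<and> (\<forall>\<Delta>\<in>Rsys J.
                    uniformly_negative G0 (range (E \<Delta>))
                  \<and> (\<forall>x y. cinner (G0 (E \<Delta> x)) y = cinner (G0 x) (E \<Delta> y))
                  \<and> (compact \<Delta> \<longrightarrow>
                       maximal_spectral_subspace D T (complex_of_real ` \<Delta>) (range (E \<Delta>))))))"
proof -
  interpret gsymmetric G0 D T
    by unfold_locales (rule G0 T)+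
  \<comment> \<open>Changing the sign of \<open>G0\<close> exchanges the two types and leaves
    symmetry of T and of the projections unchanged.\<close>
  interpret neg: gsymmetric "\<lambda>x. - G0 x" D T
    by unfold_locales (rule bounded_selfadjoint_uminus[OF G0] G_symmetric_uminus[OF T])+
  have J': "open J" "connected J" using J by (simp_all add: is_interval_connected)
  note acc = acc_up[unfolded op_resolvent_rho] acc_low[unfolded op_resolvent_rho]
  show ?thesis
  proof (intro conjI impI)
    assume "positive_type_set G0 D T (complex_of_real ` J)"
    then show "\<exists>E. local_spectral_function D T J E
               \<and> (\<forall>\<Delta>\<in>Rsys J.
                    uniformly_positive G0 (range (E \<Delta>))
                  \<and> (\<forall>x y. cinner (G0 (E \<Delta> x)) y = cinner (G0 x) (E \<Delta> y))
                  \<and> (compact \<Delta> \<longrightarrow>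
                       maximal_spectral_subspace D T (complex_of_real ` \<Delta>) (range (E \<Delta>))))"
      by (rule positive_type_spectral_function[OF J' acc])
  next
    assume "negative_type_set G0 D T (complex_of_real ` J)"
    then have "positive_type_set (\<lambda>x. - G0 x) D T (complex_of_real ` J)"
      by (rule negative_type_set_uminus)
    from neg.positive_type_spectral_function[OF J' acc this] obtain E
      where E: "local_spectral_function D T J E"
        "\<And>\<Delta>. \<Delta> \<in> Rsys J \<Longrightarrow> uniformly_positive (\<lambda>x. - G0 x) (range (E \<Delta>))"
        "\<And>\<Delta> x y. \<Delta> \<in> Rsys J \<Longrightarrow> cinner (- G0 (E \<Delta> x)) y = cinner (- G0 x) (E \<Delta> y)"
        "\<And>\<Delta>. \<Delta> \<in> Rsys J \<Longrightarrow> compact \<Delta>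
          \<Longrightarrow> maximal_spectral_subspace D T (complex_of_real ` \<Delta>) (range (E \<Delta>))"
      by blast
    have "cinner (G0 (E \<Delta> x)) y = cinner (G0 x) (E \<Delta> y)" if "\<Delta> \<in> Rsys J" for \<Delta> x y
      using E(3)[OF that, of x y] by simp
    then show "\<exists>E. local_spectral_function D T J E
               \<and> (\<forall>\<Delta>\<in>Rsys J.
                    uniformly_negative G0 (range (E \<Delta>))
                  \<and> (\<forall>x y. cinner (G0 (E \<Delta> x)) y = cinner (G0 x) (E \<Delta> y))
                  \<and> (compact \<Delta> \<longrightarrow>
                       maximal_spectral_subspace D T (complex_of_real ` \<Delta>) (range (E \<Delta>))))"
      using E(1,4) uniformly_positive_uminus[OF E(2)] by (intro exI[of _ E]) blast
  qed
qed

end
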